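(* Let $F\in\mathbb{D}^{1,2}$ be such that $E[F]=0$, and write $F=\delta(u)$ for some $u\in\mathbb{D}^{1,2}(\mathfrak{H})$. Let $S\in\mathbb{D}^{1,4}$, and let $\eta\sim\mathcal{N}(0,1)$ be a standard Gaussian random variable independent of the isonormal process $X$. Set $$\Delta=3\Bigl(\frac{1}{\sqrt{2\pi}}E\bigl[|\langle u,DF\rangle_{\mathfrak{H}}-S^2|\bigr]+\frac{\sqrt2}{3}E\bigl[|\langle u,DS^2\rangle_{\mathfrak{H}}|\bigr]\Bigr)^{1/3}$$ $$\qquad\times\max\Bigl\{\frac{1}{\sqrt{2\pi}}E\bigl[|\langle u,DF\rangle_{\mathfrak{H}}-S^2|\bigr]+\frac{\sqrt2}{3}E\bigl[|\langle u,DS^2\rangle_{\mathfrak{H}}|\bigr],\ \sqrt{\frac{2}{\pi}}\,(2+E[S])+E[|F|]\Bigr\}^{2/3}.$$ Then $d_{\mathrm{W}}(F,S\eta)\leq\Delta$. Moreover, if there exists $\alpha\in(0,1]$ such that $E[|S|^{-\alpha}]<\infty$, then $$d_{\mathrm{Kol}}(F,S\eta)\leq\Delta^{\alpha/(\alpha+1)}\bigl(1+E[|S|^{-\alpha}]\bigr).$$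
   Context: $\mathfrak{H}$ is a real separable infinite-dimensional Hilbert space and $X=\{X(h):h\in\mathfrak{H}\}$ is an isonormal Gaussian process over $\mathfrak{H}$ on a probability space $(\Omega,\mathcal{F},P)$: a centered Gaussian family with $E[X(h)X(g)]=\langle h,g\rangle_{\mathfrak{H}}$; $\mathcal{F}$ is the $P$-completion of $\sigma(X)$. $D$ is the Malliavin derivative with respect to $X$; $\mathbb{D}^{k,p}(V)$ is the usual Malliavin--Sobolev space of $V$-valued random variables ($\mathbb{D}^{k,p}=\mathbb{D}^{k,p}(\mathbb{R})$). $\delta$ is the adjoint of $D$ (divergence operator, or Skorohod integral). The random variable $\eta$ is defined on an extension of the probability space. Distances between laws of real random variables: $d_{\mathrm{W}}(F,G)=\sup|E[\varphi(F)]-E[\varphi(G)]|$, the supremum being over all Lipschitz $\varphi:\mathbb{R}\to\mathbb{R}$ with Lipschitz constant at most $1$; $d_{\mathrm{Kol}}(F,G)=\sup_{x\in\mathbb{R}}|P(F\leq x)-P(G\leq x)|$. *)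

theory Defs
  imports "HOL-Probability.Probability"
begin

section \<open>Isonormal Gaussian processes\<close>

text \<open>The degenerate law (the point mass at 0) counts as Gaussian.\<close>

definition centered_gaussian :: "'w measure \<Rightarrow> ('w \<Rightarrow> real) \<Rightarrow> bool" where
  "centered_gaussian M Y \<longleftrightarrow> Y \<in> borel_measurable M \<and>
     (distr M borel Y = return borel 0 \<or>
      (\<exists>\<sigma>>0. distributed M lborel Y (normal_density 0 \<sigma>)))"

definition centered_gaussian_family :: "'w measure \<Rightarrow> ('h \<Rightarrow> 'w \<Rightarrow> real) \<Rightarrow> bool" where
  "centered_gaussian_family M X \<longleftrightarrow>
     (\<forall>I c. finite I \<longrightarrow> centered_gaussian M (\<lambda>\<omega>. \<Sum>h\<in>I. c h * X h \<omega>))"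

definition process_algebra :: "'w measure \<Rightarrow> ('h \<Rightarrow> 'w \<Rightarrow> real) \<Rightarrow> 'w measure" where
  "process_algebra M X =
     sigma (space M) {X h -` A \<inter> space M | h A. A \<in> sets borel}"

text \<open>The last conjunct says that the events are the completion of the sigma-algebra of \<open>X\<close>.\<close>

definition isonormal :: "'w measure \<Rightarrow> ('h::real_inner \<Rightarrow> 'w \<Rightarrow> real) \<Rightarrow> bool" where
  "isonormal M X \<longleftrightarrow>
     prob_space M \<and>
     centered_gaussian_family M X \<and>
     (\<forall>h g. (\<integral>\<omega>. X h \<omega> * X g \<omega> \<partial>M) = h \<bullet> g) \<and>
     sets M = sets (completion (restr_to_subalg M (process_algebra M X)))"

section \<open>Smooth cylindrical random variables\<close>

text \<open>A function on \<open>n\<close>-dimensional Euclidean space, with \<open>n\<close> varying, is rendered as a function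
  of sequences that depends on the first \<open>n\<close> coordinates only; for such functions, continuity in
  the product topology is continuity in these coordinates. Smooth means that the partial
  derivatives of all orders exist and are continuous.\<close>

definition pdv :: "nat \<Rightarrow> ((nat \<Rightarrow> real) \<Rightarrow> real) \<Rightarrow> (nat \<Rightarrow> real) \<Rightarrow> real" where
  "pdv i f x = deriv (\<lambda>t. f (x(i := t))) (x i)"

definition smooth_fun :: "nat \<Rightarrow> ((nat \<Rightarrow> real) \<Rightarrow> real) \<Rightarrow> bool" where
  "smooth_fun n f \<longleftrightarrow>
     (\<forall>x y. (\<forall>i<n. x i = y i) \<longrightarrow> f x = f y) \<and>
     (\<forall>is. set is \<subseteq> {..<n} \<longrightarrow>
        continuous_on UNIV (foldr pdv is f) \<and>
        (\<forall>i<n. \<forall>x. (\<lambda>t. foldr pdv is f (x(i := t))) field_differentiable at (x i)))"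

definition compact_support_fun :: "nat \<Rightarrow> ((nat \<Rightarrow> real) \<Rightarrow> real) \<Rightarrow> bool" where
  "compact_support_fun n f \<longleftrightarrow> (\<exists>R. \<forall>x. (\<exists>i<n. R < \<bar>x i\<bar>) \<longrightarrow> f x = 0)"

text \<open>The graph of \<open>D\<close> on the smooth cylindrical random variables \<open>F = f(X(h\<^sub>0), \<dots>, X(h\<^sub>n\<^sub>-\<^sub>1))\<close>,
  where \<open>DF\<close> is the sum of \<open>(\<partial>\<^sub>i f)(X(h\<^sub>0), \<dots>, X(h\<^sub>n\<^sub>-\<^sub>1)) h\<^sub>i\<close>. We take \<open>f\<close> smooth with compact
  support; the other common classes (bounded derivatives, derivatives of polynomial growth) have
  the same closures.\<close>

definition smooth_cylindrical ::
  "('h::real_inner \<Rightarrow> 'w \<Rightarrow> real) \<Rightarrow> (('w \<Rightarrow> real) \<times> ('w \<Rightarrow> 'h)) set" where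
  "smooth_cylindrical X =
     {(\<lambda>\<omega>. f (\<lambda>i. X (h i) \<omega>), \<lambda>\<omega>. \<Sum>i<n. pdv i f (\<lambda>j. X (h j) \<omega>) *\<^sub>R h i) | n f h.
        1 \<le> n \<and> smooth_fun n f \<and> compact_support_fun n f}"

section \<open>Malliavin derivative, Sobolev spaces and divergence\<close>

definition Lp_tendsto ::
  "'w measure \<Rightarrow> real \<Rightarrow> (nat \<Rightarrow> 'w \<Rightarrow> 'b::real_normed_vector) \<Rightarrow> ('w \<Rightarrow> 'b) \<Rightarrow> bool" where
  "Lp_tendsto M p G Y \<longleftrightarrow>
     (\<lambda>n. \<integral>\<^sup>+\<omega>. ennreal (norm (G n \<omega> - Y \<omega>) powr p) \<partial>M) \<longlonglongrightarrow> 0"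

text \<open>The graph of the closure of \<open>D\<close> as an operator from \<open>L\<^sup>p\<close> to the \<open>H\<close>-valued \<open>L\<^sup>p\<close>.\<close>

definition malliavin_graph ::
  "'w measure \<Rightarrow> ('h::real_inner \<Rightarrow> 'w \<Rightarrow> real) \<Rightarrow> real \<Rightarrow> (('w \<Rightarrow> real) \<times> ('w \<Rightarrow> 'h)) set" where
  "malliavin_graph M X p =
     {(F, Z). F \<in> borel_measurable M \<and> Z \<in> borel_measurable M \<and>
        (\<exists>G W. (\<forall>n. (G n, W n) \<in> smooth_cylindrical X) \<and>
           Lp_tendsto M p G F \<and> Lp_tendsto M p W Z)}"

definition sobolev :: "'w measure \<Rightarrow> ('h::real_inner \<Rightarrow> 'w \<Rightarrow> real) \<Rightarrow> real \<Rightarrow> ('w \<Rightarrow> real) set" where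
  "sobolev M X p = Domain (malliavin_graph M X p)"

text \<open>\<open>p = 1\<close> gives the largest domain, on which \<open>D\<close> extends all its versions for \<open>p \<ge> 1\<close>.
  Since \<open>D\<close> is closable, the chosen version is unique up to almost sure equality.\<close>

definition malliavin_D ::
  "'w measure \<Rightarrow> ('h::real_inner \<Rightarrow> 'w \<Rightarrow> real) \<Rightarrow> ('w \<Rightarrow> real) \<Rightarrow> 'w \<Rightarrow> 'h" where
  "malliavin_D M X F = (SOME Z. (F, Z) \<in> malliavin_graph M X 1)"

text \<open>For \<open>V\<close>-valued random variables the smooth elements are finite sums of \<open>F\<^sub>j v\<^sub>j\<close>, represented
  by lists of triples \<open>(F\<^sub>j, DF\<^sub>j, v\<^sub>j)\<close>. The derivative is the sum of the tensors \<open>DF\<^sub>j \<otimes> v\<^sub>j\<close>; an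
  element of the algebraic tensor product of \<open>H\<close> and \<open>V\<close> is represented by a list of pairs, with
  the norm induced by the inner product \<open>\<langle>a \<otimes> v, b \<otimes> w\<rangle> = \<langle>a, b\<rangle> \<langle>v, w\<rangle>\<close>.\<close>

definition tensor_norm :: "('h::real_inner \<times> 'v::real_inner) list \<Rightarrow> real" where
  "tensor_norm ts = sqrt (\<Sum>(a, v)\<leftarrow>ts. \<Sum>(b, w)\<leftarrow>ts. (a \<bullet> b) * (v \<bullet> w))"

definition tensor_diff ::
  "('h::real_inner \<times> 'v::real_inner) list \<Rightarrow> ('h \<times> 'v) list \<Rightarrow> ('h \<times> 'v) list" where
  "tensor_diff ts ts' = ts @ map (\<lambda>(a, v). (- a, v)) ts'"

definition smooth_vec ::
  "('h::real_inner \<Rightarrow> 'w \<Rightarrow> real) \<Rightarrow> (('w \<Rightarrow> real) \<times> ('w \<Rightarrow> 'h) \<times> 'v::real_inner) list set" where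
  "smooth_vec X = {U. \<forall>(F, Z, v)\<in>set U. (F, Z) \<in> smooth_cylindrical X}"

definition vec_val :: "(('w \<Rightarrow> real) \<times> ('w \<Rightarrow> 'h) \<times> 'v::real_inner) list \<Rightarrow> 'w \<Rightarrow> 'v" where
  "vec_val U \<omega> = (\<Sum>(F, Z, v)\<leftarrow>U. F \<omega> *\<^sub>R v)"

definition vec_D :: "(('w \<Rightarrow> real) \<times> ('w \<Rightarrow> 'h) \<times> 'v) list \<Rightarrow> 'w \<Rightarrow> ('h \<times> 'v) list" where
  "vec_D U \<omega> = map (\<lambda>(F, Z, v). (Z \<omega>, v)) U"

text \<open>The completion of the smooth \<open>V\<close>-valued random variables for the norm of order \<open>(1, p)\<close>,
  realised inside the \<open>V\<close>-valued \<open>L\<^sup>p\<close>: limits in \<open>L\<^sup>p\<close> of sequences whose derivatives are Cauchy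
  in the \<open>L\<^sup>p\<close> norm with values in the tensor product.\<close>

definition sobolev_vec ::
  "'w measure \<Rightarrow> ('h::real_inner \<Rightarrow> 'w \<Rightarrow> real) \<Rightarrow> real \<Rightarrow> ('w \<Rightarrow> 'v::real_inner) set" where
  "sobolev_vec M X p =
     {u. u \<in> borel_measurable M \<and>
        (\<exists>U. (\<forall>n. U n \<in> smooth_vec X) \<and>
           Lp_tendsto M p (\<lambda>n. vec_val (U n)) u \<and>
           (\<forall>\<epsilon>>0. \<exists>N. \<forall>m\<ge>N. \<forall>n\<ge>N.
              (\<integral>\<^sup>+\<omega>. ennreal (tensor_norm (tensor_diff (vec_D (U m) \<omega>) (vec_D (U n) \<omega>)) powr p) \<partial>M)
                < ennreal \<epsilon>))}"

text \<open>The graph of the adjoint of \<open>D\<close>: \<open>(u, F)\<close> belongs to it if and only if \<open>u\<close> is in the domain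
  of the divergence and \<open>F = \<delta>(u)\<close> almost surely.\<close>

definition divergence_graph ::
  "'w measure \<Rightarrow> ('h::real_inner \<Rightarrow> 'w \<Rightarrow> real) \<Rightarrow> (('w \<Rightarrow> 'h) \<times> ('w \<Rightarrow> real)) set" where
  "divergence_graph M X =
     {(u, F). u \<in> borel_measurable M \<and> integrable M (\<lambda>\<omega>. (norm (u \<omega>))\<^sup>2) \<and>
        F \<in> borel_measurable M \<and> integrable M (\<lambda>\<omega>. (F \<omega>)\<^sup>2) \<and>
        (\<forall>G\<in>sobolev M X 2.
           (\<integral>\<omega>. G \<omega> * F \<omega> \<partial>M) = (\<integral>\<omega>. malliavin_D M X G \<omega> \<bullet> u \<omega> \<partial>M))}"

section \<open>Distances between laws\<close>

definition wasserstein_dist :: "'w measure \<Rightarrow> ('w \<Rightarrow> real) \<Rightarrow> ('w \<Rightarrow> real) \<Rightarrow> ereal" where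
  "wasserstein_dist M F G =
     (SUP \<phi>\<in>{\<phi> :: real \<Rightarrow> real. 1-lipschitz_on UNIV \<phi>}.
        ereal \<bar>(\<integral>\<omega>. \<phi> (F \<omega>) \<partial>M) - (\<integral>\<omega>. \<phi> (G \<omega>) \<partial>M)\<bar>)"

definition kolmogorov_dist :: "'w measure \<Rightarrow> ('w \<Rightarrow> real) \<Rightarrow> ('w \<Rightarrow> real) \<Rightarrow> real" where
  "kolmogorov_dist M F G =
     (SUP x. \<bar>measure M {\<omega> \<in> space M. F \<omega> \<le> x} - measure M {\<omega> \<in> space M. G \<omega> \<le> x}\<bar>)"

section \<open>The bound\<close>

text \<open>\<open>E[|S|\<^sup>-\<^sup>\<alpha>]\<close>, with value infinity if \<open>S = 0\<close> with positive probability (the library has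
  \<open>0 powr (-\<alpha>) = 0\<close>).\<close>

definition neg_moment :: "'w measure \<Rightarrow> ('w \<Rightarrow> real) \<Rightarrow> real \<Rightarrow> ennreal" where
  "neg_moment M S \<alpha> =
     (\<integral>\<^sup>+\<omega>. (if S \<omega> = 0 then \<infinity> else ennreal (\<bar>S \<omega>\<bar> powr (- \<alpha>))) \<partial>M)"

definition stein_term ::
  "'w measure \<Rightarrow> ('h::real_inner \<Rightarrow> 'w \<Rightarrow> real) \<Rightarrow> ('w \<Rightarrow> 'h) \<Rightarrow> ('w \<Rightarrow> real) \<Rightarrow> ('w \<Rightarrow> real) \<Rightarrow> real" where
  "stein_term M X u F S =
     1 / sqrt (2 * pi) * (\<integral>\<omega>. \<bar>u \<omega> \<bullet> malliavin_D M X F \<omega> - (S \<omega>)\<^sup>2\<bar> \<partial>M) +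
     sqrt 2 / 3 * (\<integral>\<omega>. \<bar>u \<omega> \<bullet> malliavin_D M X (\<lambda>\<omega>'. (S \<omega>')\<^sup>2) \<omega>\<bar> \<partial>M)"

definition Delta ::
  "'w measure \<Rightarrow> ('h::real_inner \<Rightarrow> 'w \<Rightarrow> real) \<Rightarrow> ('w \<Rightarrow> 'h) \<Rightarrow> ('w \<Rightarrow> real) \<Rightarrow> ('w \<Rightarrow> real) \<Rightarrow> real" where
  "Delta M X u F S =
     3 * stein_term M X u F S powr (1 / 3) *
     (max (stein_term M X u F S)
          (sqrt (2 / pi) * (2 + (\<integral>\<omega>. S \<omega> \<partial>M)) + (\<integral>\<omega>. \<bar>F \<omega>\<bar> \<partial>M))) powr (2 / 3)"

section \<open>Extensions of the probability space\<close>

definition extension_of :: "'e measure \<Rightarrow> ('e \<Rightarrow> 'w) \<Rightarrow> 'w measure \<Rightarrow> bool" where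
  "extension_of M' \<pi> M \<longleftrightarrow> prob_space M' \<and> \<pi> \<in> measurable M' M \<and> distr M' M \<pi> = M"

end

theory Submission
  imports Defs
begin

text \<open>Totality of the functions \<open>exp (i X g)\<close> in \<open>L\<^sup>1\<close> makes \<open>X h\<close> independent of the \<open>X g\<close> with
  \<open>g\<close> orthogonal to \<open>h\<close>, which gives Gaussian integration by parts; by totality again, \<open>D\<close> is closable, and the
  duality of \<open>D\<close> and \<open>\<delta>\<close> extends to \<open>E[\<psi>(aF + bS) F] = E[\<psi>'(aF + bS) \<langle>u, a DF + b DS\<rangle>]\<close>. For a smooth test
  function \<open>\<phi>\<close> one differentiates \<open>E[\<phi>(sin t F + cos t S \<eta>)]\<close> in \<open>t\<close> and gets a bound by
  \<open>E|\<langle>u, DF\<rangle> - S\<^sup>2|\<close> and \<open>E|\<langle>u, DS\<^sup>2\<rangle>|\<close> with the second and third derivatives of \<open>\<phi>\<close>. A Lipschitz \<open>\<phi>\<close> is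
  replaced by its Gaussian mollification at scale \<open>\<epsilon>\<close>. As \<open>S\<close> may be negative, \<open>E[S]\<close> in the bound
  can be far below \<open>E|S|\<close>; this loss is recovered from the mollification error of \<open>S \<eta>\<close>, which is
  \<open>E[sqrt (S\<^sup>2 + \<epsilon>\<^sup>2) - |S|]\<close> and enters with the opposite sign for the test function \<open>|x|\<close>. The Kolmogorov bound
  follows from the Wasserstein bound by a piecewise linear approximation of indicators.\<close>

section \<open>Functions determined by their Fourier transforms\<close>

text \<open>\<open>malliavin_D\<close> is a choice from a graph, so closability is needed before the
  two expectations in \<open>Delta\<close> can be evaluated at all: it makes every explicit
  derivative a valid version. The coefficients in \<open>Delta\<close> have three sources.
  Interpolation over a quarter period contributes the integrals of sin t cos t and (cos t)^3, which
  are 1/2 and 2/3. Mollification at scale \<epsilon> bounds the second derivative by E|\<eta>| /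
  \<epsilon> = sqrt (2 / pi) / \<epsilon> and the third by E|\<eta>^2 - 1| / \<epsilon>^2 \<le> sqrt
  2 / \<epsilon>^2, because every derivative beyond the first is moved onto the Gaussian weight.
  Finally the 2 in \<open>D(S\<^sup>2) = 2 S DS\<close> turns 2 sqrt 2 / 3 into sqrt 2 / 3. The
  optimisation balances a multiple of \<epsilon> against a multiple of 1 / \<epsilon>^2, which
  produces the exponents 1/3 and 2/3; the maximum in \<open>Delta\<close> keeps the chosen
  \<epsilon> at most 1, where 1 / \<epsilon> can be absorbed into 1 / \<epsilon>^2. The leading 3 is
  the cost of the case in which this maximum falls below 2 sqrt (2 / pi), possible only for negative
  E[S].\<close>

lemma integrable_bounded_mult:
  fixes f g :: "'a \<Rightarrow> real"
  assumes "integrable M g" "f \<in> borel_measurable M" "\<And>x. \<bar>f x\<bar> \<le> K"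
  shows "integrable M (\<lambda>x. f x * g x)"
proof -
  note [measurable] = borel_measurable_integrable[OF assms(1)] assms(2)
  have "\<bar>f x\<bar> * \<bar>g x\<bar> \<le> \<bar>K\<bar> * \<bar>g x\<bar>" for x
    using assms(3)[of x] by (intro mult_right_mono) auto
  then show ?thesis
    by (intro Bochner_Integration.integrable_bound[OF integrable_mult_right[OF assms(1), of "\<bar>K\<bar>"]])
      (auto simp: abs_mult)
qed

text \<open>Frequency 0 shows that the positive and the negative part of \<open>Y\<close> have the
  same mass \<open>m\<close>. Divided by \<open>m\<close> they are probability densities, and the
  remaining frequencies say that \<open>U\<close> has the same characteristic function under both,
  so Levy's uniqueness theorem applies. If \<open>m = 0\<close>, then \<open>Y\<close> vanishes
  almost everywhere.\<close>

lemma integral_indicator_vimage_eq_0_if_fourier_eq_0: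
  fixes U Y :: "'a \<Rightarrow> real"
  assumes U [measurable]: "U \<in> borel_measurable M" and Y: "integrable M Y"
    and cos0: "\<And>s. (\<integral>x. cos (s * U x) * Y x \<partial>M) = 0"
    and sin0: "\<And>s. (\<integral>x. sin (s * U x) * Y x \<partial>M) = 0"
    and A [measurable]: "A \<in> sets borel"
  shows "(\<integral>x. indicator A (U x) * Y x \<partial>M) = 0"
proof -
  note [measurable] = borel_measurable_integrable[OF Y]
  define m where "m = (\<integral>x. max 0 (Y x) \<partial>M)"
  have ip: "integrable M (\<lambda>x. max 0 (Y x))" and ineg: "integrable M (\<lambda>x. max 0 (- Y x))"
    using Y by auto
  have Y_eq: "Y x = max 0 (Y x) - max 0 (- Y x)" for x by auto
  have "(\<integral>x. Y x \<partial>M) = 0" using cos0[of 0] by simp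
  then have m2: "m = (\<integral>x. max 0 (- Y x) \<partial>M)"
    unfolding m_def using ip ineg by (subst (asm) Y_eq, subst (asm) Bochner_Integration.integral_diff) auto
  have m_ge: "m \<ge> 0" unfolding m_def by (simp add: integral_nonneg_AE)
  show ?thesis
  proof (cases "m = 0")
    case True
    have "AE x in M. max 0 (Y x) = 0"
      using True ip unfolding m_def by (subst (asm) integral_nonneg_eq_0_iff_AE) auto
    moreover have "AE x in M. max 0 (- Y x) = 0"
      using True ineg unfolding m2 by (subst (asm) integral_nonneg_eq_0_iff_AE) auto
    ultimately have "AE x in M. indicator A (U x) * Y x = 0" by eventually_elim (auto simp: max_def split: if_splits)
    then show ?thesis by (simp cong: integral_cong_AE add: integral_eq_zero_AE)
  next
    case False
    then have m: "m > 0" using m_ge by simp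
    \<comment> \<open>One definition serves both parts: \<open>D Y\<close> is the normalised
      positive part and \<open>D (\<lambda>x. - Y x)\<close> the normalised negative part.\<close>
    define D where "D g = density M (\<lambda>x. ennreal (max 0 (g x) / m))" for g :: "'a \<Rightarrow> real"
    have D_prob: "real_distribution (distr (D g) borel U)"
      if [measurable]: "g \<in> borel_measurable M" and g: "integrable M (\<lambda>x. max 0 (g x))" "(\<integral>x. max 0 (g x) \<partial>M) = m" for g
    proof -
      have "emeasure (D g) (space (D g)) = (\<integral>\<^sup>+x. ennreal (max 0 (g x) / m) \<partial>M)"
        unfolding D_def by (simp add: emeasure_density cong: nn_integral_cong)
      also have "\<dots> = ennreal (\<integral>x. max 0 (g x) / m \<partial>M)"
        using g m by (intro nn_integral_eq_integral) auto
      also have "\<dots> = 1" using g m by simp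
      finally have "prob_space (D g)" by (rule prob_spaceI)
      moreover have "U \<in> measurable (D g) borel" by (simp add: D_def)
      ultimately show ?thesis by (intro prob_space.real_distribution_distr)
    qed
    have D_int: "(\<integral>x. h x \<partial>distr (D g) borel U) = (\<integral>x. (max 0 (g x) / m) *\<^sub>R h (U x) \<partial>M)"
      if [measurable]: "g \<in> borel_measurable M" "h \<in> borel_measurable borel"
      for g and h :: "real \<Rightarrow> 'b::{banach, second_countable_topology}"
    proof -
      have "(\<integral>x. h x \<partial>distr (D g) borel U) = (\<integral>x. h (U x) \<partial>D g)"
        by (subst integral_distr) (auto simp: D_def)
      also have "\<dots> = (\<integral>x. (max 0 (g x) / m) *\<^sub>R h (U x) \<partial>M)"
        unfolding D_def using m by (subst integral_density) auto
      finally show ?thesis .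
    qed
    have "char (distr (D Y) borel U) = char (distr (D (\<lambda>x. - Y x)) borel U)"
    proof
      fix t
      have i1: "integrable M (\<lambda>x. complex_of_real (max 0 (Y x)) * iexp (t * U x))"
        using ip by (rule Bochner_Integration.integrable_bound) (auto simp: norm_mult)
      have i2: "integrable M (\<lambda>x. complex_of_real (max 0 (- Y x)) * iexp (t * U x))"
        using ineg by (rule Bochner_Integration.integrable_bound) (auto simp: norm_mult)
      have ic: "integrable M (\<lambda>x. cos (t * U x) * Y x)"
        by (rule integrable_bounded_mult[OF Y, of _ 1]) auto
      have isn: "integrable M (\<lambda>x. sin (t * U x) * Y x)"
        by (rule integrable_bounded_mult[OF Y, of _ 1]) auto
      have "(\<integral>x. complex_of_real (max 0 (Y x)) * iexp (t * U x) \<partial>M) - (\<integral>x. complex_of_real (max 0 (- Y x)) * iexp (t * U x) \<partial>M)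
        = (\<integral>x. complex_of_real (max 0 (Y x)) * iexp (t * U x) - complex_of_real (max 0 (- Y x)) * iexp (t * U x) \<partial>M)"
        using i1 i2 by simp
      also have "\<dots> = (\<integral>x. complex_of_real (cos (t * U x) * Y x) + \<i> * complex_of_real (sin (t * U x) * Y x) \<partial>M)"
        by (intro Bochner_Integration.integral_cong refl)
          (auto simp: complex_eq_iff max_def Re_exp Im_exp)
      also have "\<dots> = (\<integral>x. complex_of_real (cos (t * U x) * Y x) \<partial>M) + (\<integral>x. \<i> * complex_of_real (sin (t * U x) * Y x) \<partial>M)"
        using ic isn by (intro Bochner_Integration.integral_add) (auto intro!: integrable_of_real simp del: of_real_mult)
      also have "\<dots> = 0"
        using cos0[of t] sin0[of t] ic isn
        by (simp del: of_real_mult add: integral_complex_of_real)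
      finally show "char (distr (D Y) borel U) t = char (distr (D (\<lambda>x. - Y x)) borel U) t"
        unfolding char_def using m by (simp add: D_int scaleR_conv_of_real mult.commute)
    qed
    then have eq: "distr (D Y) borel U = distr (D (\<lambda>x. - Y x)) borel U"
      by (intro Levy_uniqueness D_prob) (use ip ineg m2 in \<open>auto simp: m_def\<close>)
    have j1: "integrable M (\<lambda>x. max 0 (Y x) * indicator A (U x))"
      using ip by (rule Bochner_Integration.integrable_bound) (auto simp: indicator_def)
    have j2: "integrable M (\<lambda>x. max 0 (- Y x) * indicator A (U x))"
      using ineg by (rule Bochner_Integration.integrable_bound) (auto simp: indicator_def)
    have "(\<integral>x. (max 0 (Y x) / m) *\<^sub>R indicator A (U x) \<partial>M) = (\<integral>x. (max 0 (- Y x) / m) *\<^sub>R (indicator A (U x) :: real) \<partial>M)"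
      by (subst (1 2) D_int[symmetric]) (auto simp: eq)
    then have "(\<integral>x. max 0 (Y x) * indicator A (U x) \<partial>M) = (\<integral>x. max 0 (- Y x) * (indicator A (U x) :: real) \<partial>M)"
      using m by simp
    moreover have "(\<integral>x. indicator A (U x) * Y x \<partial>M) = (\<integral>x. max 0 (Y x) * indicator A (U x) - max 0 (- Y x) * indicator A (U x) \<partial>M)"
      by (intro Bochner_Integration.integral_cong refl) (auto simp: max_def)
    ultimately show ?thesis using j1 j2 by simp
  qed
qed

text \<open>In real form: the signed measure with density \<open>Y\<close> has vanishing joint
  characteristic function along every finite subfamily of \<open>V\<close>.\<close>

definition fourier_null :: "'a measure \<Rightarrow> ('i \<Rightarrow> 'a \<Rightarrow> real) \<Rightarrow> ('a \<Rightarrow> real) \<Rightarrow> bool" where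
  "fourier_null M V Y \<longleftrightarrow> integrable M Y \<and>
     (\<forall>I c. finite I \<longrightarrow> (\<integral>x. cos (\<Sum>i\<in>I. c i * V i x) * Y x \<partial>M) = 0 \<and>
        (\<integral>x. sin (\<Sum>i\<in>I. c i * V i x) * Y x \<partial>M) = 0)"

lemma fourier_null_integral:
  assumes "fourier_null M V Y" shows "(\<integral>x. Y x \<partial>M) = 0"
  using assms[unfolded fourier_null_def, THEN conjunct2, rule_format, of "{}" "\<lambda>_. 0"] by simp

text \<open>By the product-to-sum formulas a frequency in \<open>V i\<close> only shifts the linear combination, so
  the coordinates can be localised one at a time.\<close>

lemma fourier_null_indicator:
  assumes V [measurable]: "\<And>i. V i \<in> borel_measurable M" and Y: "fourier_null M V Y"
    and A [measurable]: "A \<in> sets borel"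
  shows "fourier_null M V (\<lambda>x. indicator A (V i x) * Y x)"
proof -
  have Yi: "integrable M Y" using Y by (simp add: fourier_null_def)
  note [measurable] = borel_measurable_integrable[OF Yi]
  have trig_int: "integrable M (\<lambda>x. cos (f x) * Y x)" "integrable M (\<lambda>x. sin (f x) * Y x)"
    if [measurable]: "f \<in> borel_measurable M" for f
    by (rule integrable_bounded_mult[OF Yi, of _ 1]; simp)+
  have "(\<integral>x. cos (\<Sum>i\<in>I. c i * V i x) * (indicator A (V i x) * Y x) \<partial>M) = 0 \<and>
        (\<integral>x. sin (\<Sum>i\<in>I. c i * V i x) * (indicator A (V i x) * Y x) \<partial>M) = 0" if I: "finite I" for I c
  proof -
    define L where "L x = (\<Sum>i\<in>I. c i * V i x)" for x
    have [measurable]: "L \<in> borel_measurable M" unfolding L_def by measurable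
    have z: "(\<integral>x. cos (L x + s * V i x) * Y x \<partial>M) = 0" "(\<integral>x. sin (L x + s * V i x) * Y x \<partial>M) = 0" for s
    proof -
      \<comment> \<open>The index \<open>i\<close> may already belong to \<open>I\<close>; the new
        frequency is then added to the old coefficient.\<close>
      define d where "d j = (if j \<in> I then c j else 0) + (if j = i then s else 0)" for j
      have "L x + s * V i x = (\<Sum>j\<in>insert i I. d j * V j x)" for x
      proof -
        have "(\<Sum>j\<in>insert i I. (if j = i then s else 0) * V j x) = (\<Sum>j\<in>insert i I. if j = i then s * V i x else 0)"
          by (intro sum.cong) auto
        also have "\<dots> = s * V i x" using I by (subst sum.delta) auto
        finally have 1: "(\<Sum>j\<in>insert i I. (if j = i then s else 0) * V j x) = s * V i x" .
        have "(\<Sum>j\<in>insert i I. (if j \<in> I then c j else 0) * V j x) = (\<Sum>j\<in>I. (if j \<in> I then c j else 0) * V j x)"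
          using I by (intro sum.mono_neutral_right) auto
        also have "\<dots> = L x" by (auto simp: L_def intro!: sum.cong)
        finally show ?thesis using 1 by (simp only: d_def distrib_right sum.distrib)
      qed
      moreover have "finite (insert i I)" using I by simp
      ultimately show "(\<integral>x. cos (L x + s * V i x) * Y x \<partial>M) = 0" "(\<integral>x. sin (L x + s * V i x) * Y x \<partial>M) = 0"
        using Y unfolding fourier_null_def by presburger+
    qed
    have z': "(\<integral>x. cos (L x - s * V i x) * Y x \<partial>M) = 0" "(\<integral>x. sin (L x - s * V i x) * Y x \<partial>M) = 0" for s
      using z[of "-s"] by simp_all
    have a1: "cos (s * V i x) * (cos (L x) * Y x) = (cos (L x + s * V i x) * Y x + cos (L x - s * V i x) * Y x) / 2" for s x
      by (simp add: cos_add cos_diff algebra_simps)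
    have a2: "sin (s * V i x) * (cos (L x) * Y x) = (sin (L x + s * V i x) * Y x - sin (L x - s * V i x) * Y x) / 2" for s x
      by (simp add: sin_add sin_diff algebra_simps)
    have a3: "cos (s * V i x) * (sin (L x) * Y x) = (sin (L x + s * V i x) * Y x + sin (L x - s * V i x) * Y x) / 2" for s x
      by (simp add: sin_add sin_diff algebra_simps)
    have a4: "sin (s * V i x) * (sin (L x) * Y x) = (cos (L x - s * V i x) * Y x - cos (L x + s * V i x) * Y x) / 2" for s x
      by (simp add: cos_add cos_diff algebra_simps)
    have "(\<integral>x. indicator A (V i x) * (cos (L x) * Y x) \<partial>M) = 0"
      by (rule integral_indicator_vimage_eq_0_if_fourier_eq_0; (unfold a1 a2)?)
        (simp_all add: trig_int z z')
    moreover have "(\<integral>x. indicator A (V i x) * (sin (L x) * Y x) \<partial>M) = 0"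
      by (rule integral_indicator_vimage_eq_0_if_fourier_eq_0; (unfold a3 a4)?)
        (simp_all add: trig_int z z')
    ultimately show ?thesis by (simp add: L_def mult.left_commute)
  qed
  moreover have "integrable M (\<lambda>x. indicator A (V i x) * Y x)"
    by (rule Bochner_Integration.integrable_bound[OF Yi]) (auto simp: indicator_def)
  ultimately show ?thesis by (simp add: fourier_null_def)
qed

section \<open>The sigma-algebra generated by a family of random variables\<close>

lemma sets_process_algebra:
  "sets (process_algebra M V) = sigma_sets (space M) {V h -` A \<inter> space M | h A. A \<in> sets borel}"
  unfolding process_algebra_def by (rule sets_measure_of) auto

lemma space_process_algebra [simp]: "space (process_algebra M V) = space M"
  unfolding process_algebra_def by (rule space_measure_of) auto

lemma subalgebra_process_algebra:
  assumes "\<And>i. V i \<in> borel_measurable M"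
  shows "subalgebra M (process_algebra M V)"
  unfolding subalgebra_def sets_process_algebra
  using assms by (auto intro!: sets.sigma_sets_subset measurable_sets)

lemma measurable_process_algebra [measurable]:
  "V i \<in> borel_measurable (process_algebra M V)"
  by (rule measurableI) (auto simp: sets_process_algebra)

text \<open>Restricting to one coordinate condition preserves \<open>fourier_null\<close>, so by
  induction the integral of \<open>Y\<close> vanishes over every cylinder set. Cylinders are indexed
  by lists of conditions because appending lists intersects the sets; they form an
  intersection-stable generator, and a Dynkin argument does the rest.\<close>

lemma fourier_null_process_algebra:
  assumes V [measurable]: "\<And>i. V i \<in> borel_measurable M" and Y: "fourier_null M V Y"
    and A: "A \<in> sets (process_algebra M V)"
  shows "(\<integral>x. indicator A x * Y x \<partial>M) = 0"
proof -
  have Yi: "integrable M Y" using Y by (simp add: fourier_null_def)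
  note [measurable] = borel_measurable_integrable[OF Yi]
  define cyl where "cyl l = {x \<in> space M. \<forall>(i, B)\<in>set l. V i x \<in> B}" for l
  define G where "G = {cyl l | l. \<forall>(i, B)\<in>set l. B \<in> sets borel}"
  have cyl_null: "fourier_null M V (\<lambda>x. indicator (cyl l) x * Y x)"
    if "\<forall>(i, B)\<in>set l. B \<in> sets borel" for l
    using that
  proof (induction l)
    case Nil
    have "(\<integral>x. f x * (indicator (cyl []) x * Y x) \<partial>M) = (\<integral>x. f x * Y x \<partial>M)" for f
      by (intro Bochner_Integration.integral_cong) (auto simp: cyl_def)
    moreover have "integrable M (\<lambda>x. indicator (cyl []) x * Y x)"
      using Yi by (rule Bochner_Integration.integrable_bound) (auto simp: cyl_def indicator_def)
    ultimately show ?case using Y unfolding fourier_null_def by simp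
  next
    case (Cons p l)
    obtain i B where p: "p = (i, B)" by force
    have B [measurable]: "B \<in> sets borel" using Cons.prems by (simp add: p)
    have eq: "indicator (cyl (p # l)) x * Y x = indicator B (V i x) * (indicator (cyl l) x * Y x)" for x
      by (auto simp: cyl_def p indicator_def)
    show ?case unfolding eq using Cons by (intro fourier_null_indicator) auto
  qed
  have G_sub: "G \<subseteq> Pow (space M)" by (auto simp: G_def cyl_def)
  have cyl_meas: "cyl l \<in> sigma_sets (space M) {V h -` A \<inter> space M | h A. A \<in> sets borel}"
    if "\<forall>(i, B)\<in>set l. B \<in> sets borel" for l
    using that
  proof (induction l)
    case Nil
    show ?case by (simp add: cyl_def sigma_sets_top)
  next
    case (Cons p l)
    obtain i B where p: "p = (i, B)" by force
    have "cyl (p # l) = (V i -` B \<inter> space M) \<inter> cyl l" by (auto simp: cyl_def p)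
    moreover have "\<dots> \<in> sigma_sets (space M) {V h -` A \<inter> space M | h A. A \<in> sets borel}"
    proof -
      have "V i -` B \<inter> space M \<in> sets (process_algebra M V)"
        using measurable_sets[OF measurable_process_algebra, of B V i M] Cons.prems by (simp add: p)
      moreover have "cyl l \<in> sets (process_algebra M V)"
        using Cons unfolding sets_process_algebra by auto
      ultimately have "V i -` B \<inter> space M \<inter> cyl l \<in> sets (process_algebra M V)"
        by (rule sets.Int)
      then show ?thesis by (simp only: sets_process_algebra)
    qed
    ultimately show ?case by simp
  qed
  have sig: "sigma_sets (space M) G = sets (process_algebra M V)"
    unfolding sets_process_algebra
  proof (rule sigma_sets_eqI)
    fix a assume "a \<in> G" then show "a \<in> sigma_sets (space M) {V h -` A \<inter> space M | h A. A \<in> sets borel}"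
      using cyl_meas by (auto simp: G_def)
  next
    fix b assume "b \<in> {V h -` A \<inter> space M | h A. A \<in> sets borel}"
    then obtain h A where b: "b = V h -` A \<inter> space M" "A \<in> sets borel" by auto
    have "b = cyl [(h, A)]" by (auto simp: cyl_def b)
    moreover have "cyl [(h, A)] \<in> G"
      unfolding G_def using b(2) by (intro CollectI exI[of _ "[(h, A)]"]) simp
    ultimately show "b \<in> sigma_sets (space M) G" by (simp add: sigma_sets.Basic)
  qed
  have G_int: "Int_stable G"
  proof (rule Int_stableI)
    fix a b assume "a \<in> G" "b \<in> G"
    then obtain l l' where l: "a = cyl l" "b = cyl l'" "\<forall>(i, B)\<in>set l. B \<in> sets borel" "\<forall>(i, B)\<in>set l'. B \<in> sets borel"
      by (auto simp: G_def)
    have "a \<inter> b = cyl (l @ l')" by (auto simp: cyl_def l)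
    then show "a \<inter> b \<in> G" using l by (auto simp: G_def intro!: exI[of _ "l @ l'"])
  qed
  have subM: "sets (process_algebra M V) \<subseteq> sets M"
    using subalgebra_process_algebra[of V M] V by (simp add: subalgebra_def)
  have total: "(\<integral>x. Y x \<partial>M) = 0"
    using Y by (rule fourier_null_integral)
  from A have "A \<in> sigma_sets (space M) G" by (simp add: sig)
  from G_int G_sub this show ?thesis
  proof (induction rule: sigma_sets_induct_disjoint)
    case (basic A)
    then obtain l where l: "A = cyl l" "\<forall>(i, B)\<in>set l. B \<in> sets borel" by (auto simp: G_def)
    show ?case unfolding l(1) by (rule fourier_null_integral[OF cyl_null[OF l(2)]])
  next
    case empty then show ?case by simp
  next
    case (compl A)
    then have [measurable]: "A \<in> sets M" using subM by (auto simp: sig)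
    have i: "integrable M (\<lambda>x. indicator A x * Y x)"
      using Yi by (rule Bochner_Integration.integrable_bound) (auto simp: indicator_def)
    have "(\<integral>x. indicator (space M - A) x * Y x \<partial>M) = (\<integral>x. Y x - indicator A x * Y x \<partial>M)"
      by (intro Bochner_Integration.integral_cong) (auto simp: indicator_def)
    also have "\<dots> = 0" using Yi i compl total by simp
    finally show ?case .
  next
    case (union A)
    then have [measurable]: "\<And>i. A i \<in> sets M" using subM by (auto simp: sig)
    have i: "set_integrable M (\<Union>i. A i) Y"
      unfolding set_integrable_def using Yi
      by (rule Bochner_Integration.integrable_bound) (auto simp: indicator_def)
    have "(\<integral>x. indicator (\<Union>i. A i) x * Y x \<partial>M) = (\<Sum>i. (\<integral>x. indicator (A i) x * Y x \<partial>M))"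
      using lebesgue_integral_countable_add[OF _ _ i] union(1)
      by (simp add: set_lebesgue_integral_def disjoint_family_on_def)
    also have "\<dots> = 0" using union by simp
    finally show ?case .
  qed
qed

section \<open>The standard normal distribution\<close>

lemma has_real_derivative_std_normal_density:
  "(std_normal_density has_real_derivative - x * std_normal_density x) (at x)"
proof -
  have "((\<lambda>x. exp (- x\<^sup>2 / 2)) has_real_derivative - x * exp (- x\<^sup>2 / 2)) (at x)"
    by (auto intro!: derivative_eq_intros)
  from DERIV_cmult[OF this, of "1 / sqrt (2 * pi)"] show ?thesis by (simp add: std_normal_density_def[abs_def])
qed

text \<open>Controls the boundary terms in the integration by parts for functions of linear
  growth.\<close>

lemma tendsto_linear_mult_std_normal_density:
  "((\<lambda>x. (1 + x) * std_normal_density x) \<longlongrightarrow> 0) at_top"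
proof (rule tendsto_sandwich[where f = "\<lambda>_. 0" and h = "\<lambda>x. (1 + x) * exp (- x)"])
  have "((\<lambda>x::real. x ^ 0 / exp x + x ^ 1 / exp x) \<longlongrightarrow> 0 + 0) at_top"
    by (intro tendsto_add tendsto_power_div_exp_0)
  then show "((\<lambda>x::real. (1 + x) * exp (- x)) \<longlongrightarrow> 0) at_top"
    by (simp add: exp_minus divide_inverse distrib_right)
  show "((\<lambda>x::real. 0) \<longlongrightarrow> 0) at_top" by simp
  show "\<forall>\<^sub>F x in at_top. 0 \<le> (1 + x) * std_normal_density x"
    by (rule eventually_at_top_linorderI[of 0]) auto
  show "\<forall>\<^sub>F x in at_top. (1 + x) * std_normal_density x \<le> (1 + x) * exp (- x)"
  \<comment> \<open>From 2 on, x \<le> x^2 / 2, so the Gaussian exponential lies below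
    \<open>exp (- x)\<close>.\<close>
  proof (rule eventually_at_top_linorderI[of 2])
    fix x :: real assume x: "2 \<le> x"
    have "exp (- x\<^sup>2 / 2) \<le> exp (- x)"
      using x by (simp add: power2_eq_square)
    moreover have "1 / sqrt (2 * pi) \<le> 1"
      using pi_gt3 by (simp add: real_le_rsqrt)
    ultimately have "1 / sqrt (2 * pi) * exp (- x\<^sup>2 / 2) \<le> 1 * exp (- x)"
      by (intro mult_mono) auto
    then show "(1 + x) * std_normal_density x \<le> (1 + x) * exp (- x)"
      using x unfolding std_normal_density_def by (intro mult_left_mono) auto
  qed
qed

lemma integral_std_normal_distribution:
  fixes h :: "real \<Rightarrow> real"
  assumes "h \<in> borel_measurable borel"
  shows "(\<integral>x. h x \<partial>std_normal_distribution) = (\<integral>x. std_normal_density x * h x \<partial>lborel)"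
  using assms by (subst integral_density) auto

lemma integrable_std_normal_poly_growth:
  fixes h :: "real \<Rightarrow> real"
  assumes [measurable]: "h \<in> borel_measurable borel" and h: "\<And>x. \<bar>h x\<bar> \<le> K * (1 + \<bar>x\<bar>) ^ k"
  shows "integrable std_normal_distribution h"
proof -
  have "integrable lborel (\<lambda>x. \<Sum>j\<le>k. (K * real (k choose j)) * (std_normal_density x * \<bar>x\<bar> ^ j))"
    by (intro Bochner_Integration.integrable_sum integrable_mult_right integrable_std_normal_moment_abs)
  then have "integrable lborel (\<lambda>x. std_normal_density x * h x)"
  proof (rule Bochner_Integration.integrable_bound)
    have "norm (std_normal_density x * h x) \<le> norm (\<Sum>j\<le>k. (K * real (k choose j)) * (std_normal_density x * \<bar>x\<bar> ^ j))" for x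
    proof -
      have "norm (std_normal_density x * h x) \<le> std_normal_density x * (K * (1 + \<bar>x\<bar>) ^ k)"
        using h[of x] by (simp add: abs_mult mult_left_mono)
      also have "\<dots> = (\<Sum>j\<le>k. (K * real (k choose j)) * (std_normal_density x * \<bar>x\<bar> ^ j))"
        using binomial_ring[of "\<bar>x\<bar>" 1 k] by (simp add: add.commute sum_distrib_left mult_ac)
      finally show ?thesis by simp
    qed
    then show "AE x in lborel. norm (std_normal_density x * h x) \<le> norm (\<Sum>j\<le>k. (K * real (k choose j)) * (std_normal_density x * \<bar>x\<bar> ^ j))"
      by simp
  qed simp
  then show ?thesis by (subst integrable_density) auto
qed

text \<open>The derivative of \<open>h\<close> times the Gaussian density is
  \<open>h' x - x * h x\<close> times that density, and its integral over the line is zero because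
  the boundary terms vanish. Linear growth instead of boundedness is allowed since the identity is
  later applied to functions of the form y f(y) with bounded f.\<close>

lemma stein_identity:
  fixes h h' :: "real \<Rightarrow> real"
  assumes deriv: "\<And>x. (h has_real_derivative h' x) (at x)" and cont: "continuous_on UNIV h'"
    and h: "\<And>x. \<bar>h x\<bar> \<le> K * (1 + \<bar>x\<bar>)" and h': "\<And>x. \<bar>h' x\<bar> \<le> K * (1 + \<bar>x\<bar>)"
  shows "(\<integral>x. h' x \<partial>std_normal_distribution) = (\<integral>x. x * h x \<partial>std_normal_distribution)"
proof -
  have cont_h: "continuous_on UNIV h"
    using deriv by (intro DERIV_continuous_on) (auto intro: DERIV_subset)
  note [measurable] = borel_measurable_continuous_onI[OF cont] borel_measurable_continuous_onI[OF cont_h]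
  have meas: "h' \<in> borel_measurable borel" "(\<lambda>x. x * h x) \<in> borel_measurable borel" by measurable
  have K: "K \<ge> 0" using h[of 0] by simp
  have i1: "integrable std_normal_distribution h'"
    by (rule integrable_std_normal_poly_growth[of _ K 1]) (use h' in auto)
  have i2: "integrable std_normal_distribution (\<lambda>x. x * h x)"
  proof (rule integrable_std_normal_poly_growth[of _ K 2])
    fix x :: real
    have "\<bar>x * h x\<bar> \<le> (1 + \<bar>x\<bar>) * (K * (1 + \<bar>x\<bar>))"
      unfolding abs_mult using h[of x] by (intro mult_mono) auto
    then show "\<bar>x * h x\<bar> \<le> K * (1 + \<bar>x\<bar>)\<^sup>2" by (simp add: power2_eq_square mult_ac)
  qed simp
  have i1': "integrable lborel (\<lambda>x. std_normal_density x * h' x)"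
    using i1 by (subst (asm) integrable_density) auto
  have i2': "integrable lborel (\<lambda>x. std_normal_density x * (x * h x))"
    using i2 by (subst (asm) integrable_density) auto
  have lim_top: "((\<lambda>x. h x * std_normal_density x) \<longlongrightarrow> 0) at_top"
  proof (rule tendsto_0_le[OF tendsto_linear_mult_std_normal_density, where K = K])
    show "\<forall>\<^sub>F x in at_top. norm (h x * std_normal_density x) \<le> norm ((1 + x) * std_normal_density x) * K"
    proof (rule eventually_at_top_linorderI[of 0])
      fix x :: real assume "0 \<le> x"
      then show "norm (h x * std_normal_density x) \<le> norm ((1 + x) * std_normal_density x) * K"
        using mult_right_mono[OF h[of x], of "std_normal_density x"] by (simp add: abs_mult mult_ac)
    qed
  qed
  have lim_bot: "((\<lambda>x. h x * std_normal_density x) \<longlongrightarrow> 0) at_bot"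
    unfolding filterlim_at_bot_mirror
  proof (rule tendsto_0_le[OF tendsto_linear_mult_std_normal_density, where K = K])
    show "\<forall>\<^sub>F x in at_top. norm (h (-x) * std_normal_density (-x)) \<le> norm ((1 + x) * std_normal_density x) * K"
    proof (rule eventually_at_top_linorderI[of 0])
      fix x :: real assume "0 \<le> x"
      then show "norm (h (-x) * std_normal_density (-x)) \<le> norm ((1 + x) * std_normal_density x) * K"
        using mult_right_mono[OF h[of "-x"], of "std_normal_density x"]
        by (simp add: abs_mult mult_ac std_normal_density_def)
    qed
  qed
  have "(LBINT x=-\<infinity>..\<infinity>. std_normal_density x * h' x - std_normal_density x * (x * h x)) = 0 - 0"
  proof (rule interval_integral_FTC_integrable[where F = "\<lambda>x. h x * std_normal_density x"])
    fix x
    have "((\<lambda>x. h x * std_normal_density x) has_real_derivative (h' x * std_normal_density x + (- x * std_normal_density x) * h x)) (at x)"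
      by (intro DERIV_mult' DERIV_mult deriv has_real_derivative_std_normal_density)
    then show "((\<lambda>x. h x * std_normal_density x) has_vector_derivative std_normal_density x * h' x - std_normal_density x * (x * h x)) (at x)"
      by (simp add: has_real_derivative_iff_has_vector_derivative algebra_simps)
    have "isCont h' x" using cont by (simp add: continuous_on_eq_continuous_at)
    moreover have "isCont h x" using deriv DERIV_isCont by blast
    moreover have "isCont std_normal_density x"
      using has_real_derivative_std_normal_density DERIV_isCont by blast
    ultimately show "isCont (\<lambda>x. std_normal_density x * h' x - std_normal_density x * (x * h x)) x"
      by (intro continuous_intros)
  next
    show "set_integrable lborel (einterval (- \<infinity>) \<infinity>) (\<lambda>x. std_normal_density x * h' x - std_normal_density x * (x * h x))"
      using i1' i2' by (simp add: set_integrable_def)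
  qed (use lim_top lim_bot in \<open>auto simp: ereal_tendsto_simps1\<close>)
  then have "(\<integral>x. std_normal_density x * h' x - std_normal_density x * (x * h x) \<partial>lborel) = 0"
    by (simp add: interval_lebesgue_integral_def set_lebesgue_integral_def)
  then have "(\<integral>x. std_normal_density x * h' x \<partial>lborel) = (\<integral>x. std_normal_density x * (x * h x) \<partial>lborel)"
    using i1' i2' by simp
  then show ?thesis by (simp only: integral_std_normal_distribution meas)
qed

lemma integral_abs_std_normal: "(\<integral>x. \<bar>x\<bar> \<partial>std_normal_distribution) = sqrt (2 / pi)"
  using integral_std_normal_moment_abs_odd[of 0] integral_std_normal_distribution[of abs] by simp

text \<open>The variance of the second Hermite polynomial. Its square root is the
  \<open>sqrt 2\<close> in the bound on third derivatives.\<close>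

lemma integral_square_minus_1_square_std_normal:
  "(\<integral>x. (x\<^sup>2 - 1)\<^sup>2 \<partial>std_normal_distribution) = 2"
proof -
  have "(\<integral>x. std_normal_density x * x ^ 4 \<partial>lborel) = 3" "(\<integral>x. std_normal_density x * x ^ 2 \<partial>lborel) = 1"
    using integral_std_normal_moment_even[of 2] integral_std_normal_moment_even[of 1]
    by (simp_all add: fact_numeral)
  then have m: "(\<integral>x. x ^ 4 \<partial>std_normal_distribution) = 3" "(\<integral>x. x ^ 2 \<partial>std_normal_distribution) = 1"
    by (simp_all only: integral_std_normal_distribution[of "\<lambda>x. x ^ 4"] integral_std_normal_distribution[of "\<lambda>x. x\<^sup>2"] borel_measurable_power measurable_ident_sets[OF refl])
  interpret real_distribution std_normal_distribution by (rule real_dist_normal_dist)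
  have "(\<integral>x. (x\<^sup>2 - 1)\<^sup>2 \<partial>std_normal_distribution) = (\<integral>x. x ^ 4 - 2 * x ^ 2 + 1 \<partial>std_normal_distribution)"
    by (intro Bochner_Integration.integral_cong) (auto simp: power2_diff power_mult[symmetric])
  also have "\<dots> = 3 - 2 * 1 + 1"
    using m integrable_std_normal_distribution_moment prob_space by simp
  finally show ?thesis by simp
qed

section \<open>Isonormal processes\<close>

text \<open>Serves two purposes: with \<open>T\<close> the identity into a coarser sigma-algebra,
  and with \<open>T\<close> the projection of an extension onto the original space.\<close>

lemma (in prob_space) distr_Pair_indep:
  assumes T [measurable]: "T \<in> measurable M N" and U [measurable]: "U \<in> borel_measurable M"
    and indep: "\<And>B A. B \<in> sets N \<Longrightarrow> A \<in> sets (borel :: real measure) \<Longrightarrow>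
      prob ((T -` B \<inter> space M) \<inter> (U -` A \<inter> space M)) = prob (T -` B \<inter> space M) * prob (U -` A \<inter> space M)"
  shows "distr M (N \<Otimes>\<^sub>M borel) (\<lambda>\<omega>. (T \<omega>, U \<omega>)) = distr M N T \<Otimes>\<^sub>M distr M borel U"
proof (rule pair_measure_eqI[symmetric])
  interpret T: prob_space "distr M N T" by (rule prob_space_distr) simp
  interpret U: prob_space "distr M borel U" by (rule prob_space_distr) simp
  show "sigma_finite_measure (distr M N T)" "sigma_finite_measure (distr M borel U)" by unfold_locales
  show "sets (distr M N T \<Otimes>\<^sub>M distr M borel U) = sets (distr M (N \<Otimes>\<^sub>M borel) (\<lambda>\<omega>. (T \<omega>, U \<omega>)))"
    by (simp cong: sets_pair_measure_cong)
  fix B and A :: "real set" assume "B \<in> sets (distr M N T)" "A \<in> sets (distr M borel U)"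
  then have [measurable]: "B \<in> sets N" "A \<in> sets borel" by simp_all
  have "(\<lambda>\<omega>. (T \<omega>, U \<omega>)) -` (B \<times> A) \<inter> space M = (T -` B \<inter> space M) \<inter> (U -` A \<inter> space M)" by auto
  then show "emeasure (distr M N T) B * emeasure (distr M borel U) A = emeasure (distr M (N \<Otimes>\<^sub>M borel) (\<lambda>\<omega>. (T \<omega>, U \<omega>))) (B \<times> A)"
    by (simp add: emeasure_distr emeasure_eq_measure indep ennreal_mult)
qed

lemma AE_eq_0_if_indicator_integrals_0:
  fixes Y :: "'a \<Rightarrow> real"
  assumes Y: "integrable M Y" and 0: "\<And>A. A \<in> sets M \<Longrightarrow> (\<integral>x. indicator A x * Y x \<partial>M) = 0"
  shows "AE x in M. Y x = 0"
proof -
  note [measurable] = borel_measurable_integrable[OF Y]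
  have i: "integrable M (\<lambda>x. indicator A x * Y x)" if [measurable]: "A \<in> sets M" for A
    by (rule integrable_bounded_mult[OF Y, of _ 1]) (auto simp: indicator_def)
  define P where "P = {x \<in> space M. Y x > 0}"
  define N where "N = {x \<in> space M. Y x < 0}"
  have [measurable]: "P \<in> sets M" "N \<in> sets M" by (simp_all add: P_def N_def)
  have nP: "AE x in M. 0 \<le> indicator P x * Y x" by (rule AE_I2) (auto simp: P_def indicator_def)
  have nN: "AE x in M. 0 \<le> - (indicator N x * Y x)" by (rule AE_I2) (auto simp: N_def indicator_def)
  have iN: "integrable M (\<lambda>x. - (indicator N x * Y x))" using i[of N] by simp
  have "(\<integral>x. - (indicator N x * Y x) \<partial>M) = 0" using 0[of N] by simp
  then have "AE x in M. - (indicator N x * Y x) = 0"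
    using integral_nonneg_eq_0_iff_AE[OF iN nN] by blast
  moreover have "AE x in M. indicator P x * Y x = 0"
    using integral_nonneg_eq_0_iff_AE[OF i[of P] nP] 0[of P] by simp
  moreover note AE_space
  ultimately show ?thesis
  proof eventually_elim
    case (elim x)
    then show ?case by (cases "Y x > 0"; cases "Y x < 0") (simp_all add: P_def N_def)
  qed
qed

locale isonormal_process =
  fixes M :: "'w measure" and X :: "'h::{real_inner, banach, second_countable_topology} \<Rightarrow> 'w \<Rightarrow> real"
  assumes iso: "isonormal M X"
begin

sublocale prob_space M
  using iso unfolding isonormal_def by (rule conjunct1)

lemma gaussian: "centered_gaussian M (X h)"
proof -
  have "centered_gaussian_family M X" using iso by (simp only: isonormal_def)
  from this[unfolded centered_gaussian_family_def, rule_format, of "{h}" "\<lambda>_. 1"]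
  show ?thesis by simp
qed

lemma measurable_X [measurable]: "X h \<in> borel_measurable M"
  using gaussian by (simp add: centered_gaussian_def)

lemma covariance: "(\<integral>\<omega>. X h \<omega> * X g \<omega> \<partial>M) = h \<bullet> g"
  using iso by (simp add: isonormal_def)

lemma integrable_X_square: "integrable M (\<lambda>\<omega>. (X h \<omega>)\<^sup>2)"
proof (cases "distr M borel (X h) = return borel 0")
  case True
  have "AE x in distr M borel (X h). x = 0" unfolding True by (subst AE_return) auto
  then have "AE \<omega> in M. X h \<omega> = 0" by (simp add: AE_distr_iff)
  then have "AE \<omega> in M. 0 = (X h \<omega>)\<^sup>2" by eventually_elim simp
  then show ?thesis using integrable_cong_AE[of "\<lambda>_. 0::real" M "\<lambda>\<omega>. (X h \<omega>)\<^sup>2"] by simp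
next
  case False
  then obtain \<sigma> where \<sigma>: "\<sigma> > 0" "distributed M lborel (X h) (normal_density 0 \<sigma>)"
    using gaussian[of h] by (auto simp: centered_gaussian_def)
  have "integrable lborel (\<lambda>x. normal_density 0 \<sigma> x * x\<^sup>2)"
    using integrable_normal_moment[OF \<sigma>(1), of 0 2] by simp
  then show ?thesis
    using distributed_integrable[OF \<sigma>(2), of "\<lambda>x. x\<^sup>2"] \<sigma>(1) by simp
qed

lemma integrable_X_mult: "integrable M (\<lambda>\<omega>. X h \<omega> * X g \<omega>)"
proof (rule Bochner_Integration.integrable_bound)
  show "integrable M (\<lambda>\<omega>. (X h \<omega>)\<^sup>2 + (X g \<omega>)\<^sup>2)" using integrable_X_square by simp
  have "\<bar>x * y\<bar> \<le> x\<^sup>2 + y\<^sup>2" for x y :: real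
  proof -
    have "2 * (\<bar>x\<bar> * \<bar>y\<bar>) \<le> x\<^sup>2 + y\<^sup>2" using sum_squares_bound[of "\<bar>x\<bar>" "\<bar>y\<bar>"] by simp
    moreover have "0 \<le> \<bar>x\<bar> * \<bar>y\<bar>" by simp
    ultimately show ?thesis unfolding abs_mult by linarith
  qed
  then show "AE \<omega> in M. norm (X h \<omega> * X g \<omega>) \<le> norm ((X h \<omega>)\<^sup>2 + (X g \<omega>)\<^sup>2)" by simp
qed simp

text \<open>Linearity is not built into \<open>isonormal\<close>, but the covariance determines it:
  the second moment of the difference expands into inner products that cancel.\<close>

lemma AE_X_linear: "AE \<omega> in M. X (a *\<^sub>R g + b *\<^sub>R h) \<omega> = a * X g \<omega> + b * X h \<omega>"
proof -
  let ?k = "a *\<^sub>R g + b *\<^sub>R h"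
  have eq: "(X ?k \<omega> - (a * X g \<omega> + b * X h \<omega>))\<^sup>2 = X ?k \<omega> * X ?k \<omega> + a\<^sup>2 * (X g \<omega> * X g \<omega>) + b\<^sup>2 * (X h \<omega> * X h \<omega>)
      - 2 * a * (X ?k \<omega> * X g \<omega>) - 2 * b * (X ?k \<omega> * X h \<omega>) + 2 * a * b * (X g \<omega> * X h \<omega>)" for \<omega>
    by (simp add: power2_eq_square algebra_simps)
  have int: "integrable M (\<lambda>\<omega>. (X ?k \<omega> - (a * X g \<omega> + b * X h \<omega>))\<^sup>2)"
    unfolding eq using integrable_X_mult
    by (intro Bochner_Integration.integrable_add Bochner_Integration.integrable_diff integrable_mult_right)
  have "(\<integral>\<omega>. (X ?k \<omega> - (a * X g \<omega> + b * X h \<omega>))\<^sup>2 \<partial>M) = ?k \<bullet> ?k + a\<^sup>2 * (g \<bullet> g) + b\<^sup>2 * (h \<bullet> h)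
      - 2 * a * (?k \<bullet> g) - 2 * b * (?k \<bullet> h) + 2 * a * b * (g \<bullet> h)"
    unfolding eq using integrable_X_mult by (simp add: covariance)
  also have "\<dots> = 0"
    by (simp add: inner_add_left inner_add_right power2_eq_square inner_commute algebra_simps)
  finally have "AE \<omega> in M. (X ?k \<omega> - (a * X g \<omega> + b * X h \<omega>))\<^sup>2 = 0"
    using integral_nonneg_eq_0_iff_AE[OF int] by simp
  then show ?thesis by eventually_elim simp
qed

lemma AE_X_sum:
  assumes "finite I"
  shows "AE \<omega> in M. X (\<Sum>i\<in>I. c i *\<^sub>R v i) \<omega> = (\<Sum>i\<in>I. c i * X (v i) \<omega>)"
  using assms
proof (induction I)
  case empty
  \<comment> \<open>The empty sum requires X 0 = 0 almost surely, which is linearity with both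
    coefficients equal to 0.\<close>
  show ?case using AE_X_linear[of 0 undefined 0 undefined] by simp
next
  case (insert i I)
  from AE_X_linear[of "c i" "v i" 1 "\<Sum>i\<in>I. c i *\<^sub>R v i"] insert.IH
  show ?case by eventually_elim (use insert in simp)
qed

text \<open>Frequency 1 is enough, as other frequencies arise by scaling \<open>h\<close>. The
  variance of the normal law is read off from the covariance; the point mass at 0 is the case of
  \<open>h\<close> with zero norm.\<close>

lemma integral_cos_X: "(\<integral>\<omega>. cos (X h \<omega>) \<partial>M) = exp (- (h \<bullet> h) / 2)" (is ?C)
  and integral_sin_X: "(\<integral>\<omega>. sin (X h \<omega>) \<partial>M) = 0" (is ?S)
proof -
  have "?C \<and> ?S"
  proof (cases "distr M borel (X h) = return borel 0")
    case True
    have "AE x in distr M borel (X h). x = 0" unfolding True by (subst AE_return) auto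
    then have ae: "AE \<omega> in M. X h \<omega> = 0" by (simp add: AE_distr_iff)
    then have "(\<integral>\<omega>. X h \<omega> * X h \<omega> \<partial>M) = (\<integral>\<omega>. 0 \<partial>M)"
      by (intro integral_cong_AE) auto
    then have "h \<bullet> h = 0" by (simp add: covariance)
    moreover have "(\<integral>\<omega>. cos (X h \<omega>) \<partial>M) = (\<integral>\<omega>. 1 \<partial>M)" "(\<integral>\<omega>. sin (X h \<omega>) \<partial>M) = (\<integral>\<omega>. 0 \<partial>M)"
      using ae by (intro integral_cong_AE; auto)+
    ultimately show ?thesis by (simp add: prob_space)
  next
    case False
    then obtain \<sigma> where \<sigma>: "\<sigma> > 0" "distributed M lborel (X h) (normal_density 0 \<sigma>)"
      using gaussian[of h] by (auto simp: centered_gaussian_def)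
    have "(\<integral>\<omega>. (X h \<omega>)\<^sup>2 \<partial>M) = \<sigma>\<^sup>2"
      using normal_distributed_variance[OF \<sigma>] normal_distributed_expectation[OF \<sigma>] by simp
    then have var: "h \<bullet> h = \<sigma>\<^sup>2" using covariance[of h h] by (simp add: power2_eq_square)
    have "distributed M lborel (\<lambda>\<omega>. (X h \<omega> - 0) / \<sigma>) std_normal_density"
      using \<sigma> normal_standard_normal_convert[OF \<sigma>(1)] by blast
    then have d: "distr M borel (\<lambda>\<omega>. X h \<omega> / \<sigma>) = std_normal_distribution"
      by (simp add: distributed_def cong: distr_cong)
    have "char (distr M borel (\<lambda>\<omega>. X h \<omega> / \<sigma>)) \<sigma> = complex_of_real (exp (- \<sigma>\<^sup>2 / 2))"
      unfolding d char_std_normal_distribution by simp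
    moreover have "char (distr M borel (\<lambda>\<omega>. X h \<omega> / \<sigma>)) \<sigma> = (\<integral>\<omega>. iexp (X h \<omega>) \<partial>M)"
      unfolding char_def using \<sigma>(1) by (subst integral_distr) auto
    ultimately have e: "(\<integral>\<omega>. iexp (X h \<omega>) \<partial>M) = complex_of_real (exp (- \<sigma>\<^sup>2 / 2))" by simp
    have i: "integrable M (\<lambda>\<omega>. iexp (X h \<omega>))" by (rule integrable_iexp) simp_all
    have "(\<integral>\<omega>. Re (iexp (X h \<omega>)) \<partial>M) = exp (- \<sigma>\<^sup>2 / 2)" "(\<integral>\<omega>. Im (iexp (X h \<omega>)) \<partial>M) = 0"
      using e i by (simp_all add: integral_Re integral_Im del: Re_exp Im_exp)
    then show ?thesis by (simp add: Re_exp Im_exp var)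
  qed
  then show ?C ?S by auto
qed

lemma subalgebra_X: "subalgebra M (process_algebra M X)"
  by (rule subalgebra_process_algebra) simp

text \<open>An event of the completion is an event generated by \<open>X\<close> together with a
  subset of a null set. This is where the assumption on the events in \<open>isonormal\<close>
  enters.\<close>

lemma AE_process_algebra_representative:
  assumes "A \<in> sets M"
  obtains B where "B \<in> sets (process_algebra M X)" "AE \<omega> in M. \<omega> \<in> A \<longleftrightarrow> \<omega> \<in> B"
proof -
  let ?N = "restr_to_subalg M (process_algebra M X)"
  have "A \<in> sets (completion ?N)" using assms iso by (simp add: isonormal_def)
  then obtain S N N' where A: "A = S \<union> N" "N \<subseteq> N'" "N' \<in> null_sets ?N" "S \<in> sets ?N"
    by (rule sets_completionE)
  have "N' \<in> null_sets M" using A(3) null_sets_restr_to_subalg[OF subalgebra_X] by auto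
  then have "AE \<omega> in M. \<omega> \<in> A \<longleftrightarrow> \<omega> \<in> S"
    by (rule AE_I') (use A in auto)
  moreover have "S \<in> sets (process_algebra M X)"
    using A(4) by (simp add: sets_restr_to_subalg[OF subalgebra_X])
  ultimately show ?thesis using that by blast
qed

text \<open>\<open>f\<close> also depends on \<omega> so that a random weight can be carried along
  inside the integral.\<close>

lemma sum_X_linear: "finite I \<Longrightarrow> (\<integral>\<omega>. f (\<Sum>i\<in>I. c i * X (v i) \<omega>) \<omega> \<partial>M) = (\<integral>\<omega>. f (X (\<Sum>i\<in>I. c i *\<^sub>R v i) \<omega>) \<omega> \<partial>M)"
  if "\<And>g. g \<in> borel_measurable M \<Longrightarrow> (\<lambda>\<omega>. f (g \<omega>) \<omega>) \<in> borel_measurable M" for f :: "real \<Rightarrow> 'w \<Rightarrow> real"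
proof (rule integral_cong_AE)
  assume "finite I"
  from AE_X_sum[OF this, of c v]
  show "AE \<omega> in M. f (\<Sum>i\<in>I. c i * X (v i) \<omega>) \<omega> = f (X (\<Sum>i\<in>I. c i *\<^sub>R v i) \<omega>) \<omega>"
    by eventually_elim simp
qed (auto intro!: that)

text \<open>Totality in the form used throughout. Frequencies in a single \<open>X g\<close> cover
  all joint frequencies, since a linear combination of values of \<open>X\<close> is again a value
  of \<open>X\<close> almost surely.\<close>

lemma AE_eq_0_if_fourier_0:
  assumes Y: "integrable M Y"
    and c: "\<And>g. (\<integral>\<omega>. cos (X g \<omega>) * Y \<omega> \<partial>M) = 0" and s: "\<And>g. (\<integral>\<omega>. sin (X g \<omega>) * Y \<omega> \<partial>M) = 0"
  shows "AE \<omega> in M. Y \<omega> = 0"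
proof (rule AE_eq_0_if_indicator_integrals_0[OF Y])
  note [measurable] = borel_measurable_integrable[OF Y]
  have "fourier_null M X Y"
    unfolding fourier_null_def
    using Y c s sum_X_linear[of "\<lambda>x \<omega>. cos x * Y \<omega>" _ _ "\<lambda>x. x"] sum_X_linear[of "\<lambda>x \<omega>. sin x * Y \<omega>" _ _ "\<lambda>x. x"]
    by simp
  note null = fourier_null_process_algebra[OF measurable_X this]
  fix A assume A [measurable]: "A \<in> sets M"
  then obtain B where B: "B \<in> sets (process_algebra M X)" and ae: "AE \<omega> in M. \<omega> \<in> A \<longleftrightarrow> \<omega> \<in> B"
    by (rule AE_process_algebra_representative)
  have [measurable]: "B \<in> sets M" using B subalgebra_X by (auto simp: subalgebra_def)
  have "(\<integral>x. indicator A x * Y x \<partial>M) = (\<integral>x. indicator B x * Y x \<partial>M)"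
    using ae by (intro integral_cong_AE) (auto simp: indicator_def)
  then show "(\<integral>x. indicator A x * Y x \<partial>M) = 0" using null[OF B] by simp
qed

text \<open>For a unit vector \<open>h\<close> this is \<open>X\<close> at the projection of
  \<open>g\<close> onto the orthogonal complement of \<open>h\<close>.\<close>

definition residual :: "'h \<Rightarrow> 'h \<Rightarrow> 'w \<Rightarrow> real" where
  "residual h g = X (g - (g \<bullet> h) *\<^sub>R h)"

lemma measurable_residual [measurable]: "residual h g \<in> borel_measurable M"
  by (simp add: residual_def)

lemma AE_X_residual: "AE \<omega> in M. X g \<omega> = residual h g \<omega> + (g \<bullet> h) * X h \<omega>"
  using AE_X_linear[of 1 "g - (g \<bullet> h) *\<^sub>R h" "g \<bullet> h" h] by (simp add: residual_def)

text \<open>Fourier uniqueness is applied twice. For w orthogonal to \<open>h\<close> the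
  characteristic function of (X w, X h) factorises, which first yields that the centred indicator
  \<open>Y\<close> of an event of \<open>X h\<close> is orthogonal to all frequencies of X w; hence
  \<open>Y\<close> is \<open>fourier_null\<close> for the residuals, and its integral vanishes over
  every event they generate.\<close>

lemma residual_indep:
  assumes h: "norm h = 1" and A [measurable]: "A \<in> sets borel"
    and B: "B \<in> sets (process_algebra M (residual h))"
  shows "prob (B \<inter> (X h -` A \<inter> space M)) = prob B * prob (X h -` A \<inter> space M)"
proof -
  define p where "p = prob (X h -` A \<inter> space M)"
  define Y where "Y \<omega> = indicator A (X h \<omega>) - p" for \<omega>
  have [measurable]: "Y \<in> borel_measurable M" unfolding Y_def by measurable
  have iA: "integrable M (\<lambda>\<omega>. indicator A (X h \<omega>) :: real)"
    by (rule integrable_const_bound[of _ 1]) (auto simp: indicator_def)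
  have pA: "(\<integral>\<omega>. indicator A (X h \<omega>) \<partial>M) = p"
  proof -
    have "(\<integral>\<omega>. indicator A (X h \<omega>) \<partial>M) = (\<integral>\<omega>. indicator (X h -` A \<inter> space M) \<omega> \<partial>M :: real)"
      by (intro Bochner_Integration.integral_cong) (auto simp: indicator_def)
    then show ?thesis by (simp add: p_def)
  qed
  have bint: "integrable M f" if "f \<in> borel_measurable M" "\<And>\<omega>. \<bar>f \<omega>\<bar> \<le> 1" for f :: "'w \<Rightarrow> real"
    using that by (intro integrable_const_bound[of _ 1]) auto
  have shift: "(\<integral>\<omega>. f (X w \<omega> + s * X h \<omega>) \<partial>M) = (\<integral>\<omega>. f (X (w + s *\<^sub>R h) \<omega>) \<partial>M)"
    if [measurable]: "f \<in> borel_measurable borel" for w s and f :: "real \<Rightarrow> real"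
    using AE_X_linear[of 1 w s h] by (intro integral_cong_AE) auto
  have trig: "(\<integral>\<omega>. cos (X w \<omega>) * Y \<omega> \<partial>M) = 0" "(\<integral>\<omega>. sin (X w \<omega>) * Y \<omega> \<partial>M) = 0" if w: "w \<bullet> h = 0" for w
  proof -
    have sq: "(w + s *\<^sub>R h) \<bullet> (w + s *\<^sub>R h) = w \<bullet> w + s\<^sup>2" for s
      using w h by (simp add: inner_add_left inner_add_right inner_commute power2_eq_square norm_eq_1)
    have C: "(\<integral>\<omega>. cos (X w \<omega> + s * X h \<omega>) \<partial>M) = exp (- (w \<bullet> w) / 2) * exp (- s\<^sup>2 / 2)"
      and S: "(\<integral>\<omega>. sin (X w \<omega> + s * X h \<omega>) \<partial>M) = 0" for s
      by (subst shift; simp add: integral_cos_X integral_sin_X sq exp_add[symmetric] field_simps)+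
    have C': "(\<integral>\<omega>. cos (X w \<omega> - s * X h \<omega>) \<partial>M) = exp (- (w \<bullet> w) / 2) * exp (- s\<^sup>2 / 2)"
      and S': "(\<integral>\<omega>. sin (X w \<omega> - s * X h \<omega>) \<partial>M) = 0" for s
      using C[of "-s"] S[of "-s"] by simp_all
    have Cs: "(\<integral>\<omega>. cos (s * X h \<omega>) \<partial>M) = exp (- s\<^sup>2 / 2)" "(\<integral>\<omega>. sin (s * X h \<omega>) \<partial>M) = 0" for s
    proof -
      have ae: "AE \<omega> in M. X (s *\<^sub>R h) \<omega> = s * X h \<omega>" using AE_X_linear[of s h 0 h] by simp
      have "(\<integral>\<omega>. cos (s * X h \<omega>) \<partial>M) = (\<integral>\<omega>. cos (X (s *\<^sub>R h) \<omega>) \<partial>M)" "(\<integral>\<omega>. sin (s * X h \<omega>) \<partial>M) = (\<integral>\<omega>. sin (X (s *\<^sub>R h) \<omega>) \<partial>M)"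
        using ae by (auto intro!: integral_cong_AE)
      then show "(\<integral>\<omega>. cos (s * X h \<omega>) \<partial>M) = exp (- s\<^sup>2 / 2)" "(\<integral>\<omega>. sin (s * X h \<omega>) \<partial>M) = 0"
        using h by (simp_all add: integral_cos_X integral_sin_X norm_eq_1 power2_eq_square)
    qed
    note b = bint
    have cc: "(\<integral>\<omega>. cos (s * X h \<omega>) * cos (X w \<omega>) \<partial>M) = exp (- (w \<bullet> w) / 2) * exp (- s\<^sup>2 / 2)" for s
    proof -
      have "(\<integral>\<omega>. cos (s * X h \<omega>) * cos (X w \<omega>) \<partial>M) = (\<integral>\<omega>. (cos (X w \<omega> + s * X h \<omega>) + cos (X w \<omega> - s * X h \<omega>)) / 2 \<partial>M)"
        by (simp add: cos_add cos_diff algebra_simps)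
      also have "\<dots> = exp (- (w \<bullet> w) / 2) * exp (- s\<^sup>2 / 2)"
        using C[of s] C'[of s] by (simp add: b)
      finally show ?thesis .
    qed
    have sc: "(\<integral>\<omega>. sin (s * X h \<omega>) * cos (X w \<omega>) \<partial>M) = 0" for s
    proof -
      have "(\<integral>\<omega>. sin (s * X h \<omega>) * cos (X w \<omega>) \<partial>M) = (\<integral>\<omega>. (sin (X w \<omega> + s * X h \<omega>) - sin (X w \<omega> - s * X h \<omega>)) / 2 \<partial>M)"
        by (simp add: sin_add sin_diff algebra_simps)
      also have "\<dots> = 0" using S[of s] S'[of s] by (simp add: b)
      finally show ?thesis .
    qed
    have cs: "(\<integral>\<omega>. cos (s * X h \<omega>) * sin (X w \<omega>) \<partial>M) = 0" for s
    proof -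
      have "(\<integral>\<omega>. cos (s * X h \<omega>) * sin (X w \<omega>) \<partial>M) = (\<integral>\<omega>. (sin (X w \<omega> + s * X h \<omega>) + sin (X w \<omega> - s * X h \<omega>)) / 2 \<partial>M)"
        by (simp add: sin_add sin_diff algebra_simps)
      also have "\<dots> = 0" using S[of s] S'[of s] by (simp add: b)
      finally show ?thesis .
    qed
    have ss: "(\<integral>\<omega>. sin (s * X h \<omega>) * sin (X w \<omega>) \<partial>M) = 0" for s
    proof -
      have "(\<integral>\<omega>. sin (s * X h \<omega>) * sin (X w \<omega>) \<partial>M) = (\<integral>\<omega>. (cos (X w \<omega> - s * X h \<omega>) - cos (X w \<omega> + s * X h \<omega>)) / 2 \<partial>M)"
        by (simp add: cos_add cos_diff algebra_simps)
      also have "\<dots> = 0" using C[of s] C'[of s] by (simp add: b)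
      finally show ?thesis .
    qed
    have bm: "\<bar>cos a * cos b\<bar> \<le> 1" "\<bar>sin a * cos b\<bar> \<le> 1" "\<bar>cos a * sin b\<bar> \<le> 1" "\<bar>sin a * sin b\<bar> \<le> 1" for a b :: real
      by (simp_all add: abs_mult mult_le_one)
    have k: "\<bar>indicator A x * y\<bar> \<le> 1" if "\<bar>y\<bar> \<le> 1" for x y :: real
      using that by (auto simp: indicator_def)
    let ?e = "exp (- (w \<bullet> w) / 2)"
    \<comment> \<open>Subtracting its mean makes the cosine orthogonal to every frequency of
      \<open>X h\<close>; the sine has mean zero already.\<close>
    have "(\<integral>\<omega>. indicator A (X h \<omega>) * (cos (X w \<omega>) - ?e) \<partial>M) = 0"
    proof (rule integral_indicator_vimage_eq_0_if_fourier_eq_0)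
      fix s
      show "(\<integral>\<omega>. cos (s * X h \<omega>) * (cos (X w \<omega>) - ?e) \<partial>M) = 0"
        "(\<integral>\<omega>. sin (s * X h \<omega>) * (cos (X w \<omega>) - ?e) \<partial>M) = 0"
        by (simp_all add: right_diff_distrib b bm cc sc Cs)
    qed (simp_all add: b)
    moreover have "(\<integral>\<omega>. indicator A (X h \<omega>) * sin (X w \<omega>) \<partial>M) = 0"
      by (rule integral_indicator_vimage_eq_0_if_fourier_eq_0) (simp_all add: b cs ss)
    moreover have ic: "integrable M (\<lambda>\<omega>. indicator A (X h \<omega>) * cos (X w \<omega>))" "integrable M (\<lambda>\<omega>. indicator A (X h \<omega>) * sin (X w \<omega>))"
      by (intro b; simp add: k)+
    ultimately show "(\<integral>\<omega>. cos (X w \<omega>) * Y \<omega> \<partial>M) = 0" "(\<integral>\<omega>. sin (X w \<omega>) * Y \<omega> \<partial>M) = 0"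
      using iA pA integral_cos_X[of w] integral_sin_X[of w]
      by (simp_all add: Y_def right_diff_distrib b mult.commute[of "indicator A _"] mult.commute[of "p"])
  qed
  have iY: "integrable M Y" unfolding Y_def using iA by simp
  have "fourier_null M (residual h) Y"
    unfolding fourier_null_def
  proof (intro conjI allI impI iY)
    fix I :: "'h set" and c assume I: "finite I"
    let ?w = "\<Sum>g\<in>I. c g *\<^sub>R (g - (g \<bullet> h) *\<^sub>R h)"
    have w: "?w \<bullet> h = 0" using h by (simp add: inner_sum_left inner_diff_left norm_eq_1)
    show "(\<integral>\<omega>. cos (\<Sum>g\<in>I. c g * residual h g \<omega>) * Y \<omega> \<partial>M) = 0"
      unfolding residual_def using sum_X_linear[of "\<lambda>x \<omega>. cos x * Y \<omega>", OF _ I] trig(1)[OF w] by simp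
    show "(\<integral>\<omega>. sin (\<Sum>g\<in>I. c g * residual h g \<omega>) * Y \<omega> \<partial>M) = 0"
      unfolding residual_def using sum_X_linear[of "\<lambda>x \<omega>. sin x * Y \<omega>", OF _ I] trig(2)[OF w] by simp
  qed
  from fourier_null_process_algebra[OF measurable_residual this B]
  have z: "(\<integral>\<omega>. indicator B \<omega> * Y \<omega> \<partial>M) = 0" .
  have [measurable]: "B \<in> sets M"
    using B subalgebra_process_algebra[of "residual h" M] by (auto simp: subalgebra_def)
  have i1: "integrable M (\<lambda>\<omega>. indicator (B \<inter> (X h -` A \<inter> space M)) \<omega> :: real)"
    by (rule bint) (auto simp: indicator_def)
  have i2: "integrable M (\<lambda>\<omega>. indicator B \<omega> :: real)"
    by (rule bint) (auto simp: indicator_def)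
  have "(\<integral>\<omega>. indicator B \<omega> * Y \<omega> \<partial>M) = (\<integral>\<omega>. indicator (B \<inter> (X h -` A \<inter> space M)) \<omega> - p * indicator B \<omega> \<partial>M)"
    by (intro Bochner_Integration.integral_cong) (auto simp: Y_def indicator_def)
  also have "\<dots> = prob (B \<inter> (X h -` A \<inter> space M)) - p * prob B"
    using i1 i2 by simp
  finally show ?thesis using z by (simp add: p_def)
qed

lemma distr_X_unit:
  assumes h: "norm h = 1"
  shows "distr M borel (X h) = std_normal_distribution"
proof (rule Levy_uniqueness)
  show "real_distribution (distr M borel (X h))" by simp
  show "real_distribution std_normal_distribution" by (rule real_dist_normal_dist)
  show "char (distr M borel (X h)) = char std_normal_distribution"
  proof
    fix t
    have ae: "AE \<omega> in M. X (t *\<^sub>R h) \<omega> = t * X h \<omega>" using AE_X_linear[of t h 0 h] by simp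
    have i: "integrable M (\<lambda>\<omega>. iexp (X (t *\<^sub>R h) \<omega>))" by (rule integrable_iexp) simp_all
    have "char (distr M borel (X h)) t = (\<integral>\<omega>. iexp (t * X h \<omega>) \<partial>M)"
      unfolding char_def by (subst integral_distr) auto
    also have "\<dots> = (\<integral>\<omega>. iexp (X (t *\<^sub>R h) \<omega>) \<partial>M)"
      using ae by (intro integral_cong_AE) auto
    also have "\<dots> = Complex (\<integral>\<omega>. Re (iexp (X (t *\<^sub>R h) \<omega>)) \<partial>M) (\<integral>\<omega>. Im (iexp (X (t *\<^sub>R h) \<omega>)) \<partial>M)"
      using i by (simp add: integral_Re integral_Im del: Re_exp Im_exp)
    also have "\<dots> = complex_of_real (exp (- t\<^sup>2 / 2))"
      using h by (simp add: Re_exp Im_exp integral_cos_X integral_sin_X norm_eq_1 power2_eq_square complex_of_real_def)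
    finally show "char (distr M borel (X h)) t = char std_normal_distribution t"
      by (simp add: char_std_normal_distribution)
  qed
qed

text \<open>\<open>f\<close> depends on \<omega> only through the residuals, which are independent
  of \<open>X h\<close>, so \<open>X h\<close> can be integrated out with \<omega> frozen. To make
  this a Fubini argument, \<open>M\<close> is restricted to the sigma-algebra of the residuals: on
  that space the pair of \<omega> and \<open>X h \<omega>\<close> has a product law.\<close>

lemma integral_residual:
  fixes f :: "'w \<Rightarrow> real \<Rightarrow> real"
  assumes h: "norm h = 1"
    and f: "case_prod f \<in> borel_measurable (process_algebra M (residual h) \<Otimes>\<^sub>M borel)"
    and int: "integrable M (\<lambda>\<omega>. f \<omega> (X h \<omega>))"
  shows "(\<integral>\<omega>. f \<omega> (X h \<omega>) \<partial>M) = (\<integral>\<omega>. (\<integral>x. f \<omega> x \<partial>std_normal_distribution) \<partial>M)"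
proof -
  have sub: "subalgebra M (process_algebra M (residual h))"
    by (rule subalgebra_process_algebra) simp
  define N where "N = restr_to_subalg M (process_algebra M (residual h))"
  have sets_N [measurable_cong]: "sets N = sets (process_algebra M (residual h))"
    by (simp add: N_def sets_restr_to_subalg[OF sub])
  have space_N: "space N = space M" by (simp add: N_def space_restr_to_subalg)
  have id [measurable]: "(\<lambda>\<omega>. \<omega>) \<in> measurable M N"
    by (rule measurable_from_subalg[OF sub]) (rule measurable_ident_sets[OF sets_N[symmetric]])
  have distr_id: "distr M N (\<lambda>\<omega>. \<omega>) = N"
  proof (rule measure_eqI)
    fix A assume A: "A \<in> sets (distr M N (\<lambda>\<omega>. \<omega>))"
    then have AN: "A \<in> sets N" by simp
    then have "A \<subseteq> space M" using sets.sets_into_space[OF AN] space_N by simp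
    then have "(\<lambda>\<omega>. \<omega>) -` A \<inter> space M = A" by auto
    then have "emeasure (distr M N (\<lambda>\<omega>. \<omega>)) A = emeasure M A"
      using AN id by (simp add: emeasure_distr)
    also have "\<dots> = emeasure N A"
      using AN unfolding N_def by (subst emeasure_restr_to_subalg[OF sub]) (simp_all add: sets_restr_to_subalg[OF sub])
    finally show "emeasure (distr M N (\<lambda>\<omega>. \<omega>)) A = emeasure N A" .
  qed simp
  have dist: "distr M (N \<Otimes>\<^sub>M borel) (\<lambda>\<omega>. (\<omega>, X h \<omega>)) = N \<Otimes>\<^sub>M std_normal_distribution"
  proof (subst distr_Pair_indep)
    fix B A assume B: "B \<in> sets N" and A: "A \<in> sets (borel :: real measure)"
    have "B \<subseteq> space M" using sets.sets_into_space[OF B] space_N by simp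
    then have "(\<lambda>\<omega>. \<omega>) -` B \<inter> space M = B" by auto
    then show "prob ((\<lambda>\<omega>. \<omega>) -` B \<inter> space M \<inter> (X h -` A \<inter> space M)) = prob ((\<lambda>\<omega>. \<omega>) -` B \<inter> space M) * prob (X h -` A \<inter> space M)"
      using residual_indep[OF h A, of B] B by (simp add: sets_N)
  qed (simp_all add: distr_id distr_X_unit[OF h])
  interpret N: prob_space N
    unfolding N_def by (rule prob_space_restr_to_subalg[OF sub prob_space_axioms])
  interpret G: real_distribution std_normal_distribution by (rule real_dist_normal_dist)
  interpret P: pair_prob_space N std_normal_distribution ..
  have fm: "case_prod f \<in> borel_measurable (N \<Otimes>\<^sub>M borel)"
    using f by (simp cong: measurable_cong_sets add: sets_pair_measure_cong[OF sets_N refl])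
  have "integrable (distr M (N \<Otimes>\<^sub>M borel) (\<lambda>\<omega>. (\<omega>, X h \<omega>))) (case_prod f)"
    using int by (subst integrable_distr_eq) (auto intro: fm)
  then have "integrable (N \<Otimes>\<^sub>M std_normal_distribution) (case_prod f)" by (simp add: dist)
  then have "(\<integral>\<omega>. (\<integral>x. f \<omega> x \<partial>std_normal_distribution) \<partial>N) = integral\<^sup>L (N \<Otimes>\<^sub>M std_normal_distribution) (case_prod f)"
    by (rule P.integral_fst)
  also have "\<dots> = (\<integral>\<omega>. f \<omega> (X h \<omega>) \<partial>M)"
    unfolding dist[symmetric] by (subst integral_distr) (auto intro: fm)
  also have "(\<integral>\<omega>. (\<integral>x. f \<omega> x \<partial>std_normal_distribution) \<partial>N) = (\<integral>\<omega>. (\<integral>x. f \<omega> x \<partial>std_normal_distribution) \<partial>M)"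
  proof -
    have "(\<lambda>\<omega>. \<integral>x. f \<omega> x \<partial>std_normal_distribution) \<in> borel_measurable N"
      by (rule G.borel_measurable_lebesgue_integral) (use fm in \<open>simp cong: measurable_cong_sets\<close>)
    then show ?thesis
      unfolding N_def by (intro integral_subalgebra2[OF sub]) (simp cong: measurable_cong_sets add: sets_restr_to_subalg[OF sub])
  qed
  finally show ?thesis by simp
qed

end

section \<open>Smooth functions of finitely many coordinates\<close>

definition depends_on :: "nat \<Rightarrow> ((nat \<Rightarrow> real) \<Rightarrow> real) \<Rightarrow> bool" where
  "depends_on n f \<longleftrightarrow> (\<forall>x y. (\<forall>i<n. x i = y i) \<longrightarrow> f x = f y)"

lemma depends_on_upd: "depends_on n f \<Longrightarrow> n \<le> i \<Longrightarrow> f (x(i := t)) = f x"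
  unfolding depends_on_def by auto

lemma pdv_eq_0_if_depends_on:
  assumes "depends_on n f" "n \<le> i" shows "pdv i f x = 0"
  using depends_on_upd[OF assms] by (simp add: pdv_def)

lemma depends_on_pdv:
  assumes f: "depends_on n f" shows "depends_on n (pdv i f)"
proof (cases "i < n")
  case True
  show ?thesis unfolding depends_on_def
  proof (intro allI impI)
    fix x y :: "nat \<Rightarrow> real" assume xy: "\<forall>i<n. x i = y i"
    then have "f (x(i := t)) = f (y(i := t))" for t
      using f by (auto simp: depends_on_def)
    then show "pdv i f x = pdv i f y" using xy True by (simp add: pdv_def)
  qed
next
  case False
  then show ?thesis using pdv_eq_0_if_depends_on[OF f] by (simp add: depends_on_def)
qed

lemma depends_on_foldr_pdv: "depends_on n f \<Longrightarrow> depends_on n (foldr pdv is f)"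
  by (induction "is") (auto intro: depends_on_pdv)

lemma smooth_fun_depends_on: "smooth_fun n f \<Longrightarrow> depends_on n f"
  by (simp add: smooth_fun_def depends_on_def)

lemma smooth_fun_foldr:
  assumes "smooth_fun n f" "set is \<subseteq> {..<n}"
  shows "continuous_on UNIV (foldr pdv is f)"
    and "i < n \<Longrightarrow> (\<lambda>t. foldr pdv is f (x(i := t))) field_differentiable at (x i)"
  using assms by (auto simp: smooth_fun_def)

lemma smooth_fun_pdv:
  assumes f: "smooth_fun n f" and "i < n" shows "smooth_fun n (pdv i f)"
proof -
  have "foldr pdv is (pdv i f) = foldr pdv (is @ [i]) f" for "is" by simp
  moreover have "set (is @ [i]) \<subseteq> {..<n}" if "set is \<subseteq> {..<n}" for "is" using that assms by auto
  ultimately have "continuous_on UNIV (foldr pdv is (pdv i f))"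
    "j < n \<Longrightarrow> (\<lambda>t. foldr pdv is (pdv i f) (x(j := t))) field_differentiable at (x j)"
    if "set is \<subseteq> {..<n}" for "is" j x
    using smooth_fun_foldr[OF f] that by presburger+
  then show ?thesis
    using depends_on_pdv[OF smooth_fun_depends_on[OF f], of i]
    unfolding smooth_fun_def depends_on_def by blast
qed

lemma smooth_fun_continuous: "smooth_fun n f \<Longrightarrow> continuous_on UNIV f"
  using smooth_fun_foldr(1)[of n f "[]"] by simp

lemma smooth_fun_differentiable:
  "smooth_fun n f \<Longrightarrow> i < n \<Longrightarrow> (\<lambda>t. f (x(i := t))) field_differentiable at (x i)"
  using smooth_fun_foldr(2)[of n f "[]"] by simp

lemma smooth_fun_has_derivative:
  assumes "smooth_fun n f" "i < n"
  shows "((\<lambda>t. f (x(i := t))) has_real_derivative pdv i f (x(i := s))) (at s)"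
proof -
  have "(\<lambda>t. f ((x(i := s))(i := t))) field_differentiable at ((x(i := s)) i)"
    by (rule smooth_fun_differentiable[OF assms])
  then show ?thesis by (simp add: pdv_def DERIV_deriv_iff_field_differentiable)
qed

text \<open>A coinduction principle for smoothness: iterated partial derivatives never leave
  \<open>C\<close>, so first-order regularity of the members of \<open>C\<close> suffices.\<close>

lemma smooth_funI_closed:
  assumes C: "\<And>g. g \<in> C \<Longrightarrow> continuous_on UNIV g"
    "\<And>g i x. g \<in> C \<Longrightarrow> i < n \<Longrightarrow> (\<lambda>t. g (x(i := t))) field_differentiable at (x i)"
    "\<And>g i. g \<in> C \<Longrightarrow> i < n \<Longrightarrow> pdv i g \<in> C"
    and f: "f \<in> C" "depends_on n f"
  shows "smooth_fun n f"
proof -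
  have "foldr pdv is f \<in> C" if "set is \<subseteq> {..<n}" for "is"
    using that by (induction "is") (auto intro: C f)
  then show ?thesis using f(2) C unfolding smooth_fun_def depends_on_def by auto
qed

text \<open>An algebra of functions with generators closed under \<open>pdv\<close> is closed under \<open>pdv\<close>; this avoids
  a Leibniz formula for iterated derivatives of a product.\<close>

inductive_set fun_algebra :: "('a \<Rightarrow> real) set \<Rightarrow> ('a \<Rightarrow> real) set" for G where
  gen: "g \<in> G \<Longrightarrow> g \<in> fun_algebra G"
| add: "g \<in> fun_algebra G \<Longrightarrow> h \<in> fun_algebra G \<Longrightarrow> (\<lambda>x. g x + h x) \<in> fun_algebra G"
| mult: "g \<in> fun_algebra G \<Longrightarrow> h \<in> fun_algebra G \<Longrightarrow> (\<lambda>x. g x * h x) \<in> fun_algebra G"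

lemma pdv_add:
  assumes "(\<lambda>t. f (x(i := t))) field_differentiable at (x i)" "(\<lambda>t. g (x(i := t))) field_differentiable at (x i)"
  shows "pdv i (\<lambda>x. f x + g x) x = pdv i f x + pdv i g x"
  using assms by (simp add: pdv_def deriv_add)

lemma pdv_mult:
  assumes "(\<lambda>t. f (x(i := t))) field_differentiable at (x i)" "(\<lambda>t. g (x(i := t))) field_differentiable at (x i)"
  shows "pdv i (\<lambda>x. f x * g x) x = f x * pdv i g x + pdv i f x * g x"
  using assms by (simp add: pdv_def deriv_mult)

lemma fun_algebra_pdv_closed:
  assumes G: "\<And>g. g \<in> G \<Longrightarrow> continuous_on UNIV g"
    "\<And>g i x. g \<in> G \<Longrightarrow> i < n \<Longrightarrow> (\<lambda>t. g (x(i := t))) field_differentiable at (x i)"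
    "\<And>g i. g \<in> G \<Longrightarrow> i < n \<Longrightarrow> pdv i g \<in> G"
    and f: "f \<in> fun_algebra G"
  shows "continuous_on UNIV f \<and> (\<forall>i<n. (\<forall>x. (\<lambda>t. f (x(i := t))) field_differentiable at (x i)) \<and> pdv i f \<in> fun_algebra G)"
  using f
proof induction
  case (gen g)
  then show ?case using G by (auto intro: fun_algebra.gen simp del: fun_upd_apply)
next
  case (add g h)
  have "pdv i (\<lambda>x. g x + h x) = (\<lambda>x. pdv i g x + pdv i h x)" if "i < n" for i
    using add that by (intro ext pdv_add) (auto simp del: fun_upd_apply)
  then show ?case using add
    by (auto intro!: continuous_intros fun_algebra.add field_differentiable_add simp del: fun_upd_apply)
next
  case (mult g h)
  have "pdv i (\<lambda>x. g x * h x) = (\<lambda>x. g x * pdv i h x + pdv i g x * h x)" if "i < n" for i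
    using mult that by (intro ext pdv_mult) (auto simp del: fun_upd_apply)
  then show ?case using mult
    by (auto intro!: continuous_intros fun_algebra.add fun_algebra.mult field_differentiable_mult simp del: fun_upd_apply)
qed

section \<open>Products of functions of separate blocks of coordinates\<close>

lemma shift_upd_less: "i < (n::nat) \<Longrightarrow> (\<lambda>j. (x(i := t)) (n + j)) = (\<lambda>j. x (n + j))"
  by (auto simp: fun_eq_iff)

lemma shift_upd_ge: "(\<lambda>j. (x((n::nat) + i := t)) (n + j)) = (\<lambda>j. x (n + j))(i := t)"
  by (auto simp: fun_eq_iff)

lemma pdv_shift_less: "i < n \<Longrightarrow> pdv i (\<lambda>x. k (\<lambda>j. x (n + j))) x = 0"
  unfolding pdv_def by (simp add: shift_upd_less del: fun_upd_apply)

lemma pdv_shift_ge: "pdv (n + i) (\<lambda>x. k (\<lambda>j. x (n + j))) x = pdv i k (\<lambda>j. x (n + j))"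
  unfolding pdv_def by (simp add: shift_upd_ge del: fun_upd_apply)

lemma smooth_fun_tensor:
  assumes f: "smooth_fun n f" and k: "smooth_fun m k"
  shows "smooth_fun (n + m) (\<lambda>x. f x * k (\<lambda>j. x (n + j)))"
    and "i < n \<Longrightarrow> pdv i (\<lambda>x. f x * k (\<lambda>j. x (n + j))) x = pdv i f x * k (\<lambda>j. x (n + j))"
    and "j < m \<Longrightarrow> pdv (n + j) (\<lambda>x. f x * k (\<lambda>j. x (n + j))) x = f x * pdv j k (\<lambda>j. x (n + j))"
proof -
  \<comment> \<open>The generators are all iterated derivatives of the two factors. The zero
    function is included because each factor is constant in the coordinates of the other
    block.\<close>
  define G where "G = {foldr pdv is f | is. set is \<subseteq> {..<n}} \<union>
    {\<lambda>x. foldr pdv is k (\<lambda>j. x (n + j)) | is. set is \<subseteq> {..<m}} \<union> {\<lambda>x. 0}"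
  have G1: "(\<lambda>t. foldr pdv is f (x(i := t))) field_differentiable at (x i)"
    if "set is \<subseteq> {..<n}" for "is" i x
  proof (cases "i < n")
    case True then show ?thesis using smooth_fun_foldr(2)[OF f that] by simp
  next
    case False
    then show ?thesis
      using depends_on_upd[OF depends_on_foldr_pdv[OF smooth_fun_depends_on[OF f]], of i "is" x] by simp
  qed
  have G2: "(\<lambda>t. foldr pdv is k (\<lambda>j. (x(i := t)) (n + j))) field_differentiable at (x i)"
    if "set is \<subseteq> {..<m}" "i < n + m" for "is" i x
  proof (cases "i < n")
    case True then show ?thesis by (simp add: shift_upd_less del: fun_upd_apply)
  next
    case False
    then obtain i' where i: "i = n + i'" by (metis le_add_diff_inverse not_less)
    show ?thesis using smooth_fun_foldr(2)[OF k that(1), of i' "\<lambda>j. x (n + j)"] that(2)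
      unfolding i by (simp add: shift_upd_ge del: fun_upd_apply)
  qed
  have Gcont: "continuous_on UNIV g" if "g \<in> G" for g
  proof -
    have "continuous_on UNIV (\<lambda>x. foldr pdv is k (\<lambda>j. x (n + j)))" if "set is \<subseteq> {..<m}" for "is"
      by (rule continuous_on_compose2[OF smooth_fun_foldr(1)[OF k that]])
        (auto intro!: continuous_on_coordinatewise_then_product)
    then show ?thesis using that smooth_fun_foldr(1)[OF f] by (auto simp: G_def)
  qed
  have Gdiff: "(\<lambda>t. g (x(i := t))) field_differentiable at (x i)" if "g \<in> G" "i < n + m" for g i x
    using that G1[of _ x i] G2[of _ i x] by (auto simp: G_def simp del: fun_upd_apply)
  have Gpdv: "pdv i g \<in> G" if g: "g \<in> G" and i: "i < n + m" for g i
  proof -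
    have z: "(\<lambda>x. 0) \<in> G" by (simp add: G_def)
    consider (f) "is" where "g = foldr pdv is f" "set is \<subseteq> {..<n}" | (k) "is" where "g = (\<lambda>x. foldr pdv is k (\<lambda>j. x (n + j)))" "set is \<subseteq> {..<m}" | (z) "g = (\<lambda>x. 0)"
      using g by (auto simp: G_def)
    then show ?thesis
    proof cases
      case f': f
      show ?thesis
      proof (cases "i < n")
        case True
        have "pdv i g = foldr pdv (i # is) f" "set (i # is) \<subseteq> {..<n}" using f' True by auto
        then show ?thesis unfolding G_def by blast
      next
        case False
        then have "pdv i g = (\<lambda>x. 0)"
          using pdv_eq_0_if_depends_on[OF depends_on_foldr_pdv[OF smooth_fun_depends_on[OF f]]] f' by auto
        then show ?thesis using z by simp
      qed
    next
      case k': k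
      show ?thesis
      proof (cases "i < n")
        case True
        then have "pdv i g = (\<lambda>x. 0)" unfolding k' by (auto simp: pdv_shift_less)
        then show ?thesis using z by simp
      next
        case False
        then obtain i' where i': "i = n + i'" by (metis le_add_diff_inverse not_less)
        have "pdv i g = (\<lambda>x. foldr pdv (i' # is) k (\<lambda>j. x (n + j)))" unfolding k' i' by (auto simp: pdv_shift_ge)
        moreover have "set (i' # is) \<subseteq> {..<m}" using k' i i' by auto
        ultimately show ?thesis unfolding G_def by blast
      qed
    next
      case z': z
      have "pdv i g = (\<lambda>x. 0)" unfolding z' by (rule ext) (simp add: pdv_def)
      then show ?thesis using z by simp
    qed
  qed
  have fG: "f \<in> G" unfolding G_def by (rule UnI1, rule UnI1, rule CollectI, rule exI[of _ "[]"]) simp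
  have kG: "(\<lambda>x. k (\<lambda>j. x (n + j))) \<in> G" unfolding G_def by (rule UnI1, rule UnI2, rule CollectI, rule exI[of _ "[]"]) simp
  show "smooth_fun (n + m) (\<lambda>x. f x * k (\<lambda>j. x (n + j)))"
  proof (rule smooth_funI_closed[where C = "fun_algebra G"])
    show "depends_on (n + m) (\<lambda>x. f x * k (\<lambda>j. x (n + j)))"
      unfolding depends_on_def
    proof (intro allI impI)
      fix x y :: "nat \<Rightarrow> real" assume xy: "\<forall>i<n + m. x i = y i"
      have "f x = f y" using smooth_fun_depends_on[OF f] xy by (auto simp: depends_on_def)
      moreover have "k (\<lambda>j. x (n + j)) = k (\<lambda>j. y (n + j))"
        using smooth_fun_depends_on[OF k, unfolded depends_on_def, rule_format, of "\<lambda>j. x (n + j)" "\<lambda>j. y (n + j)"] xy by simp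
      ultimately show "f x * k (\<lambda>j. x (n + j)) = f y * k (\<lambda>j. y (n + j))" by simp
    qed
    show "(\<lambda>x. f x * k (\<lambda>j. x (n + j))) \<in> fun_algebra G"
      by (intro fun_algebra.mult fun_algebra.gen fG kG)
  qed (use fun_algebra_pdv_closed[OF Gcont Gdiff Gpdv] in blast)+
  have d1: "(\<lambda>t. f (x(i := t))) field_differentiable at (x i)" if "i < n + m" for i x using Gdiff[OF fG that] .
  have d2: "(\<lambda>t. k (\<lambda>j. (x(i := t)) (n + j))) field_differentiable at (x i)" if "i < n + m" for i x using Gdiff[OF kG that] .
  show "i < n \<Longrightarrow> pdv i (\<lambda>x. f x * k (\<lambda>j. x (n + j))) x = pdv i f x * k (\<lambda>j. x (n + j))"
    by (subst pdv_mult) (auto intro!: d1 d2 simp: pdv_shift_less simp del: fun_upd_apply)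
  show "j < m \<Longrightarrow> pdv (n + j) (\<lambda>x. f x * k (\<lambda>j. x (n + j))) x = f x * pdv j k (\<lambda>j. x (n + j))"
    using pdv_eq_0_if_depends_on[OF smooth_fun_depends_on[OF f], of "n + j" x]
    by (subst pdv_mult) (auto intro!: d1 d2 simp: pdv_shift_ge simp del: fun_upd_apply)
qed

section \<open>Compact support and boundedness\<close>

lemma compact_support_pdv:
  assumes f: "compact_support_fun n f" shows "compact_support_fun n (pdv i f)"
proof -
  obtain R where R: "\<And>x j. j < n \<Longrightarrow> R < \<bar>x j\<bar> \<Longrightarrow> f x = 0" using f by (auto simp: compact_support_fun_def)
  have "pdv i f x = 0" if j: "j < n" "R < \<bar>x j\<bar>" for x j
  proof (cases "j = i")
    case False
    then have "f (x(i := t)) = 0" for t using R[of j "x(i := t)"] j by simp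
    then show ?thesis by (simp add: pdv_def)
  next
    case True
    \<comment> \<open>Differentiating in the large coordinate itself needs a whole neighbourhood on
      which \<open>f\<close> vanishes, not only a line through the point.\<close>
    have "open {t :: real. R < \<bar>t\<bar>}" by (intro open_Collect_less continuous_intros)
    then have "\<forall>\<^sub>F t in nhds (x i). R < \<bar>t\<bar>" using j True by (auto simp: eventually_nhds)
    then have "\<forall>\<^sub>F t in nhds (x i). f (x(i := t)) = 0"
      by eventually_elim (use R[of j] j True in auto)
    then have "deriv (\<lambda>t. f (x(i := t))) (x i) = deriv (\<lambda>t. 0) (x i)" by (rule deriv_cong_ev) simp
    then show ?thesis by (simp add: pdv_def)
  qed
  then show ?thesis unfolding compact_support_fun_def by blast
qed

text \<open>Coordinates from \<open>n\<close> on do not influence \<open>f\<close> and can be set to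
  0. The remaining box is compact in the product topology by Tychonoff's theorem.\<close>

lemma compact_support_bounded:
  assumes c: "continuous_on UNIV f" and d: "depends_on n f" and s: "compact_support_fun n f"
  obtains K where "\<And>x. \<bar>f x\<bar> \<le> K"
proof -
  obtain R where R: "\<And>x j. j < n \<Longrightarrow> R < \<bar>x j\<bar> \<Longrightarrow> f x = 0" using s by (auto simp: compact_support_fun_def)
  define B where "B = (\<Pi>\<^sub>E i\<in>UNIV. if i < n then {- \<bar>R\<bar>..\<bar>R\<bar>} else {0::real})"
  have "compactin (product_topology (\<lambda>i::nat. euclidean) UNIV) B"
    unfolding B_def by (subst compactin_PiE) auto
  then have "compact B" by (simp add: euclidean_product_topology)
  then have "compact (f ` B)" using c by (intro compact_continuous_image) (auto intro: continuous_on_subset)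
  then have "bounded (f ` B)" by (rule compact_imp_bounded)
  then obtain K where "\<forall>y\<in>f ` B. norm y \<le> K" unfolding bounded_iff by blast
  then have K: "\<bar>f x\<bar> \<le> K" if "x \<in> B" for x using that by simp
  have "\<bar>f x\<bar> \<le> \<bar>K\<bar>" for x
  proof (cases "\<exists>j<n. R < \<bar>x j\<bar>")
    case True
    then obtain j where "j < n" "R < \<bar>x j\<bar>" by blast
    then show ?thesis using R[of j x] by simp
  next
    case False
    let ?y = "\<lambda>i. if i < n then x i else 0"
    have "- \<bar>R\<bar> \<le> x i \<and> x i \<le> \<bar>R\<bar>" if "i < n" for i
    proof -
      have "\<bar>x i\<bar> \<le> R" using False that by (meson not_less)
      then show ?thesis by linarith
    qed
    then have "?y \<in> B" by (simp add: B_def PiE_iff)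
    moreover have "f x = f ?y" using d by (auto simp: depends_on_def)
    ultimately show ?thesis using K[of ?y] by simp
  qed
  then show ?thesis by (rule that)
qed

text \<open>The classical proof that continuous partial derivatives give a chain rule, by induction
  on the number \<open>k\<close> of moving coordinates: the coordinates are released one after the
  other.\<close>

lemma smooth_fun_line_derivative_0:
  assumes f: "smooth_fun n f" and k: "k \<le> n"
  shows "((\<lambda>t. f (\<lambda>i. y i + (if i < k then t * c i else 0))) has_real_derivative (\<Sum>i<k. pdv i f y * c i)) (at 0)"
  using k
proof (induction k)
  case 0
  then show ?case by simp
next
  case (Suc k)
  let ?z = "\<lambda>t i. y i + (if i < k then t * c i else 0)"
  \<comment> \<open>In \<open>w (t, s)\<close> the coordinates below \<open>k\<close> have moved by
    time \<open>t\<close>, and coordinate \<open>k\<close> is displaced by \<open>s\<close>,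
    independently of \<open>t\<close>.\<close>
  define w where "w p = (\<lambda>i. if i = k then y k + snd p else ?z (fst p) i)" for p :: "real \<times> real"
  have kn: "k < n" using Suc by simp
  have w_cont: "continuous_on UNIV w"
  proof (rule continuous_on_coordinatewise_then_product)
    fix i show "continuous_on UNIV (\<lambda>p. w p i)"
      unfolding w_def by (cases "i = k"; cases "i < k") (auto intro!: continuous_intros)
  qed
  define \<phi> where "\<phi> p = pdv k f (w p)" for p
  have "continuous_on UNIV (pdv k f)"
    using smooth_fun_continuous[OF smooth_fun_pdv[OF f kn]] .
  then have \<phi>_cont: "continuous_on UNIV \<phi>"
    unfolding \<phi>_def by (rule continuous_on_compose2[OF _ w_cont]) auto
  \<comment> \<open>Only coordinate \<open>k\<close> differs between the two points, so the
    one-dimensional mean value theorem applies. Joint continuity of \<open>pdv k f\<close> later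
    removes the unknown intermediate point.\<close>
  have mv: "\<exists>\<theta>. 0 < \<theta> \<and> \<theta> < 1 \<and> f (w (t, t * c k)) - f (w (t, 0)) = t * c k * \<phi> (t, \<theta> * (t * c k))" for t
  proof -
    have upd: "w (t, s) = (w (t, 0))(k := y k + s)" for s
      by (auto simp: w_def fun_eq_iff)
    have "((\<lambda>s. f (w (t, s * (t * c k)))) has_real_derivative t * c k * \<phi> (t, s * (t * c k))) (at s)" for s
    proof -
      have "((\<lambda>v. f ((w (t, 0))(k := v))) has_real_derivative pdv k f ((w (t, 0))(k := y k + s * (t * c k)))) (at (y k + s * (t * c k)))"
        by (rule smooth_fun_has_derivative[OF f kn])
      moreover have "((\<lambda>s. y k + s * (t * c k)) has_real_derivative t * c k) (at s)"
        by (auto intro!: derivative_eq_intros)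
      ultimately have "((\<lambda>s. f ((w (t, 0))(k := y k + s * (t * c k)))) has_real_derivative pdv k f ((w (t, 0))(k := y k + s * (t * c k))) * (t * c k)) (at s)"
        by (rule DERIV_chain2)
      then show ?thesis unfolding \<phi>_def upd[of "_ * (t * c k)", symmetric] by (simp only: mult.commute)
    qed
    from MVT2[OF zero_less_one this]
    show ?thesis by auto
  qed
  then obtain \<theta> where \<theta>: "\<And>t. 0 < \<theta> t" "\<And>t. \<theta> t < 1"
    "\<And>t. f (w (t, t * c k)) - f (w (t, 0)) = t * c k * \<phi> (t, \<theta> t * (t * c k))" by metis
  have lim0: "((\<lambda>t. (t, \<theta> t * (t * c k))) \<longlongrightarrow> (0, 0)) (at 0)"
  proof (intro tendsto_Pair tendsto_ident_at)
    have "((\<lambda>t. t * c k) \<longlongrightarrow> 0) (at 0)" by (auto intro!: tendsto_eq_intros)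
    then show "((\<lambda>t. \<theta> t * (t * c k)) \<longlongrightarrow> 0) (at 0)"
    proof (rule tendsto_0_le[where K = 1])
      show "\<forall>\<^sub>F t in at 0. norm (\<theta> t * (t * c k)) \<le> norm (t * c k) * 1"
      proof (intro always_eventually allI)
        fix t
        have "\<bar>\<theta> t\<bar> * \<bar>t * c k\<bar> \<le> 1 * \<bar>t * c k\<bar>" using \<theta>[of t] by (intro mult_right_mono) auto
        then show "norm (\<theta> t * (t * c k)) \<le> norm (t * c k) * 1" by (simp add: abs_mult)
      qed
    qed
  qed
  have "isCont \<phi> (0, 0)" using \<phi>_cont by (simp add: continuous_on_eq_continuous_at)
  from isCont_tendsto_compose[OF this lim0]
  have "((\<lambda>t. c k * \<phi> (t, \<theta> t * (t * c k))) \<longlongrightarrow> c k * \<phi> (0, 0)) (at 0)" by (intro tendsto_mult_left)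
  then have lim: "((\<lambda>t. (f (w (t, t * c k)) - f (w (t, 0))) / t) \<longlongrightarrow> c k * \<phi> (0, 0)) (at 0)"
  proof (rule Lim_transform_eventually)
    show "\<forall>\<^sub>F t in at 0. c k * \<phi> (t, \<theta> t * (t * c k)) = (f (w (t, t * c k)) - f (w (t, 0))) / t"
      using \<theta>(3) by (auto simp: eventually_at_filter)
  qed
  have w0: "w (0, 0) = y" by (auto simp: w_def fun_eq_iff)
  have \<phi>0: "\<phi> (0, 0) = pdv k f y" by (simp add: \<phi>_def w0)
  have wz: "w (t, 0) = ?z t" for t by (auto simp: w_def fun_eq_iff)
  have "((\<lambda>t. f (w (t, t * c k)) - f (w (t, 0))) has_real_derivative c k * \<phi> (0, 0)) (at 0)"
    using lim by (simp add: has_field_derivative_iff w0)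
  then have "((\<lambda>t. f (w (t, t * c k)) - f (?z t)) has_real_derivative c k * pdv k f y) (at 0)"
    unfolding \<phi>0 wz .
  moreover have "((\<lambda>t. f (?z t)) has_real_derivative (\<Sum>i<k. pdv i f y * c i)) (at 0)"
    using Suc by simp
  ultimately have "((\<lambda>t. (f (w (t, t * c k)) - f (?z t)) + f (?z t)) has_real_derivative c k * pdv k f y + (\<Sum>i<k. pdv i f y * c i)) (at 0)"
    by (rule DERIV_add)
  moreover have "w (t, t * c k) = (\<lambda>i. y i + (if i < Suc k then t * c i else 0))" for t
    by (auto simp: w_def fun_eq_iff)
  ultimately show ?case by (simp add: add.commute mult.commute)
qed

lemma smooth_fun_line_derivative:
  assumes f: "smooth_fun n f"
  shows "((\<lambda>t. f (\<lambda>i. y i + t * c i)) has_real_derivative (\<Sum>i<n. pdv i f (\<lambda>i. y i + t * c i) * c i)) (at t)"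
proof -
  have "f (\<lambda>i. y i + s * c i) = f (\<lambda>i. (y i + t * c i) + (if i < n then (s + - t) * c i else 0))" for s
    using smooth_fun_depends_on[OF f] unfolding depends_on_def by (auto simp: algebra_simps)
  moreover have "((\<lambda>s. f (\<lambda>i. (y i + t * c i) + (if i < n then s * c i else 0))) has_real_derivative (\<Sum>i<n. pdv i f (\<lambda>i. y i + t * c i) * c i)) (at (t - t))"
    using smooth_fun_line_derivative_0[OF f order_refl, of "\<lambda>i. y i + t * c i" c] by simp
  then have "((\<lambda>s. f (\<lambda>i. (y i + t * c i) + (if i < n then (s + - t) * c i else 0))) has_real_derivative (\<Sum>i<n. pdv i f (\<lambda>i. y i + t * c i) * c i)) (at t)"
    by (subst DERIV_shift[symmetric]) simp
  ultimately show ?thesis by (simp only:)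
qed

lemma sum_lessThan_add: "(\<Sum>i<n + m. f i) = (\<Sum>i<n. f i) + (\<Sum>j<m. f (n + j))" for f :: "nat \<Rightarrow> 'a::comm_monoid_add"
  by (induction m) (simp_all add: add.assoc)

section \<open>Products of cylindrical random variables\<close>

text \<open>The two families of directions are concatenated, even when they share vectors. The
  product then depends on separate blocks of coordinates, and its derivative is given by
  \<open>smooth_fun_tensor\<close>.\<close>

lemma smooth_cylindrical_mult:
  assumes "(G, W) \<in> smooth_cylindrical X" "(G', W') \<in> smooth_cylindrical X"
  shows "(\<lambda>\<omega>. G \<omega> * G' \<omega>, \<lambda>\<omega>. G' \<omega> *\<^sub>R W \<omega> + G \<omega> *\<^sub>R W' \<omega>) \<in> smooth_cylindrical X"
proof -
  obtain n f h where 1: "G = (\<lambda>\<omega>. f (\<lambda>i. X (h i) \<omega>))" "W = (\<lambda>\<omega>. \<Sum>i<n. pdv i f (\<lambda>j. X (h j) \<omega>) *\<^sub>R h i)"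
    "1 \<le> n" "smooth_fun n f" "compact_support_fun n f"
    using assms(1) by (auto simp: smooth_cylindrical_def)
  obtain m k g where 2: "G' = (\<lambda>\<omega>. k (\<lambda>i. X (g i) \<omega>))" "W' = (\<lambda>\<omega>. \<Sum>i<m. pdv i k (\<lambda>j. X (g j) \<omega>) *\<^sub>R g i)"
    "1 \<le> m" "smooth_fun m k" "compact_support_fun m k"
    using assms(2) by (auto simp: smooth_cylindrical_def)
  let ?F = "\<lambda>x. f x * k (\<lambda>j. x (n + j))"
  define e where "e i = (if i < n then h i else g (i - n))" for i
  have fe: "p (\<lambda>i. X (e i) \<omega>) = p (\<lambda>i. X (h i) \<omega>)" if "depends_on n p" for p :: "(nat \<Rightarrow> real) \<Rightarrow> real" and \<omega>
    using that by (auto simp: depends_on_def e_def)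
  have ke: "(\<lambda>j. X (e (n + j)) \<omega>) = (\<lambda>j. X (g j) \<omega>)" for \<omega> by (auto simp: e_def)
  have val: "(\<lambda>\<omega>. G \<omega> * G' \<omega>) = (\<lambda>\<omega>. ?F (\<lambda>i. X (e i) \<omega>))"
    unfolding 1 2 by (simp add: ke fe[OF smooth_fun_depends_on[OF 1(4)]])
  have der: "(\<lambda>\<omega>. G' \<omega> *\<^sub>R W \<omega> + G \<omega> *\<^sub>R W' \<omega>) = (\<lambda>\<omega>. \<Sum>i<n + m. pdv i ?F (\<lambda>j. X (e j) \<omega>) *\<^sub>R e i)"
  proof
    fix \<omega>
    have "(\<Sum>i<n + m. pdv i ?F (\<lambda>j. X (e j) \<omega>) *\<^sub>R e i) = (\<Sum>i<n. pdv i ?F (\<lambda>j. X (e j) \<omega>) *\<^sub>R e i) + (\<Sum>j<m. pdv (n + j) ?F (\<lambda>j. X (e j) \<omega>) *\<^sub>R e (n + j))"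
      by (rule sum_lessThan_add)
    also have "(\<Sum>j<m. pdv (n + j) ?F (\<lambda>j. X (e j) \<omega>) *\<^sub>R e (n + j)) = (\<Sum>j<m. (f (\<lambda>i. X (h i) \<omega>) * pdv j k (\<lambda>j. X (g j) \<omega>)) *\<^sub>R g j)"
      by (intro sum.cong refl) (simp add: smooth_fun_tensor(3)[OF 1(4) 2(4)] ke fe[OF smooth_fun_depends_on[OF 1(4)]] e_def[of "n + _"])
    also have "\<dots> = G \<omega> *\<^sub>R W' \<omega>" unfolding 1 2 by (simp add: scaleR_sum_right)
    also have "(\<Sum>i<n. pdv i ?F (\<lambda>j. X (e j) \<omega>) *\<^sub>R e i) = (\<Sum>i<n. (pdv i f (\<lambda>i. X (h i) \<omega>) * k (\<lambda>j. X (g j) \<omega>)) *\<^sub>R h i)"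
      by (intro sum.cong refl) (simp add: smooth_fun_tensor(2)[OF 1(4) 2(4)] ke fe[OF depends_on_pdv[OF smooth_fun_depends_on[OF 1(4)]]], simp add: e_def)
    also have "\<dots> = G' \<omega> *\<^sub>R W \<omega>" unfolding 1 2 by (simp add: scaleR_sum_right mult.commute)
    finally show "G' \<omega> *\<^sub>R W \<omega> + G \<omega> *\<^sub>R W' \<omega> = (\<Sum>i<n + m. pdv i ?F (\<lambda>j. X (e j) \<omega>) *\<^sub>R e i)" by simp
  qed
  have cs: "compact_support_fun (n + m) ?F"
  proof -
    obtain R1 where R1: "\<And>x j. j < n \<Longrightarrow> R1 < \<bar>x j\<bar> \<Longrightarrow> f x = 0" using 1(5) by (auto simp: compact_support_fun_def)
    obtain R2 where R2: "\<And>x j. j < m \<Longrightarrow> R2 < \<bar>x j\<bar> \<Longrightarrow> k x = 0" using 2(5) by (auto simp: compact_support_fun_def)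
    have "?F x = 0" if j: "j < n + m" "max R1 R2 < \<bar>x j\<bar>" for x j
    proof (cases "j < n")
      case True then show ?thesis using R1[of j x] j by simp
    next
      case False then show ?thesis using R2[of "j - n" "\<lambda>j. x (n + j)"] j by simp
    qed
    then show ?thesis unfolding compact_support_fun_def by blast
  qed
  show ?thesis
    unfolding smooth_cylindrical_def val der
    using 1(3) smooth_fun_tensor(1)[OF 1(4) 2(4)] cs by (intro CollectI exI[of _ "n + m"] exI[of _ ?F] exI[of _ e]) auto
qed

section \<open>Integration by parts and closability\<close>

lemma borel_measurable_continuous_seq:
  fixes f :: "(nat \<Rightarrow> real) \<Rightarrow> real"
  assumes "continuous_on UNIV f" "\<And>i. v i \<in> borel_measurable N"
  shows "(\<lambda>x. f (\<lambda>i. v i x)) \<in> borel_measurable N"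
proof -
  have "(\<lambda>x i. v i x) \<in> borel_measurable N"
    using assms(2) by (intro measurable_coordinatewise_then_product)
  from measurable_compose[OF this borel_measurable_continuous_onI[OF assms(1)]] show ?thesis .
qed

text \<open>A damping factor: \<open>kap x\<close>, \<open>x * kap x\<close> and the derivative
  \<open>kap' x\<close> are all bounded by 1, and since \<open>kap\<close> is positive it can be
  divided out in the end.\<close>

definition kap :: "real \<Rightarrow> real" where "kap x = 1 / (1 + x\<^sup>2)"
definition kap' :: "real \<Rightarrow> real" where "kap' x = - 2 * x / (1 + x\<^sup>2)\<^sup>2"

lemma kap_pos: "kap x > 0"
  unfolding kap_def by (simp add: add_pos_nonneg)

lemma measurable_kap [measurable]: "kap \<in> borel_measurable borel" "kap' \<in> borel_measurable borel"
  unfolding kap_def[abs_def] kap'_def[abs_def] by measurable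

lemma one_plus_square_nz: "1 + x\<^sup>2 \<noteq> (0::real)"
  by (metis add_pos_nonneg less_irrefl zero_le_power2 zero_less_one)

lemma has_real_derivative_kap: "(kap has_real_derivative kap' x) (at x)"
  unfolding kap_def[abs_def] kap'_def
  by (auto intro!: derivative_eq_intros simp: one_plus_square_nz one_plus_square_nz[unfolded power2_eq_square] power2_eq_square)

lemma continuous_kap: "continuous_on UNIV kap" "continuous_on UNIV kap'"
  unfolding kap_def[abs_def] kap'_def[abs_def]
  by (auto intro!: continuous_intros simp: one_plus_square_nz)

lemma two_abs_le: "2 * \<bar>x\<bar> \<le> 1 + x\<^sup>2" for x :: real
  using zero_le_power2[of "\<bar>x\<bar> - 1"] by (simp add: power2_diff)

lemma kap_bounds: "\<bar>kap x\<bar> \<le> 1" "\<bar>x * kap x\<bar> \<le> 1" "\<bar>kap' x\<bar> \<le> 1"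
proof -
  have p: "1 + x\<^sup>2 > 0" "1 + x\<^sup>2 \<ge> 1" by (simp_all add: add_pos_nonneg)
  have "1 / (1 + x\<^sup>2) \<le> 1" using p by (subst divide_le_eq_1_pos[OF p(1)])
  then show "\<bar>kap x\<bar> \<le> 1" using p(1) by (simp add: kap_def)
  have "\<bar>x\<bar> / (1 + x\<^sup>2) \<le> 1" using two_abs_le[of x] by (subst divide_le_eq_1_pos[OF p(1)]) linarith
  then show "\<bar>x * kap x\<bar> \<le> 1" using p(1) by (simp add: kap_def abs_mult)
  have "1 + x\<^sup>2 \<le> (1 + x\<^sup>2)\<^sup>2" by (rule self_le_power[OF p(2)]) simp
  then have "2 * \<bar>x\<bar> \<le> (1 + x\<^sup>2)\<^sup>2" using two_abs_le[of x] by linarith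
  moreover have "(1 + x\<^sup>2)\<^sup>2 > 0" using p(1) by simp
  ultimately have "2 * \<bar>x\<bar> / (1 + x\<^sup>2)\<^sup>2 \<le> 1" by (subst divide_le_eq_1_pos) auto
  then show "\<bar>kap' x\<bar> \<le> 1" by (simp add: kap'_def abs_mult)
qed

text \<open>The one-dimensional Gaussian divergence x p - p' of p = \<open>kap x * cos v\<close>,
  where \<open>v\<close> is a function of \<open>x\<close> with slope \<open>b\<close>.\<close>

definition ibp_weight :: "real \<Rightarrow> real \<Rightarrow> real \<Rightarrow> real" where
  "ibp_weight b x v = x * kap x * cos v - kap' x * cos v + b * kap x * sin v"

lemma measurable_ibp_weight [measurable (raw)]:
  assumes [measurable]: "f \<in> borel_measurable N" "g \<in> borel_measurable N"
  shows "(\<lambda>x. ibp_weight b (f x) (g x)) \<in> borel_measurable N"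
  unfolding ibp_weight_def by measurable

lemma abs_mult_le_1: "\<bar>a\<bar> \<le> 1 \<Longrightarrow> \<bar>b\<bar> \<le> 1 \<Longrightarrow> \<bar>a * b\<bar> \<le> 1" for a b :: real
  by (simp add: abs_mult mult_le_one)

lemma ibp_weight_bound: "\<bar>ibp_weight b x v\<bar> \<le> 2 + \<bar>b\<bar>"
proof -
  have "\<bar>x * kap x * cos v\<bar> \<le> 1" "\<bar>kap' x * cos v\<bar> \<le> 1" "\<bar>kap x * sin v\<bar> \<le> 1"
    using kap_bounds[of x] by (auto intro!: abs_mult_le_1)
  moreover have "\<bar>b * (kap x * sin v)\<bar> \<le> \<bar>b\<bar> * 1"
    unfolding abs_mult[of b] using calculation(3) by (intro mult_left_mono) auto
  ultimately show ?thesis unfolding ibp_weight_def mult.assoc by linarith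
qed

lemma tendsto_integral_bounded_mult:
  fixes G :: "nat \<Rightarrow> 'w \<Rightarrow> real"
  assumes G: "\<And>n. integrable M (G n)" and F: "integrable M F"
    and lim: "(\<lambda>n. \<integral>\<^sup>+\<omega>. ennreal (norm (G n \<omega> - F \<omega>)) \<partial>M) \<longlonglongrightarrow> 0"
    and B: "B \<in> borel_measurable M" "\<And>\<omega>. \<bar>B \<omega>\<bar> \<le> K"
  shows "(\<lambda>n. \<integral>\<omega>. B \<omega> * G n \<omega> \<partial>M) \<longlonglongrightarrow> (\<integral>\<omega>. B \<omega> * F \<omega> \<partial>M)"
proof (rule tendsto_L1_int)
  note [measurable] = B(1) borel_measurable_integrable[OF F] borel_measurable_integrable[OF G]
  show "integrable M (\<lambda>\<omega>. B \<omega> * G n \<omega>)" for n by (rule integrable_bounded_mult[OF G B])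
  show "integrable M (\<lambda>\<omega>. B \<omega> * F \<omega>)" by (rule integrable_bounded_mult[OF F B])
  have "(\<lambda>n. ennreal \<bar>K\<bar> * (\<integral>\<^sup>+\<omega>. ennreal (norm (G n \<omega> - F \<omega>)) \<partial>M)) \<longlonglongrightarrow> ennreal \<bar>K\<bar> * 0"
    using lim by (intro ennreal_tendsto_cmult) auto
  then have lim': "(\<lambda>n. ennreal \<bar>K\<bar> * (\<integral>\<^sup>+\<omega>. ennreal (norm (G n \<omega> - F \<omega>)) \<partial>M)) \<longlonglongrightarrow> 0" by simp
  have "(\<integral>\<^sup>+\<omega>. ennreal (norm (B \<omega> * G n \<omega> - B \<omega> * F \<omega>)) \<partial>M) \<le> ennreal \<bar>K\<bar> * (\<integral>\<^sup>+\<omega>. ennreal (norm (G n \<omega> - F \<omega>)) \<partial>M)" for n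
  proof -
    have "ennreal (norm (B \<omega> * G n \<omega> - B \<omega> * F \<omega>)) \<le> ennreal \<bar>K\<bar> * ennreal (norm (G n \<omega> - F \<omega>))" for \<omega>
    proof -
      have "\<bar>B \<omega>\<bar> * \<bar>G n \<omega> - F \<omega>\<bar> \<le> \<bar>K\<bar> * \<bar>G n \<omega> - F \<omega>\<bar>"
        using B(2)[of \<omega>] by (intro mult_right_mono) auto
      then show ?thesis
        by (simp add: ennreal_mult[symmetric] right_diff_distrib[symmetric] abs_mult) 
    qed
    then have "(\<integral>\<^sup>+\<omega>. ennreal (norm (B \<omega> * G n \<omega> - B \<omega> * F \<omega>)) \<partial>M) \<le> (\<integral>\<^sup>+\<omega>. ennreal \<bar>K\<bar> * ennreal (norm (G n \<omega> - F \<omega>)) \<partial>M)"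
      by (intro nn_integral_mono) auto
    then show ?thesis by (subst (asm) nn_integral_cmult) auto
  qed
  then show "(\<lambda>n. \<integral>\<^sup>+\<omega>. ennreal (norm (B \<omega> * G n \<omega> - B \<omega> * F \<omega>)) \<partial>M) \<longlonglongrightarrow> 0"
    by (intro tendsto_sandwich[OF _ _ tendsto_const lim']) auto
qed

lemma integrable_L1_limit:
  fixes G :: "nat \<Rightarrow> 'w \<Rightarrow> 'b::{banach, second_countable_topology}"
  assumes G: "\<And>n. integrable M (G n)" and F: "F \<in> borel_measurable M"
    and lim: "(\<lambda>n. \<integral>\<^sup>+\<omega>. ennreal (norm (G n \<omega> - F \<omega>)) \<partial>M) \<longlonglongrightarrow> 0"
  shows "integrable M F"
proof -
  note [measurable] = F borel_measurable_integrable[OF G]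
  have "\<forall>\<^sub>F n in sequentially. (\<integral>\<^sup>+\<omega>. ennreal (norm (G n \<omega> - F \<omega>)) \<partial>M) < 1"
    using lim by (rule order_tendstoD) simp
  then obtain n where "(\<integral>\<^sup>+\<omega>. ennreal (norm (G n \<omega> - F \<omega>)) \<partial>M) < 1"
    by (auto simp: eventually_sequentially)
  then have "(\<integral>\<^sup>+\<omega>. ennreal (norm (G n \<omega> - F \<omega>)) \<partial>M) < \<infinity>" by (rule less_trans) simp
  then have "integrable M (\<lambda>\<omega>. G n \<omega> - F \<omega>)" by (intro integrableI_bounded) auto
  from Bochner_Integration.integrable_diff[OF G[of n] this] show ?thesis by simp
qed

lemma Lp_tendsto_1: "Lp_tendsto M 1 G F \<longleftrightarrow> (\<lambda>n. \<integral>\<^sup>+\<omega>. ennreal (norm (G n \<omega> - F \<omega>)) \<partial>M) \<longlonglongrightarrow> 0"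
  by (simp add: Lp_tendsto_def)

lemma eq_0_if_orthogonal_dense:
  fixes v :: "'h::real_inner"
  assumes D: "\<And>U. open U \<Longrightarrow> U \<noteq> {} \<Longrightarrow> \<exists>d\<in>D. d \<in> U" and v: "\<And>d. d \<in> D \<Longrightarrow> v \<bullet> d = 0"
  shows "v = 0"
proof (rule ccontr)
  assume "v \<noteq> 0"
  then have "v \<in> ball v (norm v)" by simp
  then obtain d where d: "d \<in> D" "d \<in> ball v (norm v)" using D[of "ball v (norm v)"] by auto
  have "norm v * norm v = v \<bullet> (v - d)" using v[OF d(1)] by (simp add: inner_diff_right norm_eq_sqrt_inner)
  also have "\<dots> \<le> norm v * norm (v - d)" by (rule norm_cauchy_schwarz)
  also have "\<dots> < norm v * norm v" using d(2) \<open>v \<noteq> 0\<close> by (intro mult_strict_left_mono) (auto simp: dist_norm)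
  finally show False by simp
qed

context isonormal_process
begin

section \<open>Measurability and bounds for smooth cylindrical variables\<close>

lemma smooth_cylindrical_measurable:
  assumes "(G, W) \<in> smooth_cylindrical X"
  shows "G \<in> borel_measurable M" "W \<in> borel_measurable M"
proof -
  obtain n f h where 1: "G = (\<lambda>\<omega>. f (\<lambda>i. X (h i) \<omega>))" "W = (\<lambda>\<omega>. \<Sum>i<n. pdv i f (\<lambda>j. X (h j) \<omega>) *\<^sub>R h i)"
    "1 \<le> n" "smooth_fun n f" "compact_support_fun n f"
    using assms by (auto simp: smooth_cylindrical_def)
  show "G \<in> borel_measurable M"
    unfolding 1(1) by (rule borel_measurable_continuous_seq[OF smooth_fun_continuous[OF 1(4)]]) simp
  have "(\<lambda>\<omega>. pdv i f (\<lambda>j. X (h j) \<omega>)) \<in> borel_measurable M" if "i < n" for i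
    by (rule borel_measurable_continuous_seq[OF smooth_fun_continuous[OF smooth_fun_pdv[OF 1(4) that]]]) simp
  then show "W \<in> borel_measurable M"
    unfolding 1(2) by (intro borel_measurable_sum borel_measurable_scaleR borel_measurable_const) auto
qed

lemma smooth_fun_pdv_bounded:
  assumes f: "smooth_fun n f" "compact_support_fun n f"
  shows "\<exists>K. (\<forall>i x. i < n \<longrightarrow> \<bar>pdv i f x\<bar> \<le> K) \<and> (\<forall>x. \<bar>f x\<bar> \<le> K)"
proof -
  obtain K0 where K0: "\<And>x. \<bar>f x\<bar> \<le> K0"
    using compact_support_bounded[OF smooth_fun_continuous[OF f(1)] smooth_fun_depends_on[OF f(1)] f(2)] by blast
  have "\<exists>K. \<forall>x. \<bar>pdv i f x\<bar> \<le> K" if "i < n" for i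
    using compact_support_bounded[OF smooth_fun_continuous[OF smooth_fun_pdv[OF f(1) that]]
        depends_on_pdv[OF smooth_fun_depends_on[OF f(1)]] compact_support_pdv[OF f(2)]] by metis
  then obtain K where K: "\<And>i x. i < n \<Longrightarrow> \<bar>pdv i f x\<bar> \<le> K i" by metis
  have "\<bar>pdv i f x\<bar> \<le> Max (insert K0 (K ` {..<n}))" if "i < n" for i x
    using K[OF that, of x] that by (intro order_trans[OF _ Max_ge[of _ "K i"]]) auto
  moreover have "\<bar>f x\<bar> \<le> Max (insert K0 (K ` {..<n}))" for x
    using K0[of x] by (intro order_trans[OF _ Max_ge[of _ K0]]) auto
  ultimately show ?thesis by blast
qed

lemma smooth_cylindrical_bounded:
  assumes "(G, W) \<in> smooth_cylindrical X"
  shows "\<exists>K. (\<forall>\<omega>. \<bar>G \<omega>\<bar> \<le> K) \<and> (\<forall>\<omega>. norm (W \<omega>) \<le> K)"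
proof -
  obtain n f h where 1: "G = (\<lambda>\<omega>. f (\<lambda>i. X (h i) \<omega>))" "W = (\<lambda>\<omega>. \<Sum>i<n. pdv i f (\<lambda>j. X (h j) \<omega>) *\<^sub>R h i)"
    "1 \<le> n" "smooth_fun n f" "compact_support_fun n f"
    using assms by (auto simp: smooth_cylindrical_def)
  obtain K where K: "\<And>i x. i < n \<Longrightarrow> \<bar>pdv i f x\<bar> \<le> K" "\<And>x. \<bar>f x\<bar> \<le> K"
    using smooth_fun_pdv_bounded[OF 1(4,5)] by auto
  have "norm (W \<omega>) \<le> (\<Sum>i<n. K * norm (h i))" for \<omega>
    unfolding 1(2) by (rule sum_norm_le) (auto intro!: mult_right_mono K)
  then show ?thesis
    using K(2) by (intro exI[of _ "max K (\<Sum>i<n. K * norm (h i))"]) (auto simp: 1(1) le_max_iff_disj)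
qed

lemma smooth_cylindrical_integrable:
  assumes "(G, W) \<in> smooth_cylindrical X"
  shows "integrable M G" "integrable M W"
proof -
  note [measurable] = smooth_cylindrical_measurable[OF assms]
  obtain K where "\<And>\<omega>. \<bar>G \<omega>\<bar> \<le> K" "\<And>\<omega>. norm (W \<omega>) \<le> K"
    using smooth_cylindrical_bounded[OF assms] by auto
  then show "integrable M G" "integrable M W"
    by (auto intro!: integrable_const_bound[of _ K])
qed

text \<open>The weight \<open>kap\<close> makes both sides continuous for the \<open>L\<^sup>1\<close>-norm, although \<open>X h\<close> is
  unbounded; the phase \<open>\<beta>\<close> yields the cosine and the sine at the same time.\<close>

lemma gaussian_integration_by_parts:
  assumes GW: "(G, W) \<in> smooth_cylindrical X" and h: "norm h = 1"
  shows "(\<integral>\<omega>. (kap (X h \<omega>) * cos (X g \<omega> + \<beta>)) * (W \<omega> \<bullet> h) \<partial>M) =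
    (\<integral>\<omega>. ibp_weight (g \<bullet> h) (X h \<omega>) (X g \<omega> + \<beta>) * G \<omega> \<partial>M)"
proof -
  obtain n f e where 1: "G = (\<lambda>\<omega>. f (\<lambda>i. X (e i) \<omega>))" "W = (\<lambda>\<omega>. \<Sum>i<n. pdv i f (\<lambda>j. X (e j) \<omega>) *\<^sub>R e i)"
    "1 \<le> n" and f: "smooth_fun n f" and cs: "compact_support_fun n f"
    using GW by (auto simp: smooth_cylindrical_def)
  obtain K where K: "\<And>i x. i < n \<Longrightarrow> \<bar>pdv i f x\<bar> \<le> K" "\<And>x. \<bar>f x\<bar> \<le> K"
    using smooth_fun_pdv_bounded[OF f cs] by auto
  have K0: "K \<ge> 0" using K(2)[of "\<lambda>_. 0"] by linarith
  define b where "b = g \<bullet> h"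
  define c where "c i = e i \<bullet> h" for i
  \<comment> \<open>With \<omega> frozen in the residuals, \<open>x\<close> takes the place of
    \<open>X h\<close>. Both \<open>pt\<close> and \<open>an\<close> are affine in \<open>x\<close>,
    and \<open>\<Phi>'\<close> is the derivative of \<open>\<Phi>\<close> in
    \<open>x\<close>.\<close>
  define pt where "pt \<omega> x = (\<lambda>i. residual h (e i) \<omega> + x * c i)" for \<omega> x
  define an where "an \<omega> x = residual h g \<omega> + b * x + \<beta>" for \<omega> x
  define \<Phi> where "\<Phi> \<omega> x = f (pt \<omega> x) * (kap x * cos (an \<omega> x))" for \<omega> x
  define \<Phi>' where "\<Phi>' \<omega> x = (\<Sum>i<n. pdv i f (pt \<omega> x) * c i) * (kap x * cos (an \<omega> x))
      + (kap' x * cos (an \<omega> x) - b * kap x * sin (an \<omega> x)) * f (pt \<omega> x)" for \<omega> x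
  define L where "L = (\<Sum>i<n. K * \<bar>c i\<bar>) + (1 + \<bar>b\<bar>) * K"
  have kc: "\<bar>kap x * cos (an \<omega> x)\<bar> \<le> 1" for x \<omega>
    using kap_bounds[of x] by (intro abs_mult_le_1) auto
  have \<Phi>_bound: "\<bar>\<Phi> \<omega> x\<bar> \<le> K" for \<omega> x
    using mult_mono[OF K(2)[of "pt \<omega> x"] kc[of x \<omega>]] K0 by (simp add: \<Phi>_def abs_mult)
  have x\<Phi>_bound: "\<bar>x * \<Phi> \<omega> x\<bar> \<le> K" for \<omega> x
  proof -
    have "\<bar>(x * kap x) * cos (an \<omega> x)\<bar> \<le> 1" by (rule abs_mult_le_1[OF kap_bounds(2) abs_cos_le_one])
    from mult_mono[OF K(2)[of "pt \<omega> x"] this] K0 show ?thesis by (simp add: \<Phi>_def abs_mult mult_ac)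
  qed
  have sum_bound: "\<bar>\<Sum>i<n. pdv i f y * c i\<bar> \<le> (\<Sum>i<n. K * \<bar>c i\<bar>)" for y
    by (rule order_trans[OF sum_abs]) (auto intro!: sum_mono mult_right_mono K simp: abs_mult)
  have \<Phi>'_bound: "\<bar>\<Phi>' \<omega> x\<bar> \<le> L" for \<omega> x
  proof -
    have s0: "0 \<le> (\<Sum>i<n. K * \<bar>c i\<bar>)" using K0 by (intro sum_nonneg) auto
    have "\<bar>(\<Sum>i<n. pdv i f (pt \<omega> x) * c i) * (kap x * cos (an \<omega> x))\<bar> \<le> (\<Sum>i<n. K * \<bar>c i\<bar>) * 1"
      unfolding abs_mult[of "\<Sum>i<n. pdv i f (pt \<omega> x) * c i"]
      using kc[of x \<omega>] sum_bound s0 by (intro mult_mono) auto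
    moreover have "\<bar>kap' x * cos (an \<omega> x) - b * kap x * sin (an \<omega> x)\<bar> \<le> 1 + \<bar>b\<bar>"
    proof -
      have "\<bar>kap' x * cos (an \<omega> x)\<bar> \<le> 1" "\<bar>kap x * sin (an \<omega> x)\<bar> \<le> 1"
        using kap_bounds[of x] by (auto intro!: abs_mult_le_1)
      moreover have "\<bar>b * (kap x * sin (an \<omega> x))\<bar> \<le> \<bar>b\<bar> * 1"
        unfolding abs_mult[of b] using calculation(2) by (intro mult_left_mono) auto
      ultimately show ?thesis unfolding mult.assoc by linarith
    qed
    then have "\<bar>(kap' x * cos (an \<omega> x) - b * kap x * sin (an \<omega> x)) * f (pt \<omega> x)\<bar> \<le> (1 + \<bar>b\<bar>) * K"
      unfolding abs_mult[of "kap' x * cos (an \<omega> x) - b * kap x * sin (an \<omega> x)"]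
      using K(2) K0 by (intro mult_mono) auto
    ultimately show ?thesis unfolding \<Phi>'_def L_def by linarith
  qed
  have L0: "0 \<le> L" using \<Phi>'_bound[of undefined 0] by linarith
  have pt_cont: "continuous_on UNIV (pt \<omega>)" for \<omega>
    unfolding pt_def by (intro continuous_on_coordinatewise_then_product continuous_intros)
  have pdv_cont: "continuous_on UNIV (\<lambda>x. pdv i f (pt \<omega> x))" if "i < n" for i \<omega>
    by (rule continuous_on_compose2[OF smooth_fun_continuous[OF smooth_fun_pdv[OF f that]] pt_cont]) auto
  have f_cont: "continuous_on UNIV (\<lambda>x. f (pt \<omega> x))" for \<omega>
    by (rule continuous_on_compose2[OF smooth_fun_continuous[OF f] pt_cont]) auto
  have stein: "(\<integral>x. \<Phi>' \<omega> x \<partial>std_normal_distribution) = (\<integral>x. x * \<Phi> \<omega> x \<partial>std_normal_distribution)" for \<omega>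
  proof (rule stein_identity[where K = "K + L"])
    fix x
    have d1: "((\<lambda>x. f (pt \<omega> x)) has_real_derivative (\<Sum>i<n. pdv i f (pt \<omega> x) * c i)) (at x)"
      unfolding pt_def by (rule smooth_fun_line_derivative[OF f])
    have d2: "((\<lambda>x. kap x * cos (an \<omega> x)) has_real_derivative (kap' x * cos (an \<omega> x) - b * kap x * sin (an \<omega> x))) (at x)"
      unfolding an_def by (auto intro!: derivative_eq_intros has_real_derivative_kap)
    show "(\<Phi> \<omega> has_real_derivative \<Phi>' \<omega> x) (at x)"
      unfolding \<Phi>_def[abs_def] \<Phi>'_def using DERIV_mult[OF d1 d2] by simp
    have "K \<le> (K + L) * (1 + \<bar>x\<bar>)" "L \<le> (K + L) * (1 + \<bar>x\<bar>)"
      using K0 L0 by (simp_all add: distrib_left add_increasing2 add_increasing)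
    then show "\<bar>\<Phi> \<omega> x\<bar> \<le> (K + L) * (1 + \<bar>x\<bar>)" "\<bar>\<Phi>' \<omega> x\<bar> \<le> (K + L) * (1 + \<bar>x\<bar>)"
      using \<Phi>_bound[of \<omega> x] \<Phi>'_bound[of \<omega> x] by linarith+
  next
    have "continuous_on UNIV (an \<omega>)" unfolding an_def by (intro continuous_intros)
    then show "continuous_on UNIV (\<Phi>' \<omega>)"
      unfolding \<Phi>'_def[abs_def] using pdv_cont f_cont
      by (intro continuous_intros continuous_kap) auto
  qed
  let ?N = "process_algebra M (residual h) \<Otimes>\<^sub>M borel"
  have pt_meas: "(\<lambda>p. pt (fst p) (snd p) i) \<in> borel_measurable ?N" for i
    unfolding pt_def by (measurable)
  have m1: "(\<lambda>p. f (pt (fst p) (snd p))) \<in> borel_measurable ?N"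
    using borel_measurable_continuous_seq[OF smooth_fun_continuous[OF f] pt_meas] by simp
  have m2: "(\<lambda>p. pdv i f (pt (fst p) (snd p))) \<in> borel_measurable ?N" if "i < n" for i
    using borel_measurable_continuous_seq[OF smooth_fun_continuous[OF smooth_fun_pdv[OF f that]] pt_meas] by simp
  have m3 [measurable]: "(\<lambda>p. an (fst p) (snd p)) \<in> borel_measurable ?N"
    unfolding an_def by measurable
  have m\<Phi>: "(\<lambda>p. snd p * \<Phi> (fst p) (snd p)) \<in> borel_measurable ?N"
    unfolding \<Phi>_def using m1 by measurable
  have m4: "(\<lambda>p. \<Sum>i<n. pdv i f (pt (fst p) (snd p)) * c i) \<in> borel_measurable ?N"
    using m2 by (intro borel_measurable_sum borel_measurable_times borel_measurable_const) auto
  have m\<Phi>': "(\<lambda>p. \<Phi>' (fst p) (snd p)) \<in> borel_measurable ?N"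
    unfolding \<Phi>'_def using m1 m4 by measurable
  have sub: "subalgebra M (process_algebra M (residual h))"
    by (rule subalgebra_process_algebra) simp
  have pr: "(\<lambda>\<omega>. (\<omega>, X h \<omega>)) \<in> measurable M ?N"
    by (intro measurable_Pair measurable_X measurable_from_subalg[OF sub] measurable_ident_sets) simp
  have i\<Phi>: "integrable M (\<lambda>\<omega>. X h \<omega> * \<Phi> \<omega> (X h \<omega>))"
    using measurable_compose[OF pr m\<Phi>] x\<Phi>_bound by (intro integrable_const_bound[of _ K]) auto
  have i\<Phi>': "integrable M (\<lambda>\<omega>. \<Phi>' \<omega> (X h \<omega>))"
    using measurable_compose[OF pr m\<Phi>'] \<Phi>'_bound by (intro integrable_const_bound[of _ L]) auto
  have "(\<integral>\<omega>. \<Phi>' \<omega> (X h \<omega>) \<partial>M) = (\<integral>\<omega>. (\<integral>x. \<Phi>' \<omega> x \<partial>std_normal_distribution) \<partial>M)"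
    by (rule integral_residual[where f = \<Phi>', OF h _ i\<Phi>']) (use m\<Phi>' in \<open>simp add: split_beta'\<close>)
  also have "\<dots> = (\<integral>\<omega>. (\<integral>x. x * \<Phi> \<omega> x \<partial>std_normal_distribution) \<partial>M)" by (simp add: stein)
  also have "\<dots> = (\<integral>\<omega>. X h \<omega> * \<Phi> \<omega> (X h \<omega>) \<partial>M)"
    by (rule integral_residual[where f = "\<lambda>\<omega> x. x * \<Phi> \<omega> x", OF h _ i\<Phi>, symmetric]) (use m\<Phi> in \<open>simp add: split_beta'\<close>)
  finally have main: "(\<integral>\<omega>. \<Phi>' \<omega> (X h \<omega>) \<partial>M) = (\<integral>\<omega>. X h \<omega> * \<Phi> \<omega> (X h \<omega>) \<partial>M)" .
  \<comment> \<open>The splitting of \<open>X\<close> into residual and \<open>X h\<close> holds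
    only almost surely; the directions \<open>e i\<close> are countably many, so one exceptional set
    serves them all.\<close>
  have ae: "AE \<omega> in M. (kap (X h \<omega>) * cos (X g \<omega> + \<beta>)) * (W \<omega> \<bullet> h) - ibp_weight b (X h \<omega>) (X g \<omega> + \<beta>) * G \<omega>
      = \<Phi>' \<omega> (X h \<omega>) - X h \<omega> * \<Phi> \<omega> (X h \<omega>)"
  proof -
    have "AE \<omega> in M. \<forall>i. X (e i) \<omega> = residual h (e i) \<omega> + (e i \<bullet> h) * X h \<omega>"
      unfolding AE_all_countable using AE_X_residual by blast
    with AE_X_residual[of g h] show ?thesis
    proof eventually_elim
      case (elim \<omega>)
      then have "(\<lambda>i. X (e i) \<omega>) = pt \<omega> (X h \<omega>)" and an: "X g \<omega> + \<beta> = an \<omega> (X h \<omega>)"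
        by (auto simp: pt_def c_def an_def b_def)
      then have G: "G \<omega> = f (pt \<omega> (X h \<omega>))" and W: "W \<omega> \<bullet> h = (\<Sum>i<n. pdv i f (pt \<omega> (X h \<omega>)) * c i)"
        by (simp_all add: 1 inner_sum_left c_def)
      show ?case unfolding G W an \<Phi>_def \<Phi>'_def ibp_weight_def by (simp add: algebra_simps)
    qed
  qed
  note [measurable] = smooth_cylindrical_measurable[OF GW]
  have iG: "integrable M G" and iW: "integrable M W" using smooth_cylindrical_integrable[OF GW] by auto
  have i1: "integrable M (\<lambda>\<omega>. (kap (X h \<omega>) * cos (X g \<omega> + \<beta>)) * (W \<omega> \<bullet> h))"
    by (rule integrable_bounded_mult[where K = 1]) (use iW kap_bounds in \<open>auto intro!: abs_mult_le_1\<close>)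
  have i2: "integrable M (\<lambda>\<omega>. ibp_weight b (X h \<omega>) (X g \<omega> + \<beta>) * G \<omega>)"
    by (rule integrable_bounded_mult[OF iG _ ibp_weight_bound]) measurable
  have "(\<integral>\<omega>. (kap (X h \<omega>) * cos (X g \<omega> + \<beta>)) * (W \<omega> \<bullet> h) - ibp_weight b (X h \<omega>) (X g \<omega> + \<beta>) * G \<omega> \<partial>M)
    = (\<integral>\<omega>. \<Phi>' \<omega> (X h \<omega>) - X h \<omega> * \<Phi> \<omega> (X h \<omega>) \<partial>M)"
    using ae borel_measurable_integrable[OF i\<Phi>] borel_measurable_integrable[OF i\<Phi>'] by (intro integral_cong_AE) auto
  also have "\<dots> = 0" using main i\<Phi> i\<Phi>' by simp
  finally show ?thesis using i1 i2 by (simp add: b_def)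
qed

section \<open>The closure of the derivative and its uniqueness\<close>

lemma malliavin_graph_integrable:
  assumes "(F, Z) \<in> malliavin_graph M X 1"
  shows "integrable M F" "integrable M Z"
proof -
  obtain G W where GW: "\<And>n. (G n, W n) \<in> smooth_cylindrical X" "Lp_tendsto M 1 G F" "Lp_tendsto M 1 W Z"
    and m: "F \<in> borel_measurable M" "Z \<in> borel_measurable M"
    using assms by (auto simp: malliavin_graph_def)
  show "integrable M F"
    by (rule integrable_L1_limit[OF smooth_cylindrical_integrable(1)[OF GW(1)] m(1)]) (use GW(2) in \<open>simp only: Lp_tendsto_1\<close>)
  show "integrable M Z"
    by (rule integrable_L1_limit[OF smooth_cylindrical_integrable(2)[OF GW(1)] m(2)]) (use GW(3) in \<open>simp only: Lp_tendsto_1\<close>)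
qed

lemma malliavin_graph_integration_by_parts:
  assumes FZ: "(F, Z) \<in> malliavin_graph M X 1" and h: "norm h = 1"
  shows "(\<integral>\<omega>. (kap (X h \<omega>) * cos (X g \<omega> + \<beta>)) * (Z \<omega> \<bullet> h) \<partial>M) =
    (\<integral>\<omega>. ibp_weight (g \<bullet> h) (X h \<omega>) (X g \<omega> + \<beta>) * F \<omega> \<partial>M)"
proof -
  obtain G W where GW: "\<And>n. (G n, W n) \<in> smooth_cylindrical X" "Lp_tendsto M 1 G F" "Lp_tendsto M 1 W Z"
    and m [measurable]: "F \<in> borel_measurable M" "Z \<in> borel_measurable M"
    using FZ by (auto simp: malliavin_graph_def)
  have iF: "integrable M F" and iZ: "integrable M Z" using malliavin_graph_integrable[OF FZ] by auto
  have iG: "integrable M (G n)" and iW: "integrable M (W n)" for n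
    using smooth_cylindrical_integrable[OF GW(1)] by auto
  note [measurable] = smooth_cylindrical_measurable[OF GW(1)]
  have a: "(\<lambda>n. \<integral>\<omega>. ibp_weight (g \<bullet> h) (X h \<omega>) (X g \<omega> + \<beta>) * G n \<omega> \<partial>M) \<longlonglongrightarrow>
      (\<integral>\<omega>. ibp_weight (g \<bullet> h) (X h \<omega>) (X g \<omega> + \<beta>) * F \<omega> \<partial>M)"
    by (rule tendsto_integral_bounded_mult[OF iG iF _ _ ibp_weight_bound]) (use GW in \<open>simp_all add: Lp_tendsto_1\<close>)
  have "(\<lambda>n. \<integral>\<^sup>+\<omega>. ennreal (norm (W n \<omega> \<bullet> h - Z \<omega> \<bullet> h)) \<partial>M) \<longlonglongrightarrow> 0"
  proof (rule tendsto_sandwich[OF _ _ tendsto_const])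
    show "(\<lambda>n. \<integral>\<^sup>+\<omega>. ennreal (norm (W n \<omega> - Z \<omega>)) \<partial>M) \<longlonglongrightarrow> 0" using GW(3) by (simp add: Lp_tendsto_1)
    have "norm (W n \<omega> \<bullet> h - Z \<omega> \<bullet> h) \<le> norm (W n \<omega> - Z \<omega>)" for n \<omega>
      using Cauchy_Schwarz_ineq2[of "W n \<omega> - Z \<omega>" h] h by (simp add: inner_diff_left)
    then show "\<forall>\<^sub>F n in sequentially. (\<integral>\<^sup>+\<omega>. ennreal (norm (W n \<omega> \<bullet> h - Z \<omega> \<bullet> h)) \<partial>M) \<le> (\<integral>\<^sup>+\<omega>. ennreal (norm (W n \<omega> - Z \<omega>)) \<partial>M)"
      by (intro always_eventually allI nn_integral_mono ennreal_leI) auto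
  qed auto
  then have b: "(\<lambda>n. \<integral>\<omega>. (kap (X h \<omega>) * cos (X g \<omega> + \<beta>)) * (W n \<omega> \<bullet> h) \<partial>M) \<longlonglongrightarrow>
      (\<integral>\<omega>. (kap (X h \<omega>) * cos (X g \<omega> + \<beta>)) * (Z \<omega> \<bullet> h) \<partial>M)"
    by (intro tendsto_integral_bounded_mult[where K = 1]) (use iW iZ kap_bounds in \<open>auto intro!: abs_mult_le_1\<close>)
  show ?thesis
    using b a unfolding gaussian_integration_by_parts[OF GW(1) h] by (rule LIMSEQ_unique)
qed

text \<open>Integration by parts expresses the expectations of
  \<open>kap (X h) * cos (X g + \<beta>) * (Z \<bullet> h)\<close> through \<open>F\<close> alone.
  By totality the component of \<open>Z - Z'\<close> along \<open>h\<close>, multiplied by the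
  positive factor \<open>kap (X h)\<close>, vanishes almost surely; a countable dense set of
  directions then gives equality of the vectors.\<close>

lemma malliavin_graph_unique:
  assumes 1: "(F, Z) \<in> malliavin_graph M X 1" and 2: "(F, Z') \<in> malliavin_graph M X 1"
  shows "AE \<omega> in M. Z \<omega> = Z' \<omega>"
proof -
  have iZ: "integrable M Z" "integrable M Z'" using malliavin_graph_integrable 1 2 by auto
  note [measurable] = borel_measurable_integrable[OF iZ(1)] borel_measurable_integrable[OF iZ(2)]
  have unit: "AE \<omega> in M. (Z \<omega> - Z' \<omega>) \<bullet> h = 0" if h: "norm h = 1" for h
  proof -
    let ?Y = "\<lambda>\<omega>. kap (X h \<omega>) * ((Z \<omega> - Z' \<omega>) \<bullet> h)"
    have iY: "integrable M ?Y"
      by (rule integrable_bounded_mult[where K = 1]) (use iZ kap_bounds in auto)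
    have z: "(\<integral>\<omega>. cos (X g \<omega> + \<beta>) * ?Y \<omega> \<partial>M) = 0" for g \<beta>
    proof -
      have i: "integrable M (\<lambda>\<omega>. (kap (X h \<omega>) * cos (X g \<omega> + \<beta>)) * (V \<omega> \<bullet> h))" if "integrable M V" for V
        by (rule integrable_bounded_mult[where K = 1]) (use that kap_bounds in \<open>auto intro!: abs_mult_le_1\<close>)
      have "(\<integral>\<omega>. cos (X g \<omega> + \<beta>) * ?Y \<omega> \<partial>M) = (\<integral>\<omega>. (kap (X h \<omega>) * cos (X g \<omega> + \<beta>)) * (Z \<omega> \<bullet> h) - (kap (X h \<omega>) * cos (X g \<omega> + \<beta>)) * (Z' \<omega> \<bullet> h) \<partial>M)"
        by (simp add: inner_diff_left algebra_simps)
      also have "\<dots> = 0"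
        using i[OF iZ(1)] i[OF iZ(2)] malliavin_graph_integration_by_parts[OF 1 h, of g \<beta>] malliavin_graph_integration_by_parts[OF 2 h, of g \<beta>]
        by simp
      finally show ?thesis .
    qed
    have "AE \<omega> in M. ?Y \<omega> = 0"
    proof (rule AE_eq_0_if_fourier_0[OF iY])
      fix g
      show "(\<integral>\<omega>. cos (X g \<omega>) * ?Y \<omega> \<partial>M) = 0" using z[of g 0] by simp
      have "cos (x + - (pi / 2)) = sin x" for x by (simp add: cos_diff)
      then show "(\<integral>\<omega>. sin (X g \<omega>) * ?Y \<omega> \<partial>M) = 0" using z[of g "- (pi / 2)"] by simp
    qed
    then show ?thesis by eventually_elim (use kap_pos in \<open>auto simp: less_le\<close>)
  qed
  obtain D :: "'h set" where D: "countable D" "\<And>U. open U \<Longrightarrow> U \<noteq> {} \<Longrightarrow> \<exists>d\<in>D. d \<in> U"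
    by (rule countable_dense_setE) blast
  have "AE \<omega> in M. (Z \<omega> - Z' \<omega>) \<bullet> d = 0" for d
  proof (cases "d = 0")
    case False
    then have "AE \<omega> in M. (Z \<omega> - Z' \<omega>) \<bullet> (d /\<^sub>R norm d) = 0" by (intro unit) simp
    then show ?thesis by eventually_elim (use False in simp)
  qed simp
  then have "AE \<omega> in M. \<forall>d\<in>D. (Z \<omega> - Z' \<omega>) \<bullet> d = 0" by (simp add: AE_ball_countable[OF D(1)])
  then show ?thesis
  proof eventually_elim
    case (elim \<omega>)
    have "Z \<omega> - Z' \<omega> = 0" by (rule eq_0_if_orthogonal_dense[OF D(2)]) (use elim in auto)
    then show ?case by simp
  qed
qed

text \<open>Replaces the choice in \<open>malliavin_D\<close> by any convenient representative of
  the derivative.\<close>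

lemma malliavin_D_graph:
  assumes "(F, Z) \<in> malliavin_graph M X 1"
  shows "(F, malliavin_D M X F) \<in> malliavin_graph M X 1" "AE \<omega> in M. malliavin_D M X F \<omega> = Z \<omega>"
proof -
  show 1: "(F, malliavin_D M X F) \<in> malliavin_graph M X 1"
    unfolding malliavin_D_def using assms by (rule someI[where P = "\<lambda>Z. (F, Z) \<in> malliavin_graph M X 1"])
  show "AE \<omega> in M. malliavin_D M X F \<omega> = Z \<omega>"
    by (rule malliavin_graph_unique[OF 1 assms])
qed

end

section \<open>Convergence in the mean\<close>

lemma ennreal_tendsto_0_power2:
  fixes Y :: "nat \<Rightarrow> ennreal"
  assumes "(\<lambda>n. (Y n)\<^sup>2) \<longlonglongrightarrow> 0" shows "Y \<longlonglongrightarrow> 0"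
proof (rule order_tendstoI)
  fix e :: ennreal assume e: "0 < e"
  then have "0 < e\<^sup>2" by (simp add: power2_eq_square ennreal_zero_less_mult_iff)
  with assms have "\<forall>\<^sub>F n in sequentially. (Y n)\<^sup>2 < e\<^sup>2" by (rule order_tendstoD)
  then show "\<forall>\<^sub>F n in sequentially. Y n < e"
  proof eventually_elim
    case (elim n)
    show ?case
    proof (rule ccontr)
      assume "\<not> Y n < e"
      then have "e\<^sup>2 \<le> (Y n)\<^sup>2" unfolding power2_eq_square by (intro mult_mono) auto
      with elim show False by simp
    qed
  qed
qed simp

lemma nn_integral_mult_tendsto_0:
  fixes f g :: "nat \<Rightarrow> 'a \<Rightarrow> ennreal"
  assumes [measurable]: "\<And>n. f n \<in> borel_measurable M" "\<And>n. g n \<in> borel_measurable M"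
    and f: "(\<lambda>n. \<integral>\<^sup>+x. (f n x)\<^sup>2 \<partial>M) \<longlonglongrightarrow> 0" and g: "\<And>n. (\<integral>\<^sup>+x. (g n x)\<^sup>2 \<partial>M) \<le> C" "C < \<infinity>"
  shows "(\<lambda>n. \<integral>\<^sup>+x. f n x * g n x \<partial>M) \<longlonglongrightarrow> 0"
proof (rule ennreal_tendsto_0_power2)
  have "(\<lambda>n. C * (\<integral>\<^sup>+x. (f n x)\<^sup>2 \<partial>M)) \<longlonglongrightarrow> C * 0"
    using g(2) f by (intro ennreal_tendsto_cmult) auto
  then have lim: "(\<lambda>n. C * (\<integral>\<^sup>+x. (f n x)\<^sup>2 \<partial>M)) \<longlonglongrightarrow> 0" by simp
  have "(\<integral>\<^sup>+x. f n x * g n x \<partial>M)\<^sup>2 \<le> C * (\<integral>\<^sup>+x. (f n x)\<^sup>2 \<partial>M)" for n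
  proof -
    have "(\<integral>\<^sup>+x. f n x * g n x \<partial>M)\<^sup>2 \<le> (\<integral>\<^sup>+x. (f n x)\<^sup>2 \<partial>M) * (\<integral>\<^sup>+x. (g n x)\<^sup>2 \<partial>M)"
      by (rule Cauchy_Schwarz_nn_integral) auto
    also have "\<dots> \<le> (\<integral>\<^sup>+x. (f n x)\<^sup>2 \<partial>M) * C" using g(1) by (rule mult_left_mono) simp
    finally show ?thesis by (simp add: mult.commute)
  qed
  then show "(\<lambda>n. (\<integral>\<^sup>+x. f n x * g n x \<partial>M)\<^sup>2) \<longlonglongrightarrow> 0"
    by (intro tendsto_sandwich[OF _ _ tendsto_const lim]) auto
qed

lemma powr_2_norm: "norm x powr 2 = (norm x)\<^sup>2"
  by (cases "norm x = 0") (simp_all add: powr_numeral)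

lemma powr_4_norm: "norm x powr 4 = (norm x) ^ 4"
  by (cases "norm x = 0") (simp_all add: powr_numeral)

lemma nn_integral_norm_square_finite:
  assumes "integrable M (\<lambda>\<omega>. (norm (f \<omega>))\<^sup>2)"
  shows "(\<integral>\<^sup>+\<omega>. (ennreal (norm (f \<omega>)))\<^sup>2 \<partial>M) < \<infinity>"
proof -
  have "(ennreal (norm (f \<omega>)))\<^sup>2 = ennreal (norm ((norm (f \<omega>))\<^sup>2))" for \<omega> by (simp add: ennreal_power)
  then show ?thesis using assms unfolding integrable_iff_bounded by presburger
qed

lemma Lp_tendsto_2: "Lp_tendsto M 2 G F \<longleftrightarrow> (\<lambda>n. \<integral>\<^sup>+\<omega>. (ennreal (norm (G n \<omega> - F \<omega>)))\<^sup>2 \<partial>M) \<longlonglongrightarrow> 0"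
  unfolding Lp_tendsto_def powr_2_norm by (simp add: ennreal_power)

text \<open>Hoelder's inequality is replaced by a split at a level \<delta>: a nonnegative x has
  \<open>x powr q\<close> at most \<open>\<delta> powr q\<close> below this level and at most
  \<open>\<delta> powr (q - p) * x powr p\<close> above it. The first term is small by the choice of
  \<delta>, the second in the limit.\<close>

lemma (in prob_space) Lp_tendsto_mono:
  fixes G :: "nat \<Rightarrow> 'a \<Rightarrow> 'b::{real_normed_vector, second_countable_topology}"
  assumes [measurable]: "\<And>n. G n \<in> borel_measurable M" "F \<in> borel_measurable M"
    and pq: "0 < q" "q \<le> p" and lim: "Lp_tendsto M p G F"
  shows "Lp_tendsto M q G F"
  unfolding Lp_tendsto_def
proof (rule order_tendstoI)
  fix e :: ennreal assume "0 < e"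
  \<comment> \<open>The bound \<open>e\<close> may be infinite, so a finite positive
    \<open>r\<close> strictly below it is chosen first.\<close>
  define r where "r = enn2real (min e 1) / 2"
  have m: "ennreal (enn2real (min e 1)) = min e 1" "0 < min e 1"
    using \<open>0 < e\<close> by (auto simp: ennreal_enn2real_if min_def top_unique)
  have "min e 1 < \<top>" by (simp add: min_less_iff_disj)
  then have r0: "0 < r" using m(2) by (simp add: r_def enn2real_positive_iff)
  have "ennreal r < ennreal (2 * r)" using r0 by (simp add: ennreal_lessI)
  also have "\<dots> = min e 1" using m(1) by (simp add: r_def)
  finally have r: "0 < r" "ennreal r < e" using r0 by auto
  define \<delta> where "\<delta> = (r / 2) powr (1 / q)"
  have \<delta>: "\<delta> > 0" "\<delta> powr q = r / 2" using r pq by (simp_all add: \<delta>_def powr_powr)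
  define A where "A n = (\<integral>\<^sup>+\<omega>. ennreal (norm (G n \<omega> - F \<omega>) powr p) \<partial>M)" for n
  have "(\<lambda>n. ennreal (\<delta> powr (q - p)) * A n) \<longlonglongrightarrow> ennreal (\<delta> powr (q - p)) * 0"
    using lim unfolding A_def Lp_tendsto_def by (intro ennreal_tendsto_cmult) auto
  then have "(\<lambda>n. ennreal (\<delta> powr (q - p)) * A n) \<longlonglongrightarrow> 0" by simp
  moreover have "0 < ennreal (r / 2)" using r by simp
  ultimately have "\<forall>\<^sub>F n in sequentially. ennreal (\<delta> powr (q - p)) * A n < ennreal (r / 2)"
    by (rule order_tendstoD)
  then show "\<forall>\<^sub>F n in sequentially. (\<integral>\<^sup>+\<omega>. ennreal (norm (G n \<omega> - F \<omega>) powr q) \<partial>M) < e"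
  proof eventually_elim
    case (elim n)
    have pt: "x powr q \<le> \<delta> powr q + \<delta> powr (q - p) * x powr p" if "x \<ge> 0" for x
    proof (cases "x \<le> \<delta>")
      case True
      then have "x powr q \<le> \<delta> powr q" using that pq by (intro powr_mono2) auto
      then show ?thesis by (simp add: add_increasing2)
    next
      case False
      then have "x powr q = x powr (q - p) * x powr p" by (simp add: powr_add[symmetric])
      also have "x powr (q - p) \<le> \<delta> powr (q - p)"
        using False \<delta> pq by (intro powr_mono2') auto
      finally show ?thesis by (simp add: mult_right_mono add_increasing)
    qed
    have "(\<integral>\<^sup>+\<omega>. ennreal (norm (G n \<omega> - F \<omega>) powr q) \<partial>M) \<le> (\<integral>\<^sup>+\<omega>. ennreal (\<delta> powr q) + ennreal (\<delta> powr (q - p)) * ennreal (norm (G n \<omega> - F \<omega>) powr p) \<partial>M)"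
      using pt by (intro nn_integral_mono) (simp add: ennreal_mult[symmetric] ennreal_plus[symmetric] del: ennreal_plus)
    also have "\<dots> = ennreal (r / 2) + ennreal (\<delta> powr (q - p)) * A n"
      unfolding A_def by (subst nn_integral_add) (auto simp: nn_integral_cmult emeasure_space_1 \<delta>)
    also have "\<dots> < ennreal (r / 2) + ennreal (r / 2)"
      using elim by (intro ennreal_add_left_cancel_less[THEN iffD2]) simp_all
    also have "\<dots> = ennreal r" using r by (subst ennreal_plus[symmetric]) auto
    finally show ?case using r(2) by (rule less_trans)
  qed
qed simp

text \<open>One bounded approximant at finite distance suffices: the norm of the limit is at most
  twice the larger of that distance and the bound.\<close>

lemma integrable_powr_Lp_limit:
  fixes G :: "nat \<Rightarrow> 'a \<Rightarrow> 'b::{banach, second_countable_topology}"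
  assumes "finite_measure M" and G [measurable]: "\<And>n. G n \<in> borel_measurable M" and F [measurable]: "F \<in> borel_measurable M"
    and K: "\<And>n. \<exists>K. \<forall>\<omega>. norm (G n \<omega>) \<le> K" and p: "p > 0" and lim: "Lp_tendsto M p G F"
  shows "integrable M (\<lambda>\<omega>. norm (F \<omega>) powr p)"
proof -
  interpret finite_measure M by fact
  have "\<forall>\<^sub>F n in sequentially. (\<integral>\<^sup>+\<omega>. ennreal (norm (G n \<omega> - F \<omega>) powr p) \<partial>M) < 1"
    using lim unfolding Lp_tendsto_def by (rule order_tendstoD) simp
  then obtain n where "(\<integral>\<^sup>+\<omega>. ennreal (norm (G n \<omega> - F \<omega>) powr p) \<partial>M) < 1"
    by (auto simp: eventually_sequentially)
  then have fin: "(\<integral>\<^sup>+\<omega>. ennreal (norm (G n \<omega> - F \<omega>) powr p) \<partial>M) < \<infinity>" by (rule less_trans) simp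
  have i1: "integrable M (\<lambda>\<omega>. norm (G n \<omega> - F \<omega>) powr p)"
    using fin by (intro integrableI_bounded) auto
  obtain K where K: "\<And>\<omega>. norm (G n \<omega>) \<le> K" using K by blast
  have "integrable M (\<lambda>\<omega>. 2 powr p * (norm (G n \<omega> - F \<omega>) powr p + \<bar>K\<bar> powr p))"
    using i1 by simp
  then show ?thesis
  proof (rule Bochner_Integration.integrable_bound)
    have "norm (F \<omega>) powr p \<le> 2 powr p * (norm (G n \<omega> - F \<omega>) powr p + \<bar>K\<bar> powr p)" for \<omega>
    proof -
      let ?m = "max (norm (G n \<omega> - F \<omega>)) \<bar>K\<bar>"
      have "norm (F \<omega>) \<le> norm (G n \<omega>) + norm (G n \<omega> - F \<omega>)"
        using norm_triangle_ineq4[of "G n \<omega>" "G n \<omega> - F \<omega>"] by simp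
      also have "\<dots> \<le> 2 * ?m" using K[of \<omega>] by (simp add: max_def abs_if)
      finally have "norm (F \<omega>) powr p \<le> (2 * ?m) powr p" using p by (intro powr_mono2) auto
      also have "\<dots> = 2 powr p * ?m powr p" by (rule powr_mult)
      also have "?m powr p \<le> norm (G n \<omega> - F \<omega>) powr p + \<bar>K\<bar> powr p" by (auto simp: max_def)
      finally show ?thesis by simp
    qed
    then show "AE \<omega> in M. norm (norm (F \<omega>) powr p) \<le> norm (2 powr p * (norm (G n \<omega> - F \<omega>) powr p + \<bar>K\<bar> powr p))"
      by (intro AE_I2) (simp add: abs_of_nonneg)
  qed simp
qed

section \<open>Duality for functions of Malliavin differentiable variables\<close>

context isonormal_process
begin

lemma malliavin_graph_mono:
  assumes "0 < q" "q \<le> p" "(F, Z) \<in> malliavin_graph M X p"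
  shows "(F, Z) \<in> malliavin_graph M X q"
proof -
  obtain G W where GW: "\<And>n. (G n, W n) \<in> smooth_cylindrical X" "Lp_tendsto M p G F" "Lp_tendsto M p W Z"
    and m: "F \<in> borel_measurable M" "Z \<in> borel_measurable M"
    using assms(3) by (auto simp: malliavin_graph_def)
  have "Lp_tendsto M q G F" "Lp_tendsto M q W Z"
    using smooth_cylindrical_measurable[OF GW(1)] m assms(1,2) GW(2,3) by (auto intro: Lp_tendsto_mono)
  then show ?thesis using GW(1) m by (auto simp: malliavin_graph_def)
qed

lemma malliavin_graph_powr_integrable:
  assumes "0 < p" "(F, Z) \<in> malliavin_graph M X p"
  shows "integrable M (\<lambda>\<omega>. \<bar>F \<omega>\<bar> powr p)" "integrable M (\<lambda>\<omega>. norm (Z \<omega>) powr p)"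
proof -
  obtain G W where GW: "\<And>n. (G n, W n) \<in> smooth_cylindrical X" "Lp_tendsto M p G F" "Lp_tendsto M p W Z"
    and m: "F \<in> borel_measurable M" "Z \<in> borel_measurable M"
    using assms(2) by (auto simp: malliavin_graph_def)
  have b: "\<exists>K. \<forall>\<omega>. norm (G n \<omega>) \<le> K" "\<exists>K. \<forall>\<omega>. norm (W n \<omega>) \<le> K" for n
    using smooth_cylindrical_bounded[OF GW(1)[of n]] by auto
  show "integrable M (\<lambda>\<omega>. \<bar>F \<omega>\<bar> powr p)"
    using integrable_powr_Lp_limit[OF finite_measure_axioms smooth_cylindrical_measurable(1)[OF GW(1)] m(1) b(1) assms(1) GW(2)] by simp
  show "integrable M (\<lambda>\<omega>. norm (Z \<omega>) powr p)"
    by (rule integrable_powr_Lp_limit[OF finite_measure_axioms smooth_cylindrical_measurable(2)[OF GW(1)] m(2) b(2) assms(1) GW(3)])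
qed

lemma smooth_cylindrical_graph:
  assumes "(G, W) \<in> smooth_cylindrical X" "0 < p"
  shows "(G, W) \<in> malliavin_graph M X p"
  unfolding malliavin_graph_def Lp_tendsto_def
  using smooth_cylindrical_measurable[OF assms(1)] assms
  by (auto intro!: exI[of _ "\<lambda>_. G"] exI[of _ "\<lambda>_. W"])

text \<open>The exponent drops from 2 to 1 because the error terms are products: after expanding
  around \<open>S\<close> and \<open>Z\<close>, each is a product of two square-integrable factors
  of which at least one tends to zero in mean square, so Cauchy-Schwarz applies.\<close>

lemma malliavin_graph_square:
  assumes "(S, Z) \<in> malliavin_graph M X 2"
  shows "(\<lambda>\<omega>. (S \<omega>)\<^sup>2, \<lambda>\<omega>. (2 * S \<omega>) *\<^sub>R Z \<omega>) \<in> malliavin_graph M X 1"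
proof -
  obtain G W where GW: "\<And>n. (G n, W n) \<in> smooth_cylindrical X" "Lp_tendsto M 2 G S" "Lp_tendsto M 2 W Z"
    and m [measurable]: "S \<in> borel_measurable M" "Z \<in> borel_measurable M"
    using assms by (auto simp: malliavin_graph_def)
  note [measurable] = smooth_cylindrical_measurable[OF GW(1)]
  define a where "a n \<omega> = ennreal (norm (G n \<omega> - S \<omega>))" for n \<omega>
  define b where "b n \<omega> = ennreal (norm (W n \<omega> - Z \<omega>))" for n \<omega>
  have [measurable]: "a n \<in> borel_measurable M" "b n \<in> borel_measurable M" for n
    unfolding a_def[abs_def] b_def[abs_def] by measurable
  have a2: "(\<lambda>n. \<integral>\<^sup>+\<omega>. (a n \<omega>)\<^sup>2 \<partial>M) \<longlonglongrightarrow> 0" and b2: "(\<lambda>n. \<integral>\<^sup>+\<omega>. (b n \<omega>)\<^sup>2 \<partial>M) \<longlonglongrightarrow> 0"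
    using GW(2,3) by (simp_all add: Lp_tendsto_2 a_def b_def)
  have fin: "(\<integral>\<^sup>+\<omega>. (ennreal (norm (S \<omega>)))\<^sup>2 \<partial>M) < \<infinity>" "(\<integral>\<^sup>+\<omega>. (ennreal (norm (Z \<omega>)))\<^sup>2 \<partial>M) < \<infinity>"
  proof -
    have i: "integrable M (\<lambda>\<omega>. (norm (S \<omega>))\<^sup>2)" "integrable M (\<lambda>\<omega>. (norm (Z \<omega>))\<^sup>2)"
      using malliavin_graph_powr_integrable[OF _ assms] unfolding powr_2_norm[symmetric] real_norm_def by simp_all
    show "(\<integral>\<^sup>+\<omega>. (ennreal (norm (S \<omega>)))\<^sup>2 \<partial>M) < \<infinity>" "(\<integral>\<^sup>+\<omega>. (ennreal (norm (Z \<omega>)))\<^sup>2 \<partial>M) < \<infinity>"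
      using nn_integral_norm_square_finite[OF i(1)] nn_integral_norm_square_finite[OF i(2)] by blast+
  qed
  have aS: "(\<lambda>n. \<integral>\<^sup>+\<omega>. a n \<omega> * ennreal (norm (S \<omega>)) \<partial>M) \<longlonglongrightarrow> 0"
    by (rule nn_integral_mult_tendsto_0[OF _ _ a2 _ fin(1)]) auto
  have aZ: "(\<lambda>n. \<integral>\<^sup>+\<omega>. a n \<omega> * ennreal (norm (Z \<omega>)) \<partial>M) \<longlonglongrightarrow> 0"
    by (rule nn_integral_mult_tendsto_0[OF _ _ a2 _ fin(2)]) auto
  have bS: "(\<lambda>n. \<integral>\<^sup>+\<omega>. b n \<omega> * ennreal (norm (S \<omega>)) \<partial>M) \<longlonglongrightarrow> 0"
    by (rule nn_integral_mult_tendsto_0[OF _ _ b2 _ fin(1)]) auto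
  have 1: "Lp_tendsto M 1 (\<lambda>n \<omega>. G n \<omega> * G n \<omega>) (\<lambda>\<omega>. (S \<omega>)\<^sup>2)"
    unfolding Lp_tendsto_1
  proof (rule tendsto_sandwich[OF _ _ tendsto_const])
    have "(\<lambda>n. (\<integral>\<^sup>+\<omega>. (a n \<omega>)\<^sup>2 \<partial>M) + 2 * (\<integral>\<^sup>+\<omega>. a n \<omega> * ennreal (norm (S \<omega>)) \<partial>M)) \<longlonglongrightarrow> 0 + 2 * 0"
      using a2 aS by (intro tendsto_add ennreal_tendsto_cmult) auto
    then show "(\<lambda>n. (\<integral>\<^sup>+\<omega>. (a n \<omega>)\<^sup>2 \<partial>M) + 2 * (\<integral>\<^sup>+\<omega>. a n \<omega> * ennreal (norm (S \<omega>)) \<partial>M)) \<longlonglongrightarrow> 0" by simp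
    show "\<forall>\<^sub>F n in sequentially. (\<integral>\<^sup>+\<omega>. ennreal (norm (G n \<omega> * G n \<omega> - (S \<omega>)\<^sup>2)) \<partial>M) \<le> (\<integral>\<^sup>+\<omega>. (a n \<omega>)\<^sup>2 \<partial>M) + 2 * (\<integral>\<^sup>+\<omega>. a n \<omega> * ennreal (norm (S \<omega>)) \<partial>M)"
    proof (intro always_eventually allI)
      fix n
      have pt: "ennreal (norm (x * x - y\<^sup>2)) \<le> (ennreal (norm (x - y)))\<^sup>2 + 2 * (ennreal (norm (x - y)) * ennreal (norm y))" for x y :: real
      proof -
        have "x * x - y\<^sup>2 = (x - y) * (x - y) + 2 * ((x - y) * y)" by (simp add: power2_eq_square algebra_simps)
        then have "norm (x * x - y\<^sup>2) \<le> norm ((x - y) * (x - y)) + norm (2 * ((x - y) * y))" by (metis norm_triangle_ineq)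
        then have "norm (x * x - y\<^sup>2) \<le> (norm (x - y))\<^sup>2 + 2 * (norm (x - y) * norm y)" by (simp add: norm_mult abs_mult power2_eq_square)
        then have "ennreal (norm (x * x - y\<^sup>2)) \<le> ennreal ((norm (x - y))\<^sup>2 + 2 * (norm (x - y) * norm y))" by (rule ennreal_leI)
        also have "\<dots> = (ennreal (norm (x - y)))\<^sup>2 + 2 * (ennreal (norm (x - y)) * ennreal (norm y))"
          by (simp add: ennreal_plus ennreal_mult ennreal_power del: power2_abs)
        finally show ?thesis .
      qed
      have "(\<integral>\<^sup>+\<omega>. ennreal (norm (G n \<omega> * G n \<omega> - (S \<omega>)\<^sup>2)) \<partial>M) \<le> (\<integral>\<^sup>+\<omega>. (a n \<omega>)\<^sup>2 + 2 * (a n \<omega> * ennreal (norm (S \<omega>))) \<partial>M)"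
        unfolding a_def by (intro nn_integral_mono pt)
      also have "\<dots> = (\<integral>\<^sup>+\<omega>. (a n \<omega>)\<^sup>2 \<partial>M) + 2 * (\<integral>\<^sup>+\<omega>. a n \<omega> * ennreal (norm (S \<omega>)) \<partial>M)"
        by (subst nn_integral_add) (auto simp: nn_integral_cmult)
      finally show "(\<integral>\<^sup>+\<omega>. ennreal (norm (G n \<omega> * G n \<omega> - (S \<omega>)\<^sup>2)) \<partial>M) \<le> (\<integral>\<^sup>+\<omega>. (a n \<omega>)\<^sup>2 \<partial>M) + 2 * (\<integral>\<^sup>+\<omega>. a n \<omega> * ennreal (norm (S \<omega>)) \<partial>M)" .
    qed
  qed auto
  let ?B = "\<lambda>n. 2 * ((\<integral>\<^sup>+\<omega>. (a n \<omega>)\<^sup>2 \<partial>M) + (\<integral>\<^sup>+\<omega>. (b n \<omega>)\<^sup>2 \<partial>M) + (\<integral>\<^sup>+\<omega>. b n \<omega> * ennreal (norm (S \<omega>)) \<partial>M) + (\<integral>\<^sup>+\<omega>. a n \<omega> * ennreal (norm (Z \<omega>)) \<partial>M))"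
  have 2: "Lp_tendsto M 1 (\<lambda>n \<omega>. G n \<omega> *\<^sub>R W n \<omega> + G n \<omega> *\<^sub>R W n \<omega>) (\<lambda>\<omega>. (2 * S \<omega>) *\<^sub>R Z \<omega>)"
    unfolding Lp_tendsto_1
  proof (rule tendsto_sandwich[OF _ _ tendsto_const])
    have "?B \<longlonglongrightarrow> 2 * (0 + 0 + 0 + 0)"
      using a2 b2 bS aZ by (intro tendsto_add ennreal_tendsto_cmult) auto
    then show "?B \<longlonglongrightarrow> 0" by simp
    show "\<forall>\<^sub>F n in sequentially. (\<integral>\<^sup>+\<omega>. ennreal (norm (G n \<omega> *\<^sub>R W n \<omega> + G n \<omega> *\<^sub>R W n \<omega> - (2 * S \<omega>) *\<^sub>R Z \<omega>)) \<partial>M) \<le> ?B n"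
    proof (intro always_eventually allI)
      fix n
      have pt: "ennreal (norm (x *\<^sub>R w + x *\<^sub>R w - (2 * s) *\<^sub>R z)) \<le> 2 * ((ennreal (norm (x - s)))\<^sup>2 + (ennreal (norm (w - z)))\<^sup>2 + ennreal (norm (w - z)) * ennreal (norm s) + ennreal (norm (x - s)) * ennreal (norm z))"
        for x s :: real and w z :: 'h
      proof -
        have eq: "x *\<^sub>R w + x *\<^sub>R w - (2 * s) *\<^sub>R z = 2 *\<^sub>R ((x - s) *\<^sub>R (w - z) + s *\<^sub>R (w - z) + (x - s) *\<^sub>R z)"
        proof -
          have "x *\<^sub>R w + x *\<^sub>R w = (2 * x) *\<^sub>R w" by (simp add: scaleR_add_left[symmetric])
          then show ?thesis by (simp add: algebra_simps)
        qed
        have "\<bar>x - s\<bar> * norm (w - z) \<le> (norm (x - s))\<^sup>2 + (norm (w - z))\<^sup>2"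
        proof -
          have "2 * (\<bar>x - s\<bar> * norm (w - z)) \<le> \<bar>x - s\<bar>\<^sup>2 + (norm (w - z))\<^sup>2" using sum_squares_bound[of "\<bar>x - s\<bar>" "norm (w - z)"] by simp
          moreover have "0 \<le> \<bar>x - s\<bar> * norm (w - z)" by simp
          ultimately show ?thesis unfolding real_norm_def by linarith
        qed
        moreover have "norm ((x - s) *\<^sub>R (w - z) + s *\<^sub>R (w - z) + (x - s) *\<^sub>R z) \<le> \<bar>x - s\<bar> * norm (w - z) + norm s * norm (w - z) + norm (x - s) * norm z"
          by (intro order_trans[OF norm_triangle_ineq] add_mono) auto
        ultimately have "norm (x *\<^sub>R w + x *\<^sub>R w - (2 * s) *\<^sub>R z) \<le> 2 * ((norm (x - s))\<^sup>2 + (norm (w - z))\<^sup>2 + norm (w - z) * norm s + norm (x - s) * norm z)"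
          unfolding eq norm_scaleR by (simp add: mult.commute)
        then have "ennreal (norm (x *\<^sub>R w + x *\<^sub>R w - (2 * s) *\<^sub>R z)) \<le> ennreal (2 * ((norm (x - s))\<^sup>2 + (norm (w - z))\<^sup>2 + norm (w - z) * norm s + norm (x - s) * norm z))"
          by (rule ennreal_leI)
        also have "\<dots> = 2 * ((ennreal (norm (x - s)))\<^sup>2 + (ennreal (norm (w - z)))\<^sup>2 + ennreal (norm (w - z)) * ennreal (norm s) + ennreal (norm (x - s)) * ennreal (norm z))"
          by (simp add: ennreal_plus ennreal_mult ennreal_power del: power2_abs)
        finally show ?thesis .
      qed
      have "(\<integral>\<^sup>+\<omega>. ennreal (norm (G n \<omega> *\<^sub>R W n \<omega> + G n \<omega> *\<^sub>R W n \<omega> - (2 * S \<omega>) *\<^sub>R Z \<omega>)) \<partial>M)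
        \<le> (\<integral>\<^sup>+\<omega>. 2 * ((a n \<omega>)\<^sup>2 + (b n \<omega>)\<^sup>2 + b n \<omega> * ennreal (norm (S \<omega>)) + a n \<omega> * ennreal (norm (Z \<omega>))) \<partial>M)"
        unfolding a_def b_def by (intro nn_integral_mono pt)
      also have "\<dots> = ?B n"
        by (simp add: nn_integral_cmult nn_integral_add)
      finally show "(\<integral>\<^sup>+\<omega>. ennreal (norm (G n \<omega> *\<^sub>R W n \<omega> + G n \<omega> *\<^sub>R W n \<omega> - (2 * S \<omega>) *\<^sub>R Z \<omega>)) \<partial>M) \<le> ?B n" .
    qed
  qed auto
  have 3: "(\<lambda>\<omega>. G n \<omega> * G n \<omega>, \<lambda>\<omega>. G n \<omega> *\<^sub>R W n \<omega> + G n \<omega> *\<^sub>R W n \<omega>) \<in> smooth_cylindrical X" for n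
    by (rule smooth_cylindrical_mult[OF GW(1) GW(1)])
  show ?thesis
    unfolding malliavin_graph_def mem_Collect_eq prod.case
  proof (intro conjI exI allI)
    show "(\<lambda>\<omega>. G n \<omega> * G n \<omega>, \<lambda>\<omega>. G n \<omega> *\<^sub>R W n \<omega> + G n \<omega> *\<^sub>R W n \<omega>) \<in> smooth_cylindrical X" for n by (rule 3)
  qed (use 1 2 in auto)
qed

end

section \<open>The chain rule through polynomials\<close>

lemma eq_0_if_abs_le_all_eps:
  fixes D C :: real
  assumes "\<And>e. e > 0 \<Longrightarrow> \<bar>D\<bar> \<le> e * C" shows "D = 0"
proof (rule ccontr)
  assume "D \<noteq> 0"
  then have C: "C > 0" using assms[of 1] by linarith
  then have "\<bar>D\<bar> \<le> (\<bar>D\<bar> / (2 * C)) * C" using \<open>D \<noteq> 0\<close> by (intro assms) simp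
  then show False using C \<open>D \<noteq> 0\<close> by simp
qed

text \<open>Weierstrass approximation is applied to the derivative, and the polynomial is then
  integrated. This controls the function and its derivative at the same time, which approximating
  the function alone would not.\<close>

lemma polynomial_approximation_C1:
  fixes \<psi> \<psi>' :: "real \<Rightarrow> real"
  assumes d: "\<And>x. (\<psi> has_real_derivative \<psi>' x) (at x)" and c: "continuous_on UNIV \<psi>'" and e: "e > 0" and K: "K \<ge> 0"
  obtains a n where
    "\<And>x. \<bar>x\<bar> \<le> K \<Longrightarrow> \<bar>\<psi>' x - (\<Sum>i\<le>n. a i * x ^ i)\<bar> \<le> e"
    "\<And>x. \<bar>x\<bar> \<le> K \<Longrightarrow> \<bar>\<psi> x - (\<psi> 0 + (\<Sum>i\<le>n. a i / real (Suc i) * x ^ Suc i))\<bar> \<le> e * K"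
proof -
  have "\<exists>g. real_polynomial_function g \<and> (\<forall>x\<in>{-K..K}. \<bar>\<psi>' x - g x\<bar> < e)"
    by (rule Stone_Weierstrass_real_polynomial_function[of "{-K..K}" \<psi>' e])
      (use c e in \<open>auto intro: continuous_on_subset\<close>)
  then obtain g where g: "real_polynomial_function g" "\<And>x. x \<in> {-K..K} \<Longrightarrow> \<bar>\<psi>' x - g x\<bar> < e" by blast
  then obtain a n where an: "g = (\<lambda>x. \<Sum>i\<le>n. a i * x ^ i)" by (auto simp: real_polynomial_function_iff_sum)
  have q: "\<bar>\<psi>' x - (\<Sum>i\<le>n. a i * x ^ i)\<bar> \<le> e" if "\<bar>x\<bar> \<le> K" for x
  proof -
    have "x \<in> {-K..K}" using that unfolding atLeastAtMost_iff by linarith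
    then show ?thesis using g(2)[of x] unfolding an by linarith
  qed
  define p where "p x = \<psi> x - (\<psi> 0 + (\<Sum>i\<le>n. a i / real (Suc i) * x ^ Suc i))" for x
  have dp: "(p has_real_derivative \<psi>' x - (\<Sum>i\<le>n. a i * x ^ i)) (at x)" for x
  proof -
    have "((\<lambda>x. a i / real (Suc i) * x ^ Suc i) has_real_derivative a i * x ^ i) (at x)" for i
      using DERIV_cmult[OF DERIV_pow[of "Suc i" x], of "a i / real (Suc i)"] by simp
    then have "((\<lambda>x. \<Sum>i\<le>n. a i / real (Suc i) * x ^ Suc i) has_real_derivative (\<Sum>i\<le>n. a i * x ^ i)) (at x)"
      by (rule DERIV_sum)
    from DERIV_diff[OF d DERIV_add[OF DERIV_const this]] show ?thesis by (simp add: p_def[abs_def])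
  qed
  have "\<bar>p x\<bar> \<le> e * K" if x: "\<bar>x\<bar> \<le> K" for x
  proof -
    have "norm (p x - p 0) \<le> e * norm (x - 0)"
    proof (rule field_differentiable_bound)
      show "convex {-K..K}" by simp
      show "(p has_field_derivative \<psi>' z - (\<Sum>i\<le>n. a i * z ^ i)) (at z within {-K..K})" for z
        using dp by (rule has_field_derivative_at_within)
      show "norm (\<psi>' z - (\<Sum>i\<le>n. a i * z ^ i)) \<le> e" if "z \<in> {-K..K}" for z
        using q[of z] that by (simp add: abs_le_iff)
    qed (use x K in \<open>auto simp: abs_le_iff\<close>)
    moreover have "p 0 = 0" by (simp add: p_def)
    moreover have "e * \<bar>x\<bar> \<le> e * K" using x e by (intro mult_left_mono) auto
    ultimately show ?thesis by simp
  qed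
  then show ?thesis using q by (intro that) (auto simp: p_def)
qed

context isonormal_process
begin

text \<open>Constants are adjoined because they are not cylindrical with compact support; as products of
  cylindrical variables are cylindrical again, the span is closed under products.\<close>

inductive_set cyl_algebra :: "(('w \<Rightarrow> real) \<times> ('w \<Rightarrow> 'h)) set" where
  const: "(\<lambda>_. c, \<lambda>_. 0) \<in> cyl_algebra"
| step: "(G, Z) \<in> cyl_algebra \<Longrightarrow> (G', Z') \<in> smooth_cylindrical X \<Longrightarrow>
    (\<lambda>\<omega>. G \<omega> + c * G' \<omega>, \<lambda>\<omega>. Z \<omega> + c *\<^sub>R Z' \<omega>) \<in> cyl_algebra"

lemma cyl_algebra_cong:
  "(G, Z) \<in> cyl_algebra \<Longrightarrow> (\<And>\<omega>. G' \<omega> = G \<omega>) \<Longrightarrow> (\<And>\<omega>. Z' \<omega> = Z \<omega>) \<Longrightarrow> (G', Z') \<in> cyl_algebra"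
  by (metis ext)

lemma cyl_algebra_smooth: "(G, Z) \<in> smooth_cylindrical X \<Longrightarrow> (G, Z) \<in> cyl_algebra"
  by (rule cyl_algebra_cong[OF cyl_algebra.step[OF cyl_algebra.const[of 0], of G Z 1]]) auto

lemma cyl_algebra_add:
  assumes "(G', Z') \<in> cyl_algebra" "(G, Z) \<in> cyl_algebra"
  shows "(\<lambda>\<omega>. G \<omega> + c * G' \<omega>, \<lambda>\<omega>. Z \<omega> + c *\<^sub>R Z' \<omega>) \<in> cyl_algebra"
  using assms
proof (induction "G'" "Z'")
  case (const d)
  from \<open>(G, Z) \<in> cyl_algebra\<close> show ?case
  proof (induction G Z)
    case (const e)
    then show ?case by (rule cyl_algebra_cong[OF cyl_algebra.const[of "e + c * d"]]) auto
  next
    case (step G Z G' Z' e)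
    show ?case by (rule cyl_algebra_cong[OF cyl_algebra.step[OF step.IH step.hyps(2), of e]]) auto
  qed
next
  case (step G1 Z1 G2 Z2 d)
  show ?case
    by (rule cyl_algebra_cong[OF cyl_algebra.step[OF step.IH[OF step.prems] step.hyps(2), of "c * d"]])
      (auto simp: algebra_simps)
qed

lemma cyl_algebra_mult_smooth:
  assumes "(G, Z) \<in> cyl_algebra" "(K, Y) \<in> smooth_cylindrical X"
  shows "(\<lambda>\<omega>. G \<omega> * K \<omega>, \<lambda>\<omega>. K \<omega> *\<^sub>R Z \<omega> + G \<omega> *\<^sub>R Y \<omega>) \<in> cyl_algebra"
  using assms
proof (induction G Z)
  case (const c)
  show ?case by (rule cyl_algebra_cong[OF cyl_algebra.step[OF cyl_algebra.const[of 0] const, of c]]) auto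
next
  case (step G Z G' Z' c)
  show ?case
    by (rule cyl_algebra_cong[OF cyl_algebra.step[OF step.IH[OF step.prems] smooth_cylindrical_mult[OF step.hyps(2) step.prems], of c]])
      (auto simp: algebra_simps)
qed

lemma cyl_algebra_mult:
  assumes "(G', Z') \<in> cyl_algebra" "(G, Z) \<in> cyl_algebra"
  shows "(\<lambda>\<omega>. G \<omega> * G' \<omega>, \<lambda>\<omega>. G' \<omega> *\<^sub>R Z \<omega> + G \<omega> *\<^sub>R Z' \<omega>) \<in> cyl_algebra"
  using assms
proof (induction "G'" "Z'")
  case (const c)
  show ?case
    by (rule cyl_algebra_cong[OF cyl_algebra_add[OF const cyl_algebra.const[of 0], of c]]) auto
next
  case (step G1 Z1 G2 Z2 d)
  show ?case
    by (rule cyl_algebra_cong[OF cyl_algebra_add[OF cyl_algebra_mult_smooth[OF step.prems step.hyps(2)] step.IH[OF step.prems], of d]])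
      (auto simp: algebra_simps)
qed

lemma cyl_algebra_power:
  assumes "(G, Z) \<in> cyl_algebra"
  shows "(\<lambda>\<omega>. G \<omega> ^ Suc i, \<lambda>\<omega>. (real (Suc i) * G \<omega> ^ i) *\<^sub>R Z \<omega>) \<in> cyl_algebra"
proof (induction i)
  case 0
  show ?case by (rule cyl_algebra_cong[OF assms]) auto
next
  case (Suc i)
  show ?case
    by (rule cyl_algebra_cong[OF cyl_algebra_mult[OF assms Suc]])
      (auto simp: algebra_simps scaleR_add_left[symmetric] simp del: scaleR_add_left)
qed

text \<open>The polynomial is written as an antiderivative, with coefficients
  \<open>a i / real (Suc i)\<close>, to match \<open>polynomial_approximation_C1\<close>.\<close>

lemma cyl_algebra_polynomial:
  assumes "(G, Z) \<in> cyl_algebra"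
  shows "(\<lambda>\<omega>. c + (\<Sum>i\<le>n. a i / real (Suc i) * G \<omega> ^ Suc i), \<lambda>\<omega>. (\<Sum>i\<le>n. a i * G \<omega> ^ i) *\<^sub>R Z \<omega>) \<in> cyl_algebra"
proof (induction n)
  case 0
  show ?case by (rule cyl_algebra_cong[OF cyl_algebra_add[OF assms cyl_algebra.const[of c], of "a 0"]]) auto
next
  case (Suc n)
  show ?case
  proof (rule cyl_algebra_cong[OF cyl_algebra_add[OF cyl_algebra_power[OF assms, of "Suc n"] Suc, of "a (Suc n) / real (Suc (Suc n))"]])
    fix \<omega>
    show "c + (\<Sum>i\<le>Suc n. a i / real (Suc i) * G \<omega> ^ Suc i) = c + (\<Sum>i\<le>n. a i / real (Suc i) * G \<omega> ^ Suc i) + a (Suc n) / real (Suc (Suc n)) * G \<omega> ^ Suc (Suc n)"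
      by simp
    have "a (Suc n) / real (Suc (Suc n)) * (real (Suc (Suc n)) * G \<omega> ^ Suc n) = a (Suc n) * G \<omega> ^ Suc n" by simp
    then show "(\<Sum>i\<le>Suc n. a i * G \<omega> ^ i) *\<^sub>R Z \<omega> = (\<Sum>i\<le>n. a i * G \<omega> ^ i) *\<^sub>R Z \<omega> + (a (Suc n) / real (Suc (Suc n))) *\<^sub>R (real (Suc (Suc n)) * G \<omega> ^ Suc n) *\<^sub>R Z \<omega>"
      by (simp only: sum.atMost_Suc scaleR_add_left scaleR_scaleR)
  qed
qed

lemma cyl_algebra_measurable:
  assumes "(G, Z) \<in> cyl_algebra" shows "G \<in> borel_measurable M \<and> Z \<in> borel_measurable M"
  using assms by induction (auto intro!: borel_measurable_add borel_measurable_times borel_measurable_scaleR dest: smooth_cylindrical_measurable)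

lemma cyl_algebra_bounded:
  assumes "(G, Z) \<in> cyl_algebra" shows "\<exists>K. \<forall>\<omega>. \<bar>G \<omega>\<bar> \<le> K \<and> norm (Z \<omega>) \<le> K"
  using assms
proof induction
  case (const c)
  show ?case by (intro exI[of _ "\<bar>c\<bar>"]) auto
next
  case (step G Z G' Z' c)
  obtain K where K: "\<And>\<omega>. \<bar>G \<omega>\<bar> \<le> K" "\<And>\<omega>. norm (Z \<omega>) \<le> K" using step.IH by auto
  obtain L where L: "\<And>\<omega>. \<bar>G' \<omega>\<bar> \<le> L" "\<And>\<omega>. norm (Z' \<omega>) \<le> L"
    using smooth_cylindrical_bounded[OF step.hyps(2)] by auto
  have "\<bar>G \<omega> + c * G' \<omega>\<bar> \<le> K + \<bar>c\<bar> * L" for \<omega>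
    by (intro order_trans[OF abs_triangle_ineq] add_mono K) (simp add: abs_mult mult_left_mono L)
  moreover have "norm (Z \<omega> + c *\<^sub>R Z' \<omega>) \<le> K + \<bar>c\<bar> * L" for \<omega>
    by (intro order_trans[OF norm_triangle_ineq] add_mono K) (simp add: mult_left_mono L)
  ultimately show ?case by blast
qed

lemma integrable_inner_square:
  fixes u Z :: "'w \<Rightarrow> 'h"
  assumes [measurable]: "u \<in> borel_measurable M" "Z \<in> borel_measurable M"
    and "integrable M (\<lambda>\<omega>. (norm (u \<omega>))\<^sup>2)" "integrable M (\<lambda>\<omega>. (norm (Z \<omega>))\<^sup>2)"
  shows "integrable M (\<lambda>\<omega>. Z \<omega> \<bullet> u \<omega>)"
proof (rule Bochner_Integration.integrable_bound)
  show "integrable M (\<lambda>\<omega>. (norm (Z \<omega>))\<^sup>2 + (norm (u \<omega>))\<^sup>2)" using assms by simp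
  have "\<bar>Z \<omega> \<bullet> u \<omega>\<bar> \<le> (norm (Z \<omega>))\<^sup>2 + (norm (u \<omega>))\<^sup>2" for \<omega>
  proof -
    have "2 * (norm (Z \<omega>) * norm (u \<omega>)) \<le> (norm (Z \<omega>))\<^sup>2 + (norm (u \<omega>))\<^sup>2"
      using sum_squares_bound[of "norm (Z \<omega>)" "norm (u \<omega>)"] by simp
    moreover have "0 \<le> norm (Z \<omega>) * norm (u \<omega>)" by simp
    ultimately show ?thesis using Cauchy_Schwarz_ineq2[of "Z \<omega>" "u \<omega>"] by linarith
  qed
  then show "AE \<omega> in M. norm (Z \<omega> \<bullet> u \<omega>) \<le> norm ((norm (Z \<omega>))\<^sup>2 + (norm (u \<omega>))\<^sup>2)"
    by (intro AE_I2) (simp add: abs_of_nonneg)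
qed simp

lemma integrable_if_square:
  fixes F :: "'w \<Rightarrow> real"
  assumes [measurable]: "F \<in> borel_measurable M" and "integrable M (\<lambda>\<omega>. (F \<omega>)\<^sup>2)"
  shows "integrable M F"
proof (rule Bochner_Integration.integrable_bound)
  show "integrable M (\<lambda>\<omega>. 1 + (F \<omega>)\<^sup>2)" using assms by simp
  have "\<bar>x\<bar> \<le> 1 + x\<^sup>2" for x :: real using two_abs_le[of x] by linarith
  then show "AE \<omega> in M. norm (F \<omega>) \<le> norm (1 + (F \<omega>)\<^sup>2)" by simp
qed simp

end

section \<open>Duality with the divergence\<close>

locale divergence_setup = isonormal_process M X
  for M :: "'w measure" and X :: "'h::{real_inner, banach, second_countable_topology} \<Rightarrow> 'w \<Rightarrow> real" +
  fixes u :: "'w \<Rightarrow> 'h" and F :: "'w \<Rightarrow> real"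
  assumes div: "(u, F) \<in> divergence_graph M X" and centered: "(\<integral>\<omega>. F \<omega> \<partial>M) = 0"
begin

lemma measurable_u [measurable]: "u \<in> borel_measurable M"
  and measurable_F [measurable]: "F \<in> borel_measurable M"
  and u_square: "integrable M (\<lambda>\<omega>. (norm (u \<omega>))\<^sup>2)"
  and F_square: "integrable M (\<lambda>\<omega>. (F \<omega>)\<^sup>2)"
  using div by (auto simp: divergence_graph_def)

lemma integrable_F: "integrable M F"
  by (rule integrable_if_square) (auto intro: F_square)

text \<open>For constants the identity is the assumption \<open>centered\<close>. For cylindrical
  variables it is the definition of the divergence, once \<open>malliavin_D\<close> has been
  replaced by the explicit derivative; the rest is linearity.\<close>

lemma cyl_algebra_dual:
  assumes "(G, Z) \<in> cyl_algebra"
  shows "(\<integral>\<omega>. G \<omega> * F \<omega> \<partial>M) = (\<integral>\<omega>. Z \<omega> \<bullet> u \<omega> \<partial>M)"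
  using assms
proof induction
  case (const c)
  show ?case using centered by simp
next
  case (step G Z G' Z' c)
  have "G' \<in> sobolev M X 2"
    unfolding sobolev_def using smooth_cylindrical_graph[OF step.hyps(2), of 2] by auto
  then have "(\<integral>\<omega>. G' \<omega> * F \<omega> \<partial>M) = (\<integral>\<omega>. malliavin_D M X G' \<omega> \<bullet> u \<omega> \<partial>M)"
    using div by (auto simp: divergence_graph_def)
  also have "\<dots> = (\<integral>\<omega>. Z' \<omega> \<bullet> u \<omega> \<partial>M)"
  proof -
    have g: "(G', Z') \<in> malliavin_graph M X 1" by (rule smooth_cylindrical_graph[OF step.hyps(2)]) simp
    have "malliavin_D M X G' \<in> borel_measurable M"
      using malliavin_D_graph(1)[OF g] by (simp add: malliavin_graph_def)
    then show ?thesis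
      using malliavin_D_graph(2)[OF g] smooth_cylindrical_measurable[OF step.hyps(2)]
      by (intro integral_cong_AE) auto
  qed
  finally have d: "(\<integral>\<omega>. G' \<omega> * F \<omega> \<partial>M) = (\<integral>\<omega>. Z' \<omega> \<bullet> u \<omega> \<partial>M)" .
  have i: "integrable M (\<lambda>\<omega>. G \<omega> * F \<omega>)" "integrable M (\<lambda>\<omega>. Z \<omega> \<bullet> u \<omega>)" if GZ: "(G, Z) \<in> cyl_algebra" for G Z
  proof -
    obtain K where K: "\<And>\<omega>. \<bar>G \<omega>\<bar> \<le> K" "\<And>\<omega>. norm (Z \<omega>) \<le> K" using cyl_algebra_bounded[OF GZ] by auto
    have m: "G \<in> borel_measurable M" "Z \<in> borel_measurable M" using cyl_algebra_measurable[OF GZ] by auto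
    show "integrable M (\<lambda>\<omega>. G \<omega> * F \<omega>)" by (rule integrable_bounded_mult[OF integrable_F m(1) K(1)])
    have "integrable M (\<lambda>\<omega>. (norm (Z \<omega>))\<^sup>2)"
      using K(2) m(2) by (intro integrable_const_bound[of _ "K\<^sup>2"]) (auto intro!: power_mono)
    then show "integrable M (\<lambda>\<omega>. Z \<omega> \<bullet> u \<omega>)" using m u_square by (intro integrable_inner_square) auto
  qed
  note i1 = i[OF step.hyps(1)] and i2 = i[OF cyl_algebra_smooth[OF step.hyps(2)]]
  have "(\<integral>\<omega>. (G \<omega> + c * G' \<omega>) * F \<omega> \<partial>M) = (\<integral>\<omega>. G \<omega> * F \<omega> + c * (G' \<omega> * F \<omega>) \<partial>M)"
    by (simp add: algebra_simps)
  also have "\<dots> = (\<integral>\<omega>. Z \<omega> \<bullet> u \<omega> + c * (Z' \<omega> \<bullet> u \<omega>) \<partial>M)"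
    using i1 i2 step.IH d by simp
  finally show ?case by (simp add: inner_add_left)
qed

text \<open>\<open>G\<close> is bounded, so \<psi> matters only on a compact interval. There it is
  approximated, together with its derivative, by polynomials, under which \<open>cyl_algebra\<close>
  is closed.\<close>

lemma cyl_algebra_dual_C1:
  assumes GZ: "(G, Z) \<in> cyl_algebra"
    and d: "\<And>x. (\<psi> has_real_derivative \<psi>' x) (at x)" and c: "continuous_on UNIV \<psi>'"
  shows "(\<integral>\<omega>. \<psi> (G \<omega>) * F \<omega> \<partial>M) = (\<integral>\<omega>. \<psi>' (G \<omega>) * (Z \<omega> \<bullet> u \<omega>) \<partial>M)"
proof -
  obtain K where K: "\<And>\<omega>. \<bar>G \<omega>\<bar> \<le> K" "\<And>\<omega>. norm (Z \<omega>) \<le> K" using cyl_algebra_bounded[OF GZ] by auto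
  have K0: "K \<ge> 0" using K(1)[of undefined] by linarith
  have m [measurable]: "G \<in> borel_measurable M" "Z \<in> borel_measurable M" using cyl_algebra_measurable[OF GZ] by auto
  have "integrable M (\<lambda>\<omega>. (norm (Z \<omega>))\<^sup>2)"
    using K(2) by (intro integrable_const_bound[of _ "K\<^sup>2"]) (auto intro!: power_mono)
  then have iV: "integrable M (\<lambda>\<omega>. Z \<omega> \<bullet> u \<omega>)" using u_square by (intro integrable_inner_square) auto
  have cp: "continuous_on UNIV \<psi>" using d by (intro DERIV_continuous_on) (auto intro: has_field_derivative_at_within)
  note [measurable] = borel_measurable_continuous_onI[OF c] borel_measurable_continuous_onI[OF cp]
  have bd: "\<exists>L. \<forall>\<omega>. \<bar>f (G \<omega>)\<bar> \<le> L" if "continuous_on UNIV f" for f :: "real \<Rightarrow> real"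
  proof -
    have "compact (f ` {-K..K})" using that by (intro compact_continuous_image) (auto intro: continuous_on_subset)
    then have "bounded (f ` {-K..K})" by (rule compact_imp_bounded)
    then obtain L where "\<forall>y\<in>f ` {-K..K}. norm y \<le> L" unfolding bounded_iff by blast
    moreover have "G \<omega> \<in> {-K..K}" for \<omega> using K(1)[of \<omega>] unfolding atLeastAtMost_iff by linarith
    ultimately show ?thesis by (intro exI[of _ L]) auto
  qed
  obtain L1 L2 where L: "\<And>\<omega>. \<bar>\<psi> (G \<omega>)\<bar> \<le> L1" "\<And>\<omega>. \<bar>\<psi>' (G \<omega>)\<bar> \<le> L2"
    using bd[OF cp] bd[OF c] by blast
  have i1: "integrable M (\<lambda>\<omega>. \<psi> (G \<omega>) * F \<omega>)" by (rule integrable_bounded_mult[OF integrable_F _ L(1)]) simp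
  have i2: "integrable M (\<lambda>\<omega>. \<psi>' (G \<omega>) * (Z \<omega> \<bullet> u \<omega>))" by (rule integrable_bounded_mult[OF iV _ L(2)]) simp
  let ?D = "(\<integral>\<omega>. \<psi> (G \<omega>) * F \<omega> \<partial>M) - (\<integral>\<omega>. \<psi>' (G \<omega>) * (Z \<omega> \<bullet> u \<omega>) \<partial>M)"
  have "?D = 0"
  proof (rule eq_0_if_abs_le_all_eps)
    fix e :: real assume e: "e > 0"
    obtain a n where q: "\<And>x. \<bar>x\<bar> \<le> K \<Longrightarrow> \<bar>\<psi>' x - (\<Sum>i\<le>n. a i * x ^ i)\<bar> \<le> e"
      and p: "\<And>x. \<bar>x\<bar> \<le> K \<Longrightarrow> \<bar>\<psi> x - (\<psi> 0 + (\<Sum>i\<le>n. a i / real (Suc i) * x ^ Suc i))\<bar> \<le> e * K"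
      using polynomial_approximation_C1[OF d c e K0] by blast
    define P where "P \<omega> = \<psi> 0 + (\<Sum>i\<le>n. a i / real (Suc i) * G \<omega> ^ Suc i)" for \<omega>
    define Q where "Q \<omega> = (\<Sum>i\<le>n. a i * G \<omega> ^ i)" for \<omega>
    have [measurable]: "P \<in> borel_measurable M" "Q \<in> borel_measurable M"
      unfolding P_def[abs_def] Q_def[abs_def] by measurable
    have PQ: "(P, \<lambda>\<omega>. Q \<omega> *\<^sub>R Z \<omega>) \<in> cyl_algebra"
      unfolding P_def[abs_def] Q_def[abs_def] by (rule cyl_algebra_polynomial[OF GZ])
    have pb: "\<bar>\<psi> (G \<omega>) - P \<omega>\<bar> \<le> e * K" "\<bar>\<psi>' (G \<omega>) - Q \<omega>\<bar> \<le> e" for \<omega>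
      using p[OF K(1)] q[OF K(1)] by (simp_all add: P_def Q_def)
    have j1: "integrable M (\<lambda>\<omega>. (\<psi> (G \<omega>) - P \<omega>) * F \<omega>)" by (rule integrable_bounded_mult[OF integrable_F _ pb(1)]) simp
    have j2: "integrable M (\<lambda>\<omega>. (\<psi>' (G \<omega>) - Q \<omega>) * (Z \<omega> \<bullet> u \<omega>))" by (rule integrable_bounded_mult[OF iV _ pb(2)]) simp
    have "(\<integral>\<omega>. \<psi> (G \<omega>) * F \<omega> - (\<psi> (G \<omega>) - P \<omega>) * F \<omega> \<partial>M) = (\<integral>\<omega>. \<psi>' (G \<omega>) * (Z \<omega> \<bullet> u \<omega>) - (\<psi>' (G \<omega>) - Q \<omega>) * (Z \<omega> \<bullet> u \<omega>) \<partial>M)"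
      using cyl_algebra_dual[OF PQ] by (simp add: left_diff_distrib)
    then have "?D = (\<integral>\<omega>. (\<psi> (G \<omega>) - P \<omega>) * F \<omega> \<partial>M) - (\<integral>\<omega>. (\<psi>' (G \<omega>) - Q \<omega>) * (Z \<omega> \<bullet> u \<omega>) \<partial>M)"
      by (simp only: Bochner_Integration.integral_diff[OF i1 j1] Bochner_Integration.integral_diff[OF i2 j2])
    moreover have "\<bar>\<integral>\<omega>. (\<psi> (G \<omega>) - P \<omega>) * F \<omega> \<partial>M\<bar> \<le> (\<integral>\<omega>. e * K * \<bar>F \<omega>\<bar> \<partial>M)"
      using integrable_abs[OF j1] integrable_F pb(1) by (intro order_trans[OF integral_abs_bound] integral_mono) (auto simp: abs_mult intro!: mult_right_mono)
    moreover have "\<bar>\<integral>\<omega>. (\<psi>' (G \<omega>) - Q \<omega>) * (Z \<omega> \<bullet> u \<omega>) \<partial>M\<bar> \<le> (\<integral>\<omega>. e * \<bar>Z \<omega> \<bullet> u \<omega>\<bar> \<partial>M)"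
      using integrable_abs[OF j2] iV pb(2) by (intro order_trans[OF integral_abs_bound] integral_mono) (auto simp: abs_mult intro!: mult_right_mono)
    ultimately show "\<bar>?D\<bar> \<le> e * (K * (\<integral>\<omega>. \<bar>F \<omega>\<bar> \<partial>M) + (\<integral>\<omega>. \<bar>Z \<omega> \<bullet> u \<omega>\<bar> \<partial>M))"
      by (simp add: distrib_left)
  qed
  then show ?thesis by simp
qed

lemma tendsto_inner_L2:
  assumes [measurable]: "\<And>n. W n \<in> borel_measurable M" "Z \<in> borel_measurable M" and lim: "Lp_tendsto M 2 W Z"
  shows "(\<lambda>n. \<integral>\<^sup>+\<omega>. ennreal \<bar>W n \<omega> \<bullet> u \<omega> - Z \<omega> \<bullet> u \<omega>\<bar> \<partial>M) \<longlonglongrightarrow> 0"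
proof (rule tendsto_sandwich[OF _ _ tendsto_const])
  show "(\<lambda>n. \<integral>\<^sup>+\<omega>. ennreal (norm (W n \<omega> - Z \<omega>)) * ennreal (norm (u \<omega>)) \<partial>M) \<longlonglongrightarrow> 0"
    by (rule nn_integral_mult_tendsto_0[OF _ _ _ _ nn_integral_norm_square_finite[OF u_square]])
      (use lim in \<open>auto simp: Lp_tendsto_2\<close>)
  show "\<forall>\<^sub>F n in sequentially. (\<integral>\<^sup>+\<omega>. ennreal \<bar>W n \<omega> \<bullet> u \<omega> - Z \<omega> \<bullet> u \<omega>\<bar> \<partial>M) \<le> (\<integral>\<^sup>+\<omega>. ennreal (norm (W n \<omega> - Z \<omega>)) * ennreal (norm (u \<omega>)) \<partial>M)"
    by (intro always_eventually allI nn_integral_mono)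
      (auto simp: ennreal_mult[symmetric] inner_diff_left[symmetric] intro!: ennreal_leI Cauchy_Schwarz_ineq2)
qed auto

text \<open>Stated for combinations of two variables because the interpolation path mixes
  \<open>F\<close> and \<open>S\<close>. Approximants of both are inserted into
  \<open>cyl_algebra_dual_C1\<close>. The left side converges by dominated convergence along an
  almost surely convergent subsequence. On the right, \<psi>'(Yn) Vn is split into \<psi>'(Yn) (Vn -
  V), small because \<psi>' is bounded and Vn tends to V in mean, and \<psi>'(Yn) V, again treated
  by dominated convergence.\<close>

theorem dual_C1:
  assumes 1: "(F1, Z1) \<in> malliavin_graph M X 2" and 2: "(F2, Z2) \<in> malliavin_graph M X 2"
    and d: "\<And>x. (\<psi> has_real_derivative \<psi>' x) (at x)" and c: "continuous_on UNIV \<psi>'"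
    and b: "\<And>x. \<bar>\<psi> x\<bar> \<le> K" "\<And>x. \<bar>\<psi>' x\<bar> \<le> K"
  shows "(\<integral>\<omega>. \<psi> (a1 * F1 \<omega> + a2 * F2 \<omega>) * F \<omega> \<partial>M) =
    (\<integral>\<omega>. \<psi>' (a1 * F1 \<omega> + a2 * F2 \<omega>) * (a1 * (Z1 \<omega> \<bullet> u \<omega>) + a2 * (Z2 \<omega> \<bullet> u \<omega>)) \<partial>M)"
proof -
  have cp: "continuous_on UNIV \<psi>" using d by (intro DERIV_continuous_on) (auto intro: has_field_derivative_at_within)
  note [measurable] = borel_measurable_continuous_onI[OF c] borel_measurable_continuous_onI[OF cp]
  obtain G1 W1 where G1: "\<And>n. (G1 n, W1 n) \<in> smooth_cylindrical X" "Lp_tendsto M 2 G1 F1" "Lp_tendsto M 2 W1 Z1"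
    and m1 [measurable]: "F1 \<in> borel_measurable M" "Z1 \<in> borel_measurable M"
    using 1 by (auto simp: malliavin_graph_def)
  obtain G2 W2 where G2: "\<And>n. (G2 n, W2 n) \<in> smooth_cylindrical X" "Lp_tendsto M 2 G2 F2" "Lp_tendsto M 2 W2 Z2"
    and m2 [measurable]: "F2 \<in> borel_measurable M" "Z2 \<in> borel_measurable M"
    using 2 by (auto simp: malliavin_graph_def)
  note [measurable] = smooth_cylindrical_measurable[OF G1(1)] smooth_cylindrical_measurable[OF G2(1)]
  have sub: "\<exists>r::nat\<Rightarrow>nat. strict_mono r \<and> (AE \<omega> in M. (\<lambda>n. G (s (r n)) \<omega> - F \<omega>) \<longlonglongrightarrow> 0)"
    if G: "\<And>n. (G n, W n) \<in> smooth_cylindrical X" and m: "F \<in> borel_measurable M" and lim: "Lp_tendsto M 2 G F" and s: "strict_mono s"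
    for G W F and s :: "nat \<Rightarrow> nat"
  proof (rule tendsto_L1_AE_subseq)
    have Gm: "G n \<in> borel_measurable M" for n using smooth_cylindrical_measurable(1)[OF G] .
    have lim1: "Lp_tendsto M 1 G F" using Lp_tendsto_mono[OF Gm m _ _ lim, of 1] by simp
    have Gi: "integrable M (G n)" for n using smooth_cylindrical_integrable(1)[OF G] .
    have Fi: "integrable M F" by (rule integrable_L1_limit[OF Gi m]) (use lim1 in \<open>simp only: Lp_tendsto_1\<close>)
    show "integrable M (\<lambda>\<omega>. G (s n) \<omega> - F \<omega>)" for n using Gi Fi by simp
    have "(\<lambda>n. ennreal (\<integral>\<omega>. norm (G n \<omega> - F \<omega>) \<partial>M)) \<longlonglongrightarrow> ennreal 0"
      using lim1 Gi Fi unfolding Lp_tendsto_1 by (subst nn_integral_eq_integral[symmetric]) auto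
    then have "(\<lambda>n. \<integral>\<omega>. norm (G n \<omega> - F \<omega>) \<partial>M) \<longlonglongrightarrow> 0"
      by (subst (asm) tendsto_ennreal_iff) (auto intro!: always_eventually)
    from LIMSEQ_subseq_LIMSEQ[OF this s]
    show "(\<lambda>n. \<integral>\<omega>. norm (G (s n) \<omega> - F \<omega>) \<partial>M) \<longlonglongrightarrow> 0" by (simp add: o_def)
  qed
  obtain r1 where r1: "strict_mono r1" "AE \<omega> in M. (\<lambda>n. G1 (r1 n) \<omega> - F1 \<omega>) \<longlonglongrightarrow> 0"
    using sub[OF G1(1) m1(1) G1(2), of "\<lambda>n. n"] by (auto simp: strict_mono_def)
  \<comment> \<open>The second subsequence is extracted from the first, so that both approximations
    converge along the composition \<open>r\<close>.\<close>
  obtain r2 where r2: "strict_mono r2" "AE \<omega> in M. (\<lambda>n. G2 (r1 (r2 n)) \<omega> - F2 \<omega>) \<longlonglongrightarrow> 0"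
    using sub[OF G2(1) m2(1) G2(2) r1(1)] by auto
  define r where "r = r1 \<circ> r2"
  have r: "strict_mono r" using r1(1) r2(1) by (simp add: r_def strict_mono_o)
  have ae1: "AE \<omega> in M. (\<lambda>n. G1 (r n) \<omega>) \<longlonglongrightarrow> F1 \<omega>"
    using r1(2)
  proof eventually_elim
    case (elim \<omega>)
    from LIMSEQ_subseq_LIMSEQ[OF elim r2(1)] have "(\<lambda>n. G1 (r n) \<omega> - F1 \<omega>) \<longlonglongrightarrow> 0" by (simp add: o_def r_def)
    then show ?case by (simp add: LIM_zero_iff)
  qed
  have ae2: "AE \<omega> in M. (\<lambda>n. G2 (r n) \<omega>) \<longlonglongrightarrow> F2 \<omega>"
    using r2(2) by eventually_elim (simp add: LIM_zero_iff r_def)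
  define Y where "Y \<omega> = a1 * F1 \<omega> + a2 * F2 \<omega>" for \<omega>
  define Yn where "Yn n \<omega> = a1 * G1 (r n) \<omega> + a2 * G2 (r n) \<omega>" for n \<omega>
  define V where "V \<omega> = a1 * (Z1 \<omega> \<bullet> u \<omega>) + a2 * (Z2 \<omega> \<bullet> u \<omega>)" for \<omega>
  define Vn where "Vn n \<omega> = a1 * (W1 (r n) \<omega> \<bullet> u \<omega>) + a2 * (W2 (r n) \<omega> \<bullet> u \<omega>)" for n \<omega>
  have [measurable]: "Y \<in> borel_measurable M" "V \<in> borel_measurable M" "Yn n \<in> borel_measurable M" "Vn n \<in> borel_measurable M" for n
    unfolding Y_def[abs_def] Yn_def[abs_def] V_def[abs_def] Vn_def[abs_def] by measurable
  have aeY: "AE \<omega> in M. (\<lambda>n. Yn n \<omega>) \<longlonglongrightarrow> Y \<omega>"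
    using ae1 ae2 by eventually_elim (auto simp: Yn_def Y_def intro!: tendsto_intros)
  have alg: "(Yn n, \<lambda>\<omega>. a1 *\<^sub>R W1 (r n) \<omega> + a2 *\<^sub>R W2 (r n) \<omega>) \<in> cyl_algebra" for n
  proof -
    have "(\<lambda>\<omega>. 0 + a1 * G1 (r n) \<omega>, \<lambda>\<omega>. 0 + a1 *\<^sub>R W1 (r n) \<omega>) \<in> cyl_algebra"
      by (rule cyl_algebra.step[OF cyl_algebra.const G1(1)])
    from cyl_algebra.step[OF this G2(1), of a2] show ?thesis by (simp add: Yn_def[abs_def])
  qed
  have dual: "(\<integral>\<omega>. \<psi> (Yn n \<omega>) * F \<omega> \<partial>M) = (\<integral>\<omega>. \<psi>' (Yn n \<omega>) * Vn n \<omega> \<partial>M)" for n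
    using cyl_algebra_dual_C1[OF alg d c, of n] by (simp add: Vn_def inner_add_left)
  have iZ: "integrable M (\<lambda>\<omega>. Z \<omega> \<bullet> u \<omega>)" if "(F', Z) \<in> malliavin_graph M X 2" for F' Z
    using malliavin_graph_powr_integrable(2)[OF _ that] that u_square
    by (intro integrable_inner_square) (auto simp: powr_2_norm malliavin_graph_def)
  have iV: "integrable M V" unfolding V_def[abs_def] using iZ[OF 1] iZ[OF 2] by simp
  have iVn: "integrable M (Vn n)" for n
    unfolding Vn_def[abs_def]
    using iZ[OF smooth_cylindrical_graph[OF G1(1)]] iZ[OF smooth_cylindrical_graph[OF G2(1)]] by simp
  have L: "(\<lambda>n. \<integral>\<omega>. \<psi> (Yn n \<omega>) * F \<omega> \<partial>M) \<longlonglongrightarrow> (\<integral>\<omega>. \<psi> (Y \<omega>) * F \<omega> \<partial>M)"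
  proof (rule integral_dominated_convergence[where w = "\<lambda>\<omega>. K * \<bar>F \<omega>\<bar>"])
    show "integrable M (\<lambda>\<omega>. K * \<bar>F \<omega>\<bar>)" using integrable_F by simp
    show "AE \<omega> in M. (\<lambda>n. \<psi> (Yn n \<omega>) * F \<omega>) \<longlonglongrightarrow> \<psi> (Y \<omega>) * F \<omega>"
      using aeY
    proof eventually_elim
      case (elim \<omega>)
      have "isCont \<psi> (Y \<omega>)" using d DERIV_isCont by blast
      from isCont_tendsto_compose[OF this elim] show ?case by (intro tendsto_mult tendsto_const)
    qed
    show "AE \<omega> in M. norm (\<psi> (Yn n \<omega>) * F \<omega>) \<le> K * \<bar>F \<omega>\<bar>" for n
      using b(1) by (intro AE_I2) (simp add: abs_mult mult_right_mono)
  qed simp_all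
  have R1: "(\<lambda>n. \<integral>\<omega>. \<psi>' (Yn n \<omega>) * V \<omega> \<partial>M) \<longlonglongrightarrow> (\<integral>\<omega>. \<psi>' (Y \<omega>) * V \<omega> \<partial>M)"
  proof (rule integral_dominated_convergence[where w = "\<lambda>\<omega>. K * \<bar>V \<omega>\<bar>"])
    show "integrable M (\<lambda>\<omega>. K * \<bar>V \<omega>\<bar>)" using iV by simp
    show "AE \<omega> in M. (\<lambda>n. \<psi>' (Yn n \<omega>) * V \<omega>) \<longlonglongrightarrow> \<psi>' (Y \<omega>) * V \<omega>"
      using aeY
    proof eventually_elim
      case (elim \<omega>)
      have "isCont \<psi>' (Y \<omega>)" using c by (simp add: continuous_on_eq_continuous_at)
      from isCont_tendsto_compose[OF this elim] show ?case by (intro tendsto_mult tendsto_const)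
    qed
    show "AE \<omega> in M. norm (\<psi>' (Yn n \<omega>) * V \<omega>) \<le> K * \<bar>V \<omega>\<bar>" for n
      using b(2) by (intro AE_I2) (simp add: abs_mult mult_right_mono)
  qed simp_all
  have R2: "(\<lambda>n. \<integral>\<omega>. \<psi>' (Yn n \<omega>) * Vn n \<omega> - \<psi>' (Yn n \<omega>) * V \<omega> \<partial>M) \<longlonglongrightarrow> (\<integral>\<omega>. 0 \<partial>M)"
  proof (rule tendsto_L1_int)
    have j: "integrable M (\<lambda>\<omega>. \<psi>' (Yn n \<omega>) * Vn n \<omega>)" "integrable M (\<lambda>\<omega>. \<psi>' (Yn n \<omega>) * V \<omega>)" for n
      by (rule integrable_bounded_mult[OF _ _ b(2)]; use iV iVn in simp)+
    then show "integrable M (\<lambda>\<omega>. \<psi>' (Yn n \<omega>) * Vn n \<omega> - \<psi>' (Yn n \<omega>) * V \<omega>)" for n by simp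
    define A where "A n = (\<integral>\<^sup>+\<omega>. ennreal \<bar>W1 n \<omega> \<bullet> u \<omega> - Z1 \<omega> \<bullet> u \<omega>\<bar> \<partial>M)" for n
    define B where "B n = (\<integral>\<^sup>+\<omega>. ennreal \<bar>W2 n \<omega> \<bullet> u \<omega> - Z2 \<omega> \<bullet> u \<omega>\<bar> \<partial>M)" for n
    have "A \<longlonglongrightarrow> 0" "B \<longlonglongrightarrow> 0"
      unfolding A_def[abs_def] B_def[abs_def] using G1(3) G2(3) by (auto intro!: tendsto_inner_L2)
    from this[THEN LIMSEQ_subseq_LIMSEQ, OF r] have AB: "(\<lambda>n. A (r n)) \<longlonglongrightarrow> 0" "(\<lambda>n. B (r n)) \<longlonglongrightarrow> 0"
      by (simp_all add: o_def)
    have K0: "K \<ge> 0" using b(1)[of 0] by linarith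
    show "(\<lambda>n. \<integral>\<^sup>+\<omega>. ennreal (norm (\<psi>' (Yn n \<omega>) * Vn n \<omega> - \<psi>' (Yn n \<omega>) * V \<omega> - 0)) \<partial>M) \<longlonglongrightarrow> 0"
    proof (rule tendsto_sandwich[OF _ _ tendsto_const])
      have "(\<lambda>n. ennreal (K * \<bar>a1\<bar>) * A (r n) + ennreal (K * \<bar>a2\<bar>) * B (r n)) \<longlonglongrightarrow> ennreal (K * \<bar>a1\<bar>) * 0 + ennreal (K * \<bar>a2\<bar>) * 0"
        using AB by (intro tendsto_add ennreal_tendsto_cmult) auto
      then show "(\<lambda>n. ennreal (K * \<bar>a1\<bar>) * A (r n) + ennreal (K * \<bar>a2\<bar>) * B (r n)) \<longlonglongrightarrow> 0" by simp
      show "\<forall>\<^sub>F n in sequentially. (\<integral>\<^sup>+\<omega>. ennreal (norm (\<psi>' (Yn n \<omega>) * Vn n \<omega> - \<psi>' (Yn n \<omega>) * V \<omega> - 0)) \<partial>M)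
          \<le> ennreal (K * \<bar>a1\<bar>) * A (r n) + ennreal (K * \<bar>a2\<bar>) * B (r n)"
      proof (intro always_eventually allI)
        fix n
        have pt: "ennreal (norm (p * (a1 * x + a2 * y) - p * (a1 * x' + a2 * y') - 0)) \<le> ennreal (K * \<bar>a1\<bar>) * ennreal \<bar>x - x'\<bar> + ennreal (K * \<bar>a2\<bar>) * ennreal \<bar>y - y'\<bar>"
          if p: "\<bar>p\<bar> \<le> K" for p x y x' y'
        proof -
          have "p * (a1 * x + a2 * y) - p * (a1 * x' + a2 * y') - 0 = p * (a1 * (x - x') + a2 * (y - y'))" by (simp add: algebra_simps)
          then have "norm (p * (a1 * x + a2 * y) - p * (a1 * x' + a2 * y') - 0) = \<bar>p\<bar> * \<bar>a1 * (x - x') + a2 * (y - y')\<bar>" by (simp add: abs_mult)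
          also have "\<dots> \<le> K * (\<bar>a1\<bar> * \<bar>x - x'\<bar> + \<bar>a2\<bar> * \<bar>y - y'\<bar>)"
            using p K0 by (intro mult_mono order_trans[OF abs_triangle_ineq]) (auto simp: abs_mult)
          finally have "ennreal (norm (p * (a1 * x + a2 * y) - p * (a1 * x' + a2 * y') - 0)) \<le> ennreal (K * \<bar>a1\<bar> * \<bar>x - x'\<bar> + K * \<bar>a2\<bar> * \<bar>y - y'\<bar>)"
            by (intro ennreal_leI) (simp add: distrib_left mult.assoc)
          then show ?thesis using K0 by (simp add: ennreal_mult ennreal_plus)
        qed
        have "(\<integral>\<^sup>+\<omega>. ennreal (norm (\<psi>' (Yn n \<omega>) * Vn n \<omega> - \<psi>' (Yn n \<omega>) * V \<omega> - 0)) \<partial>M)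
          \<le> (\<integral>\<^sup>+\<omega>. ennreal (K * \<bar>a1\<bar>) * ennreal \<bar>W1 (r n) \<omega> \<bullet> u \<omega> - Z1 \<omega> \<bullet> u \<omega>\<bar> + ennreal (K * \<bar>a2\<bar>) * ennreal \<bar>W2 (r n) \<omega> \<bullet> u \<omega> - Z2 \<omega> \<bullet> u \<omega>\<bar> \<partial>M)"
          unfolding Vn_def V_def by (intro nn_integral_mono pt b)
        also have "\<dots> = ennreal (K * \<bar>a1\<bar>) * A (r n) + ennreal (K * \<bar>a2\<bar>) * B (r n)"
          unfolding A_def B_def by (subst nn_integral_add) (auto simp: nn_integral_cmult)
        finally show "(\<integral>\<^sup>+\<omega>. ennreal (norm (\<psi>' (Yn n \<omega>) * Vn n \<omega> - \<psi>' (Yn n \<omega>) * V \<omega> - 0)) \<partial>M) \<le> ennreal (K * \<bar>a1\<bar>) * A (r n) + ennreal (K * \<bar>a2\<bar>) * B (r n)" .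
      qed
    qed auto
  qed simp
  have "(\<integral>\<omega>. \<psi>' (Yn n \<omega>) * Vn n \<omega> - \<psi>' (Yn n \<omega>) * V \<omega> \<partial>M) + (\<integral>\<omega>. \<psi>' (Yn n \<omega>) * V \<omega> \<partial>M) = (\<integral>\<omega>. \<psi>' (Yn n \<omega>) * Vn n \<omega> \<partial>M)" for n
  proof -
    have "integrable M (\<lambda>\<omega>. \<psi>' (Yn n \<omega>) * Vn n \<omega>)" "integrable M (\<lambda>\<omega>. \<psi>' (Yn n \<omega>) * V \<omega>)"
      by (rule integrable_bounded_mult[OF _ _ b(2)]; use iV iVn in simp)+
    then show ?thesis by simp
  qed
  with tendsto_add[OF R2 R1] have "(\<lambda>n. \<integral>\<omega>. \<psi>' (Yn n \<omega>) * Vn n \<omega> \<partial>M) \<longlonglongrightarrow> (\<integral>\<omega>. \<psi>' (Y \<omega>) * V \<omega> \<partial>M)" by simp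
  with L have "(\<integral>\<omega>. \<psi> (Y \<omega>) * F \<omega> \<partial>M) = (\<integral>\<omega>. \<psi>' (Y \<omega>) * V \<omega> \<partial>M)"
    unfolding dual by (rule LIMSEQ_unique)
  then show ?thesis by (simp add: Y_def V_def)
qed

end

section \<open>Smoothing\<close>

text \<open>The dominating function is uniform in \<open>t\<close>, so by the mean value inequality
  it also dominates all difference quotients.\<close>

lemma has_real_derivative_integral:
  fixes f f' :: "real \<Rightarrow> 'a \<Rightarrow> real"
  assumes int: "\<And>t. integrable M (f t)" and d: "\<And>t x. ((\<lambda>t. f t x) has_real_derivative f' t x) (at t)"
    and b: "\<And>t x. \<bar>f' t x\<bar> \<le> w x" and w: "integrable M w" and m: "\<And>t. f' t \<in> borel_measurable M"
  shows "((\<lambda>t. \<integral>x. f t x \<partial>M) has_real_derivative (\<integral>x. f' t x \<partial>M)) (at t)"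
proof -
  have "((\<lambda>s. ((\<integral>x. f s x \<partial>M) - (\<integral>x. f t x \<partial>M)) / (s - t)) \<longlongrightarrow> (\<integral>x. f' t x \<partial>M)) (at t)"
    unfolding tendsto_at_iff_sequentially
  proof (intro allI impI)
    fix s :: "nat \<Rightarrow> real" assume s: "\<forall>i. s i \<in> UNIV - {t}" "s \<longlonglongrightarrow> t"
    have "(\<lambda>n. \<integral>x. (f (s n) x - f t x) / (s n - t) \<partial>M) \<longlonglongrightarrow> (\<integral>x. f' t x \<partial>M)"
    proof (rule integral_dominated_convergence[where w = w])
      show "f' t \<in> borel_measurable M" by (rule m)
      show "(\<lambda>x. (f (s n) x - f t x) / (s n - t)) \<in> borel_measurable M" for n
        using borel_measurable_integrable[OF int] by measurable
      show "integrable M w" by (rule w)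
      show "AE x in M. (\<lambda>n. (f (s n) x - f t x) / (s n - t)) \<longlonglongrightarrow> f' t x"
      proof (rule AE_I2)
        fix x
        have "((\<lambda>s. (f s x - f t x) / (s - t)) \<longlongrightarrow> f' t x) (at t)"
          using d[where t = t and x = x] by (simp add: has_field_derivative_iff)
        then show "(\<lambda>n. (f (s n) x - f t x) / (s n - t)) \<longlonglongrightarrow> f' t x"
          using s unfolding tendsto_at_iff_sequentially by (auto simp: o_def)
      qed
      show "AE x in M. norm ((f (s n) x - f t x) / (s n - t)) \<le> w x" for n
      proof (rule AE_I2)
        fix x
        have "norm (f (s n) x - f t x) \<le> w x * norm (s n - t)"
          by (rule field_differentiable_bound[of UNIV "\<lambda>t. f t x" "\<lambda>t. f' t x"]) (use d b in auto)
        moreover have "s n - t \<noteq> 0" using s(1) by auto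
        ultimately show "norm ((f (s n) x - f t x) / (s n - t)) \<le> w x"
          by (simp add: divide_le_eq)
      qed
    qed
    moreover have "(\<integral>x. (f (s n) x - f t x) / (s n - t) \<partial>M) = ((\<integral>x. f (s n) x \<partial>M) - (\<integral>x. f t x \<partial>M)) / (s n - t)" for n
      using int by simp
    ultimately show "((\<lambda>s. ((\<integral>x. f s x \<partial>M) - (\<integral>x. f t x \<partial>M)) / (s - t)) \<circ> s) \<longlonglongrightarrow> (\<integral>x. f' t x \<partial>M)"
      by (simp only: o_def)
  qed
  then show ?thesis by (simp add: has_field_derivative_iff)
qed

section \<open>Lipschitz functions and their approximation by smooth ones\<close>

definition lip1 :: "(real \<Rightarrow> real) \<Rightarrow> bool" where
  "lip1 f \<longleftrightarrow> (\<forall>x y. \<bar>f x - f y\<bar> \<le> \<bar>x - y\<bar>)"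

lemma lip1D: "lip1 f \<Longrightarrow> \<bar>f x - f y\<bar> \<le> \<bar>x - y\<bar>"
  by (simp add: lip1_def)

lemma lip1_continuous: "lip1 f \<Longrightarrow> continuous_on UNIV f"
  using lipschitz_on_continuous_on[of 1 UNIV f] by (auto simp: lip1_def lipschitz_on_def dist_real_def)

lemma lip1_measurable: "lip1 f \<Longrightarrow> f \<in> borel_measurable borel"
  by (intro borel_measurable_continuous_onI lip1_continuous)

lemma lip1_abs: "lip1 (\<lambda>x. \<bar>x\<bar>)"
  by (auto simp: lip1_def)

lemma lip1_growth: "lip1 f \<Longrightarrow> \<bar>f x\<bar> \<le> \<bar>f 0\<bar> + \<bar>x\<bar>"
  using lip1D[of f x 0] by linarith

lemma lip1_if_derivative:
  assumes "\<And>x. (f has_real_derivative f' x) (at x)" "\<And>x. \<bar>f' x\<bar> \<le> 1"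
  shows "lip1 f"
  unfolding lip1_def
proof (intro allI)
  fix x y
  have "norm (f x - f y) \<le> 1 * norm (x - y)"
    by (rule field_differentiable_bound[of UNIV f f']) (use assms in auto)
  then show "\<bar>f x - f y\<bar> \<le> \<bar>x - y\<bar>" by simp
qed

text \<open>The average of \<open>f\<close> over the interval from x to x + m: it gains one
  derivative, keeps the Lipschitz constant, and by the mean value theorem equals a value of
  \<open>f\<close> at distance at most \<open>m\<close>.\<close>

lemma steklov_average:
  assumes f: "lip1 f" and m: "m > 0"
  obtains a where "\<And>x. (a has_real_derivative (f (x + m) - f x) / m) (at x)" "lip1 a" "\<And>x. \<bar>a x - f x\<bar> \<le> m"
proof -
  have "\<exists>P. \<forall>x :: real. -\<infinity> < ereal x \<longrightarrow> ereal x < \<infinity> \<longrightarrow> (P has_vector_derivative f x) (at x)"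
    using lip1_continuous[OF f] by (intro einterval_antiderivative) (auto simp: continuous_on_eq_continuous_at)
  then obtain P where P: "\<And>x. (P has_real_derivative f x) (at x)"
    by (auto simp: has_real_derivative_iff_has_vector_derivative)
  define a where "a x = (P (x + m) - P x) / m" for x
  have d: "(a has_real_derivative (f (x + m) - f x) / m) (at x)" for x
  proof -
    have "((\<lambda>x. P (x + m)) has_real_derivative f (x + m)) (at x)" using P[of "x + m"] by (simp add: DERIV_shift)
    from DERIV_cdivide[OF DERIV_diff[OF this P], of m] show ?thesis by (simp add: a_def[abs_def])
  qed
  have "lip1 a"
  proof (rule lip1_if_derivative[OF d])
    fix x show "\<bar>(f (x + m) - f x) / m\<bar> \<le> 1"
      using lip1D[OF f, of "x + m" x] m by (simp add: divide_le_eq)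
  qed
  moreover have "\<bar>a x - f x\<bar> \<le> m" for x
  proof -
    obtain z where z: "x < z" "z < x + m" "P (x + m) - P x = (x + m - x) * f z"
      using MVT2[of x "x + m" P f] P m by auto
    then have "a x = f z" using m by (simp add: a_def)
    then show ?thesis using lip1D[OF f, of z x] z by simp
  qed
  ultimately show ?thesis using d that by blast
qed

text \<open>The first derivative carries the constant 1 that matters. \<open>K\<close> provides
  integrability and may depend on the approximation; the bounds on the higher derivatives that reach
  the result come from Gaussian smoothing.\<close>

definition test_function :: "real \<Rightarrow> (real \<Rightarrow> real) \<Rightarrow> (real \<Rightarrow> real) \<Rightarrow> (real \<Rightarrow> real) \<Rightarrow> (real \<Rightarrow> real) \<Rightarrow> bool" where
  "test_function K f f1 f2 f3 \<longleftrightarrow> (\<forall>x. (f has_real_derivative f1 x) (at x)) \<and> (\<forall>x. (f1 has_real_derivative f2 x) (at x)) \<and>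
     (\<forall>x. (f2 has_real_derivative f3 x) (at x)) \<and> continuous_on UNIV f3 \<and>
     (\<forall>x. \<bar>f1 x\<bar> \<le> 1) \<and> (\<forall>x. \<bar>f2 x\<bar> \<le> K) \<and> (\<forall>x. \<bar>f3 x\<bar> \<le> K)"

lemma test_functionD:
  assumes "test_function K f f1 f2 f3"
  shows "(f has_real_derivative f1 x) (at x)" "(f1 has_real_derivative f2 x) (at x)" "(f2 has_real_derivative f3 x) (at x)"
    "continuous_on UNIV f" "continuous_on UNIV f1" "continuous_on UNIV f2" "continuous_on UNIV f3"
    "\<bar>f1 x\<bar> \<le> 1" "\<bar>f2 x\<bar> \<le> K" "\<bar>f3 x\<bar> \<le> K" "lip1 f"
proof -
  have c: "continuous_on UNIV g" if "\<And>x. (g has_real_derivative g' x) (at x)" for g g' :: "real \<Rightarrow> real"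
    using that by (intro DERIV_continuous_on) (auto intro: has_field_derivative_at_within)
  show "continuous_on UNIV f" "continuous_on UNIV f1" "continuous_on UNIV f2"
    using c[of f f1] c[of f1 f2] c[of f2 f3] assms by (auto simp: test_function_def)
  show "lip1 f" using assms by (intro lip1_if_derivative[of f f1]) (auto simp: test_function_def)
qed (use assms in \<open>auto simp: test_function_def\<close>)

lemma difference_quotient_derivative:
  assumes "\<And>x. (f has_real_derivative f' x) (at x)"
  shows "((\<lambda>x. (f (x + m) - f x) / m) has_real_derivative (f' (x + m) - f' x) / m) (at x)"
proof -
  have "((\<lambda>x. f (x + m)) has_real_derivative f' (x + m)) (at x)" using assms[of "x + m"] by (simp add: DERIV_shift)
  from DERIV_cdivide[OF DERIV_diff[OF this assms], of m] show ?thesis by simp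
qed

text \<open>Three successive averages give three derivatives; each derivative is a difference
  quotient of the preceding level, hence bounded.\<close>

lemma test_function_approximation:
  assumes f: "lip1 f" and \<delta>: "\<delta> > 0"
  obtains K g g1 g2 g3 where "test_function K g g1 g2 g3" "\<And>x. \<bar>g x - f x\<bar> \<le> \<delta>"
proof -
  \<comment> \<open>Each of the three averages moves the function by at most
    \<open>m\<close>.\<close>
  define m where "m = \<delta> / 3"
  have m: "m > 0" using \<delta> by (simp add: m_def)
  obtain a where a: "\<And>x. (a has_real_derivative (f (x + m) - f x) / m) (at x)" "lip1 a" "\<And>x. \<bar>a x - f x\<bar> \<le> m"
    using steklov_average[OF f m] by blast
  obtain b where b: "\<And>x. (b has_real_derivative (a (x + m) - a x) / m) (at x)" "lip1 b" "\<And>x. \<bar>b x - a x\<bar> \<le> m"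
    using steklov_average[OF a(2) m] by blast
  obtain c where c: "\<And>x. (c has_real_derivative (b (x + m) - b x) / m) (at x)" "lip1 c" "\<And>x. \<bar>c x - b x\<bar> \<le> m"
    using steklov_average[OF b(2) m] by blast
  define d where "d h x = (h (x + m) - h x) / m" for h :: "real \<Rightarrow> real" and x
  have lip_d: "\<bar>d h x\<bar> \<le> 1" if "lip1 h" for h x
    using lip1D[OF that, of "x + m" x] m by (simp add: d_def divide_le_eq)
  have d_bound: "\<bar>d h x\<bar> \<le> 2 * L / m" if "\<And>x. \<bar>h x\<bar> \<le> L" for h L x
  proof -
    have "\<bar>h (x + m) - h x\<bar> \<le> 2 * L" using that[of "x + m"] that[of x] by linarith
    then show ?thesis using m by (simp add: d_def divide_right_mono)
  qed
  have fa: "(a has_real_derivative d f x) (at x)" for x using a(1) by (simp add: d_def)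
  have ba: "(b has_real_derivative d a x) (at x)" for x using b(1) by (simp add: d_def)
  have cb: "(c has_real_derivative d b x) (at x)" for x using c(1) by (simp add: d_def)
  have dd: "(d h has_real_derivative d h' x) (at x)" if "\<And>x. (h has_real_derivative h' x) (at x)" for h h' x
    using difference_quotient_derivative[OF that] by (simp add: d_def[abs_def])
  have bd2: "\<bar>d (d a) x\<bar> \<le> 2 * 1 / m" for x by (rule d_bound[OF lip_d[OF a(2)]])
  have bd3: "\<bar>d (d (d f)) x\<bar> \<le> 2 * (2 * 1 / m) / m" for x by (rule d_bound[OF d_bound[OF lip_d[OF f]]])
  have cont: "continuous_on UNIV (d h)" if "continuous_on UNIV h" for h
    unfolding d_def[abs_def] using m by (intro continuous_intros continuous_on_compose2[OF that]) auto
  have "test_function (max (2 * 1 / m) (2 * (2 * 1 / m) / m)) c (d b) (d (d a)) (d (d (d f)))"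
    unfolding test_function_def
    using cb dd[OF ba] dd[OF dd[OF fa]] cont[OF cont[OF cont[OF lip1_continuous[OF f]]]] lip_d[OF b(2)] bd2 bd3
    by (auto simp: le_max_iff_disj)
  moreover have "\<bar>c x - f x\<bar> \<le> \<delta>" for x
    using a(3)[of x] b(3)[of x] c(3)[of x] unfolding m_def by linarith
  ultimately show ?thesis by (rule that)
qed

section \<open>Gaussian mollification\<close>

abbreviation \<gamma> :: "real measure" where "\<gamma> \<equiv> std_normal_distribution"

interpretation std_normal: real_distribution \<gamma> by (rule real_dist_normal_dist)

lemma std_normal_prob_UNIV [simp]: "measure \<gamma> UNIV = 1"
  using std_normal.prob_space by simp

lemma integrable_std_normal_lip1:
  assumes "lip1 f" shows "integrable \<gamma> (\<lambda>y. f (a + b * y))"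
proof (rule integrable_std_normal_poly_growth[of _ "\<bar>f 0\<bar> + \<bar>a\<bar> + \<bar>b\<bar>" 1])
  note [measurable] = lip1_measurable[OF assms]
  show "(\<lambda>y. f (a + b * y)) \<in> borel_measurable borel" by measurable
  fix y
  have "\<bar>f (a + b * y)\<bar> \<le> \<bar>f 0\<bar> + (\<bar>a\<bar> + \<bar>b\<bar> * \<bar>y\<bar>)"
    using lip1_growth[OF assms, of "a + b * y"] abs_triangle_ineq[of a "b * y"] by (simp add: abs_mult)
  also have "\<dots> \<le> (\<bar>f 0\<bar> + \<bar>a\<bar> + \<bar>b\<bar>) * (1 + \<bar>y\<bar>) ^ 1"
    by (simp add: distrib_left distrib_right add_increasing2)
  finally show "\<bar>f (a + b * y)\<bar> \<le> (\<bar>f 0\<bar> + \<bar>a\<bar> + \<bar>b\<bar>) * (1 + \<bar>y\<bar>) ^ 1" .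
qed

definition smoothed :: "real \<Rightarrow> (real \<Rightarrow> real) \<Rightarrow> real \<Rightarrow> real" where
  "smoothed \<epsilon> f x = (\<integral>y. f (x + \<epsilon> * y) \<partial>\<gamma>)"

lemma integrable_abs_std_normal: "integrable \<gamma> (\<lambda>y. \<bar>y\<bar>)"
  by (rule integrable_std_normal_poly_growth[of _ 1 1]) auto

lemma smoothed_error:
  assumes f: "lip1 f" and \<epsilon>: "\<epsilon> \<ge> 0"
  shows "\<bar>smoothed \<epsilon> f x - f x\<bar> \<le> sqrt (2 / pi) * \<epsilon>"
proof -
  have i: "integrable \<gamma> (\<lambda>y. f (x + \<epsilon> * y))" by (rule integrable_std_normal_lip1[OF f])
  have "smoothed \<epsilon> f x - f x = (\<integral>y. f (x + \<epsilon> * y) - f x \<partial>\<gamma>)"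
    using i by (simp add: smoothed_def std_normal.prob_space)
  also have "\<bar>\<dots>\<bar> \<le> (\<integral>y. \<bar>f (x + \<epsilon> * y) - f x\<bar> \<partial>\<gamma>)" by (rule integral_abs_bound)
  also have "\<dots> \<le> (\<integral>y. \<epsilon> * \<bar>y\<bar> \<partial>\<gamma>)"
    using i integrable_abs_std_normal lip1D[OF f, of "x + \<epsilon> * _" x] \<epsilon>
    by (intro integral_mono) (auto simp: abs_mult)
  finally show ?thesis by (simp add: integral_abs_std_normal mult.commute)
qed

lemma smoothed_derivative:
  assumes d: "\<And>x. (f has_real_derivative f' x) (at x)" and c: "continuous_on UNIV f'" and b: "\<And>x. \<bar>f' x\<bar> \<le> K"
    and int: "\<And>x. integrable \<gamma> (\<lambda>y. f (x + \<epsilon> * y))"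
  shows "(smoothed \<epsilon> f has_real_derivative smoothed \<epsilon> f' x) (at x)"
  unfolding smoothed_def[abs_def]
proof (rule has_real_derivative_integral[where w = "\<lambda>_. K"])
  note [measurable] = borel_measurable_continuous_onI[OF c]
  show "(\<lambda>y. f' (t + \<epsilon> * y)) \<in> borel_measurable \<gamma>" for t by simp
  show "((\<lambda>t. f (t + \<epsilon> * y)) has_real_derivative f' (t + \<epsilon> * y)) (at t)" for t y
    using d[of "t + \<epsilon> * y"] by (simp add: DERIV_shift)
qed (use b int in auto)

lemma smoothed_continuous:
  assumes c: "continuous_on UNIV f" and b: "\<And>x. \<bar>f x\<bar> \<le> K"
  shows "continuous_on UNIV (smoothed \<epsilon> f)"
  unfolding continuous_on_sequentially
proof (intro allI ballI impI)
  fix x :: "nat \<Rightarrow> real" and a assume x: "(\<forall>n. x n \<in> UNIV) \<and> x \<longlonglongrightarrow> a"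
  note [measurable] = borel_measurable_continuous_onI[OF c]
  have "(\<lambda>n. \<integral>y. f (x n + \<epsilon> * y) \<partial>\<gamma>) \<longlonglongrightarrow> (\<integral>y. f (a + \<epsilon> * y) \<partial>\<gamma>)"
  proof (rule integral_dominated_convergence[where w = "\<lambda>_. K"])
    show "AE y in \<gamma>. (\<lambda>n. f (x n + \<epsilon> * y)) \<longlonglongrightarrow> f (a + \<epsilon> * y)"
    proof (rule AE_I2)
      fix y
      have "isCont f (a + \<epsilon> * y)" using c by (simp add: continuous_on_eq_continuous_at)
      moreover have "(\<lambda>n. x n + \<epsilon> * y) \<longlonglongrightarrow> a + \<epsilon> * y" using x by (intro tendsto_intros) auto
      ultimately show "(\<lambda>n. f (x n + \<epsilon> * y)) \<longlonglongrightarrow> f (a + \<epsilon> * y)" by (rule isCont_tendsto_compose)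
    qed
  qed (use b in auto)
  then show "(smoothed \<epsilon> f \<circ> x) \<longlonglongrightarrow> smoothed \<epsilon> f a" by (simp add: o_def smoothed_def)
qed

text \<open>Trades one derivative of the function for the factor \<open>y / \<epsilon>\<close> under
  the Gaussian integral.\<close>

lemma smoothed_stein:
  assumes d: "\<And>x. (f has_real_derivative f' x) (at x)" and c: "continuous_on UNIV f'" and b: "\<And>x. \<bar>f x\<bar> \<le> K" "\<And>x. \<bar>f' x\<bar> \<le> K"
    and \<epsilon>: "\<epsilon> > 0"
  shows "smoothed \<epsilon> f' x = (1 / \<epsilon>) * (\<integral>y. y * f (x + \<epsilon> * y) \<partial>\<gamma>)"
proof -
  have K: "K \<ge> 0" using b(1)[of 0] by linarith
  have "(\<integral>y. f' (x + \<epsilon> * y) * \<epsilon> \<partial>\<gamma>) = (\<integral>y. y * f (x + \<epsilon> * y) \<partial>\<gamma>)"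
  proof (rule stein_identity[where K = "K * (1 + \<epsilon>)"])
    fix y
    show "((\<lambda>y. f (x + \<epsilon> * y)) has_real_derivative f' (x + \<epsilon> * y) * \<epsilon>) (at y)"
      by (rule DERIV_chain2[OF d]) (auto intro!: derivative_eq_intros)
    have "K \<le> K * (1 + \<epsilon>) * (1 + \<bar>y\<bar>)" "K * \<epsilon> \<le> K * (1 + \<epsilon>) * (1 + \<bar>y\<bar>)"
      using K \<epsilon> by (simp_all add: distrib_left distrib_right add_increasing add_increasing2)
    moreover have "\<bar>f' (x + \<epsilon> * y) * \<epsilon>\<bar> \<le> K * \<epsilon>"
      using mult_right_mono[OF b(2)[of "x + \<epsilon> * y"], of \<epsilon>] \<epsilon> by (simp add: abs_mult)
    ultimately show "\<bar>f (x + \<epsilon> * y)\<bar> \<le> K * (1 + \<epsilon>) * (1 + \<bar>y\<bar>)" "\<bar>f' (x + \<epsilon> * y) * \<epsilon>\<bar> \<le> K * (1 + \<epsilon>) * (1 + \<bar>y\<bar>)"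
      using b(1)[of "x + \<epsilon> * y"] by linarith+
    show "continuous_on UNIV (\<lambda>y. f' (x + \<epsilon> * y) * \<epsilon>)"
      by (intro continuous_intros continuous_on_compose2[OF c]) auto
  qed
  then show ?thesis using \<epsilon> by (simp add: smoothed_def field_simps)
qed

text \<open>The new bounds do not involve \<open>K\<close>, since all derivatives beyond the first
  are moved onto the Gaussian weight and only the bound 1 on \<open>f1\<close> is spent. One step
  produces the weight y, with mean absolute value sqrt (2 / pi); two steps produce y^2 - 1, whose
  mean absolute value is at most sqrt 2.\<close>

lemma smoothed_test_function:
  assumes f: "test_function K f f1 f2 f3" and \<epsilon>: "\<epsilon> > 0"
  shows "test_function (max (sqrt (2 / pi) / \<epsilon>) (sqrt 2 / \<epsilon>\<^sup>2)) (smoothed \<epsilon> f) (smoothed \<epsilon> f1) (smoothed \<epsilon> f2) (smoothed \<epsilon> f3)"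
    "\<bar>smoothed \<epsilon> f2 x\<bar> \<le> sqrt (2 / pi) / \<epsilon>" "\<bar>smoothed \<epsilon> f3 x\<bar> \<le> sqrt 2 / \<epsilon>\<^sup>2"
proof -
  note D = test_functionD[OF f]
  note [measurable] = D(4-7)[THEN borel_measurable_continuous_onI]
  have K: "K \<ge> 0" using D(9)[of 0] by linarith
  have b1: "\<bar>f1 x\<bar> \<le> max 1 K" "\<bar>f2 x\<bar> \<le> max 1 K" "\<bar>f3 x\<bar> \<le> max 1 K" for x
    using D(8,9,10)[of x] by (auto simp: le_max_iff_disj)
  have s1: "\<bar>smoothed \<epsilon> f1 x\<bar> \<le> 1" for x
  proof -
    have "\<bar>smoothed \<epsilon> f1 x\<bar> \<le> (\<integral>y. \<bar>f1 (x + \<epsilon> * y)\<bar> \<partial>\<gamma>)" unfolding smoothed_def by (rule integral_abs_bound)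
    also have "\<dots> \<le> (\<integral>y. 1 \<partial>\<gamma>)"
      using D(8) by (intro integral_mono std_normal.integrable_const_bound[of _ 1]) auto
    finally show ?thesis by (simp add: std_normal.prob_space)
  qed
  show s2: "\<bar>smoothed \<epsilon> f2 x\<bar> \<le> sqrt (2 / pi) / \<epsilon>" for x
  proof -
    have i: "integrable \<gamma> (\<lambda>y. y * f1 (x + \<epsilon> * y))"
    proof (rule integrable_std_normal_poly_growth[of _ 1 1])
      fix y show "\<bar>y * f1 (x + \<epsilon> * y)\<bar> \<le> 1 * (1 + \<bar>y\<bar>) ^ 1"
        using mult_left_mono[OF D(8)[of "x + \<epsilon> * y"], of "\<bar>y\<bar>"] by (simp add: abs_mult)
    qed simp
    have "\<bar>\<integral>y. y * f1 (x + \<epsilon> * y) \<partial>\<gamma>\<bar> \<le> (\<integral>y. \<bar>y * f1 (x + \<epsilon> * y)\<bar> \<partial>\<gamma>)" by (rule integral_abs_bound)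
    also have "\<dots> \<le> (\<integral>y. \<bar>y\<bar> \<partial>\<gamma>)"
    proof (intro integral_mono integrable_abs_std_normal integrable_abs i)
      fix y show "\<bar>y * f1 (x + \<epsilon> * y)\<bar> \<le> \<bar>y\<bar>" using mult_left_mono[OF D(8)[of "x + \<epsilon> * y"], of "\<bar>y\<bar>"] by (simp add: abs_mult)
    qed
    also have "\<dots> = sqrt (2 / pi)" by (rule integral_abs_std_normal)
    finally show ?thesis
      unfolding smoothed_stein[OF D(2) D(6) b1(1,2) \<epsilon>] using \<epsilon> by (simp add: abs_mult divide_right_mono)
  qed
  show s3: "\<bar>smoothed \<epsilon> f3 x\<bar> \<le> sqrt 2 / \<epsilon>\<^sup>2" for x
  proof -
    let ?g = "\<lambda>y. f1 (x + \<epsilon> * y)"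
    let ?L = "max 1 K * (1 + \<epsilon>)"
    have d: "((\<lambda>y. y * ?g y) has_real_derivative ?g y + y * (f2 (x + \<epsilon> * y) * \<epsilon>)) (at y)" for y
    proof -
      have "(?g has_real_derivative f2 (x + \<epsilon> * y) * \<epsilon>) (at y)"
        by (rule DERIV_chain2[OF D(2)]) (auto intro!: derivative_eq_intros)
      from DERIV_mult[OF DERIV_ident this] show ?thesis by (simp add: mult.commute)
    qed
    have g2: "\<bar>y * (f2 (x + \<epsilon> * y) * \<epsilon>)\<bar> \<le> max 1 K * \<epsilon> * \<bar>y\<bar>" for y
      using mult_right_mono[OF b1(2)[of "x + \<epsilon> * y"], of "\<epsilon> * \<bar>y\<bar>"] \<epsilon> by (simp add: abs_mult mult_ac)
    have g1: "\<bar>y * ?g y\<bar> \<le> \<bar>y\<bar>" for y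
      using mult_left_mono[OF D(8)[of "x + \<epsilon> * y"], of "\<bar>y\<bar>"] by (simp add: abs_mult)
    have M: "1 \<le> max 1 K" by simp
    \<comment> \<open>Stein's identity for y g(y) is the second integration by parts; moving the g
      term to the other side leaves the second Hermite polynomial as weight.\<close>
    have e1: "(\<integral>y. ?g y + y * (f2 (x + \<epsilon> * y) * \<epsilon>) \<partial>\<gamma>) = (\<integral>y. y * (y * ?g y) \<partial>\<gamma>)"
    proof (rule stein_identity[OF d, where K = ?L])
      show "continuous_on UNIV (\<lambda>y. ?g y + y * (f2 (x + \<epsilon> * y) * \<epsilon>))"
        by (intro continuous_intros continuous_on_compose2[OF D(5)] continuous_on_compose2[OF D(6)]) auto
      fix y
      have "\<bar>y\<bar> \<le> max 1 K * \<bar>y\<bar>" using M by (simp add: mult_le_cancel_right1)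
      moreover have "0 \<le> max 1 K * \<epsilon>" "0 \<le> max 1 K * (\<epsilon> * \<bar>y\<bar>)" using \<epsilon> by (auto intro!: mult_nonneg_nonneg)
      moreover have "?L * (1 + \<bar>y\<bar>) = max 1 K + max 1 K * \<epsilon> + max 1 K * \<bar>y\<bar> + max 1 K * (\<epsilon> * \<bar>y\<bar>)" by (simp add: algebra_simps)
      ultimately show "\<bar>y * ?g y\<bar> \<le> ?L * (1 + \<bar>y\<bar>)" "\<bar>?g y + y * (f2 (x + \<epsilon> * y) * \<epsilon>)\<bar> \<le> ?L * (1 + \<bar>y\<bar>)"
        using g1[of y] g2[of y] D(8)[of "x + \<epsilon> * y"] M unfolding mult.assoc by linarith+
    qed
    have ig: "integrable \<gamma> ?g" using D(8) by (intro std_normal.integrable_const_bound[of _ 1]) auto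
    have i2: "integrable \<gamma> (\<lambda>y. y * (f2 (x + \<epsilon> * y) * \<epsilon>))"
    proof (rule integrable_std_normal_poly_growth[of _ "max 1 K * \<epsilon>" 1])
      fix y show "\<bar>y * (f2 (x + \<epsilon> * y) * \<epsilon>)\<bar> \<le> max 1 K * \<epsilon> * (1 + \<bar>y\<bar>) ^ 1"
        using g2[of y] \<epsilon> by (simp add: distrib_left add_increasing)
    qed simp
    have i3: "integrable \<gamma> (\<lambda>y. y * (y * ?g y))"
    proof (rule integrable_std_normal_poly_growth[of _ 1 2])
      fix y
      have "\<bar>y\<bar> * \<bar>y * ?g y\<bar> \<le> (1 + \<bar>y\<bar>) * (1 + \<bar>y\<bar>)" using g1[of y] by (intro mult_mono) auto
      then show "\<bar>y * (y * ?g y)\<bar> \<le> 1 * (1 + \<bar>y\<bar>)\<^sup>2" by (simp add: abs_mult[of y] power2_eq_square)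
    qed simp
    have e2: "(\<integral>y. y * f2 (x + \<epsilon> * y) \<partial>\<gamma>) * \<epsilon> = (\<integral>y. (y\<^sup>2 - 1) * ?g y \<partial>\<gamma>)"
    proof -
      have "(\<integral>y. y * f2 (x + \<epsilon> * y) \<partial>\<gamma>) * \<epsilon> = (\<integral>y. y * (f2 (x + \<epsilon> * y) * \<epsilon>) \<partial>\<gamma>)"
        by (simp flip: mult.assoc)
      also have "\<dots> = (\<integral>y. y * (y * ?g y) \<partial>\<gamma>) - (\<integral>y. ?g y \<partial>\<gamma>)" using e1 ig i2 by simp
      also have "\<dots> = (\<integral>y. (y\<^sup>2 - 1) * ?g y \<partial>\<gamma>)"
        using ig i3 by (simp add: power2_eq_square algebra_simps flip: Bochner_Integration.integral_diff)
      finally show ?thesis .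
    qed
    have iq: "integrable \<gamma> (\<lambda>y. (y\<^sup>2 - 1)\<^sup>2)"
    proof (rule integrable_std_normal_poly_growth[of _ 1 4])
      fix y :: real
      have "(y\<^sup>2 - 1)\<^sup>2 \<le> ((1 + \<bar>y\<bar>)\<^sup>2)\<^sup>2"
        by (rule power2_le_iff_abs_le[THEN iffD2]) (auto simp: power2_eq_square abs_le_iff algebra_simps)
      then show "\<bar>(y\<^sup>2 - 1)\<^sup>2\<bar> \<le> 1 * (1 + \<bar>y\<bar>) ^ 4" by (simp flip: power_mult)
    qed simp
    have ia: "integrable \<gamma> (\<lambda>y. \<bar>y\<^sup>2 - 1\<bar>)"
    proof (rule integrable_std_normal_poly_growth[of _ 1 2])
      fix y :: real show "\<bar>\<bar>y\<^sup>2 - 1\<bar>\<bar> \<le> 1 * (1 + \<bar>y\<bar>)\<^sup>2"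
        by (auto simp: power2_eq_square abs_le_iff algebra_simps)
    qed simp
    \<comment> \<open>The Cauchy-Schwarz inequality, obtained from the nonnegativity of a
      variance.\<close>
    have cs: "(\<integral>y. \<bar>y\<^sup>2 - 1\<bar> \<partial>\<gamma>) \<le> sqrt 2"
    proof (rule real_le_rsqrt)
      have "0 \<le> (\<integral>y. (\<bar>y\<^sup>2 - 1\<bar> - (\<integral>y. \<bar>y\<^sup>2 - 1\<bar> \<partial>\<gamma>))\<^sup>2 \<partial>\<gamma>)" by simp
      also have "\<dots> = (\<integral>y. (y\<^sup>2 - 1)\<^sup>2 \<partial>\<gamma>) - (\<integral>y. \<bar>y\<^sup>2 - 1\<bar> \<partial>\<gamma>)\<^sup>2"
        using std_normal.variance_eq[of "\<lambda>y. \<bar>y\<^sup>2 - 1\<bar>"] ia iq by simp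
      finally show "(\<integral>y. \<bar>y\<^sup>2 - 1\<bar> \<partial>\<gamma>)\<^sup>2 \<le> 2" by (simp add: integral_square_minus_1_square_std_normal)
    qed
    have i4: "integrable \<gamma> (\<lambda>y. (y\<^sup>2 - 1) * ?g y)"
      using i3 ig by (simp add: left_diff_distrib power2_eq_square mult.assoc)
    have "\<bar>\<integral>y. (y\<^sup>2 - 1) * ?g y \<partial>\<gamma>\<bar> \<le> (\<integral>y. \<bar>(y\<^sup>2 - 1) * ?g y\<bar> \<partial>\<gamma>)" by (rule integral_abs_bound)
    also have "\<dots> \<le> (\<integral>y. \<bar>y\<^sup>2 - 1\<bar> \<partial>\<gamma>)"
    proof (intro integral_mono ia integrable_abs i4)
      fix y show "\<bar>(y\<^sup>2 - 1) * ?g y\<bar> \<le> \<bar>y\<^sup>2 - 1\<bar>"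
        using mult_left_mono[OF D(8)[of "x + \<epsilon> * y"], of "\<bar>y\<^sup>2 - 1\<bar>"] by (simp add: abs_mult)
    qed
    also note cs
    finally have B: "\<bar>\<integral>y. (y\<^sup>2 - 1) * ?g y \<partial>\<gamma>\<bar> \<le> sqrt 2" .
    have "smoothed \<epsilon> f3 x = (1 / \<epsilon>\<^sup>2) * (\<integral>y. (y\<^sup>2 - 1) * ?g y \<partial>\<gamma>)"
      unfolding smoothed_stein[OF D(3) D(7) b1(2,3) \<epsilon>] e2[symmetric] using \<epsilon> by (simp add: power2_eq_square)
    then show ?thesis using B \<epsilon> by (simp add: abs_mult divide_right_mono)
  qed
  have ii: "integrable \<gamma> (\<lambda>y. g (x + \<epsilon> * y))" if "\<And>x. \<bar>g x\<bar> \<le> max 1 K" "continuous_on UNIV g" for g x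
    using that borel_measurable_continuous_onI[OF that(2)] by (intro std_normal.integrable_const_bound[of _ "max 1 K"]) auto
  show "test_function (max (sqrt (2 / pi) / \<epsilon>) (sqrt 2 / \<epsilon>\<^sup>2)) (smoothed \<epsilon> f) (smoothed \<epsilon> f1) (smoothed \<epsilon> f2) (smoothed \<epsilon> f3)"
    unfolding test_function_def
  proof (intro conjI allI)
    show "(smoothed \<epsilon> f has_real_derivative smoothed \<epsilon> f1 x) (at x)" for x
      by (rule smoothed_derivative[OF D(1) D(5) D(8) integrable_std_normal_lip1[OF D(11)]])
    show "(smoothed \<epsilon> f1 has_real_derivative smoothed \<epsilon> f2 x) (at x)" for x
      by (rule smoothed_derivative[OF D(2) D(6) D(9) ii[OF b1(1) D(5)]])
    show "(smoothed \<epsilon> f2 has_real_derivative smoothed \<epsilon> f3 x) (at x)" for x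
      by (rule smoothed_derivative[OF D(3) D(7) D(10) ii[OF b1(2) D(6)]])
    show "continuous_on UNIV (smoothed \<epsilon> f3)" by (rule smoothed_continuous[OF D(7) D(10)])
  qed (use s1 s2 s3 in \<open>auto simp: le_max_iff_disj\<close>)
qed

text \<open>The sum of independent centred normal variables with standard deviations
  \<open>\<bar>a\<bar>\<close> and \<open>\<bar>b\<bar>\<close> is normal again. With a = S and b =
  \<epsilon>, mollifying the test function at S \<eta> amounts to replacing |S| by sqrt (S^2 +
  \<epsilon>^2).\<close>

lemma gaussian_convolution:
  assumes f: "lip1 f"
  shows "(\<integral>x. smoothed b f (a * x) \<partial>\<gamma>) = (\<integral>x. f (sqrt (a\<^sup>2 + b\<^sup>2) * x) \<partial>\<gamma>)"
proof -
  interpret P: pair_prob_space \<gamma> \<gamma> ..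
  note [measurable] = lip1_measurable[OF f]
  let ?g = "\<lambda>p :: real \<times> real. a * fst p + b * snd p"
  have "distr (\<gamma> \<Otimes>\<^sub>M \<gamma>) borel ?g = distr \<gamma> borel (\<lambda>x. sqrt (a\<^sup>2 + b\<^sup>2) * x)"
  proof (rule Levy_uniqueness)
    show "real_distribution (distr (\<gamma> \<Otimes>\<^sub>M \<gamma>) borel ?g)" by (rule P.real_distribution_distr) simp
    show "real_distribution (distr \<gamma> borel (\<lambda>x. sqrt (a\<^sup>2 + b\<^sup>2) * x))" by (rule std_normal.real_distribution_distr) simp
    show "char (distr (\<gamma> \<Otimes>\<^sub>M \<gamma>) borel ?g) = char (distr \<gamma> borel (\<lambda>x. sqrt (a\<^sup>2 + b\<^sup>2) * x))"
    proof
      fix t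
      have "char (distr (\<gamma> \<Otimes>\<^sub>M \<gamma>) borel ?g) t = (\<integral>p. iexp (t * (a * fst p + b * snd p)) \<partial>(\<gamma> \<Otimes>\<^sub>M \<gamma>))"
        unfolding char_def by (subst integral_distr) auto
      also have "\<dots> = (\<integral>p. (\<lambda>(x, y). iexp ((t * a) * x) * iexp ((t * b) * y)) p \<partial>(\<gamma> \<Otimes>\<^sub>M \<gamma>))"
        by (intro Bochner_Integration.integral_cong) (auto simp: algebra_simps exp_add[symmetric])
      also have "\<dots> = (\<integral>x. (\<integral>y. iexp ((t * a) * x) * iexp ((t * b) * y) \<partial>\<gamma>) \<partial>\<gamma>)"
        by (rule P.integral_fst[symmetric], rule P.integrable_const_bound[of _ 1]) (auto simp: norm_mult)
      also have "\<dots> = char \<gamma> (t * a) * char \<gamma> (t * b)"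
        by (simp add: char_def)
      also have "\<dots> = complex_of_real (exp (- (t * a)\<^sup>2 / 2) * exp (- (t * b)\<^sup>2 / 2))"
        by (simp add: char_std_normal_distribution)
      also have "\<dots> = complex_of_real (exp (- (t * sqrt (a\<^sup>2 + b\<^sup>2))\<^sup>2 / 2))"
        by (simp add: exp_add[symmetric] power_mult_distrib field_simps)
      also have "\<dots> = char \<gamma> (t * sqrt (a\<^sup>2 + b\<^sup>2))" by (simp add: char_std_normal_distribution)
      also have "\<dots> = char (distr \<gamma> borel (\<lambda>x. sqrt (a\<^sup>2 + b\<^sup>2) * x)) t"
        unfolding char_def by (subst integral_distr) (auto simp: mult_ac)
      finally show "char (distr (\<gamma> \<Otimes>\<^sub>M \<gamma>) borel ?g) t = char (distr \<gamma> borel (\<lambda>x. sqrt (a\<^sup>2 + b\<^sup>2) * x)) t" .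
    qed
  qed
  then have "(\<integral>z. f z \<partial>distr (\<gamma> \<Otimes>\<^sub>M \<gamma>) borel ?g) = (\<integral>z. f z \<partial>distr \<gamma> borel (\<lambda>x. sqrt (a\<^sup>2 + b\<^sup>2) * x))" by simp
  then have e: "(\<integral>p. f (a * fst p + b * snd p) \<partial>(\<gamma> \<Otimes>\<^sub>M \<gamma>)) = (\<integral>x. f (sqrt (a\<^sup>2 + b\<^sup>2) * x) \<partial>\<gamma>)"
    by (subst (asm) (1 2) integral_distr) auto
  have "integrable \<gamma> (\<lambda>x. \<integral>y. \<bar>f (a * x + b * y)\<bar> \<partial>\<gamma>)"
    proof (rule integrable_std_normal_poly_growth[of _ "\<bar>f 0\<bar> + \<bar>a\<bar> + \<bar>b\<bar> * sqrt (2 / pi)" 1])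
      show "(\<lambda>x. \<integral>y. \<bar>f (a * x + b * y)\<bar> \<partial>\<gamma>) \<in> borel_measurable borel" by measurable
      fix x
      have "(\<integral>y. \<bar>f (a * x + b * y)\<bar> \<partial>\<gamma>) \<le> (\<integral>y. (\<bar>f 0\<bar> + \<bar>a\<bar> * \<bar>x\<bar>) + \<bar>b\<bar> * \<bar>y\<bar> \<partial>\<gamma>)"
      proof (rule integral_mono)
        show "integrable \<gamma> (\<lambda>y. \<bar>f (a * x + b * y)\<bar>)" using integrable_std_normal_lip1[OF f, of "a * x" b] by simp
        show "integrable \<gamma> (\<lambda>y. (\<bar>f 0\<bar> + \<bar>a\<bar> * \<bar>x\<bar>) + \<bar>b\<bar> * \<bar>y\<bar>)" using integrable_abs_std_normal by simp
        fix y show "\<bar>f (a * x + b * y)\<bar> \<le> (\<bar>f 0\<bar> + \<bar>a\<bar> * \<bar>x\<bar>) + \<bar>b\<bar> * \<bar>y\<bar>"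
          using lip1_growth[OF f, of "a * x + b * y"] abs_triangle_ineq[of "a * x" "b * y"] by (simp add: abs_mult)
      qed
      also have "\<dots> = \<bar>f 0\<bar> + \<bar>a\<bar> * \<bar>x\<bar> + \<bar>b\<bar> * sqrt (2 / pi)"
        using integrable_abs_std_normal by (simp add: integral_abs_std_normal std_normal.prob_space)
      also have "\<dots> \<le> (\<bar>f 0\<bar> + \<bar>a\<bar> + \<bar>b\<bar> * sqrt (2 / pi)) * (1 + \<bar>x\<bar>) ^ 1"
        by (simp add: distrib_left distrib_right add_increasing2)
      finally show "\<bar>\<integral>y. \<bar>f (a * x + b * y)\<bar> \<partial>\<gamma>\<bar> \<le> (\<bar>f 0\<bar> + \<bar>a\<bar> + \<bar>b\<bar> * sqrt (2 / pi)) * (1 + \<bar>x\<bar>) ^ 1" by simp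
    qed
  then have "integrable (\<gamma> \<Otimes>\<^sub>M \<gamma>) (\<lambda>(x, y). f (a * x + b * y))"
    using integrable_std_normal_lip1[OF f] by (intro P.Fubini_integrable) simp_all
  from P.integral_fst[OF this] show ?thesis using e by (simp add: smoothed_def split_beta')
qed

section \<open>The interpolation\<close>

lemma integrable_const_std_normal: "integrable \<gamma> (\<lambda>_. c :: real)"
  by (rule integrable_std_normal_poly_growth[of _ "\<bar>c\<bar>" 0]) auto

lemma malliavin_graph_measurable:
  assumes "(G, Z) \<in> malliavin_graph M X p" shows "G \<in> borel_measurable M" "Z \<in> borel_measurable M"
  using assms unfolding malliavin_graph_def mem_Collect_eq prod.case by blast+

lemma (in prob_space) integrable_product_std_normal:
  fixes A :: "'a \<Rightarrow> real"
  assumes A: "integrable M A" and B: "integrable \<gamma> B"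
  shows "integrable (M \<Otimes>\<^sub>M \<gamma>) (\<lambda>p. A (fst p) * B (snd p))"
proof -
  interpret G: real_distribution \<gamma> by (rule real_dist_normal_dist)
  interpret P: pair_prob_space M \<gamma> ..
  have [measurable]: "A \<in> borel_measurable M" "B \<in> borel_measurable borel"
    using borel_measurable_integrable[OF A] borel_measurable_integrable[OF B] by auto
  have 1: "integrable M (\<lambda>x. \<integral>y. norm (A x * B y) \<partial>\<gamma>)" using A by (simp add: abs_mult)
  have 2: "integrable \<gamma> (\<lambda>y. A x * B y)" for x using B by simp
  show ?thesis
    by (rule P.Fubini_integrable) (use 1 2 in simp_all)
qed

lemma (in prob_space) integral_product_std_normal:
  fixes f :: "'a \<Rightarrow> real \<Rightarrow> real"
  assumes f: "integrable (M \<Otimes>\<^sub>M \<gamma>) (\<lambda>p. f (fst p) (snd p))"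
  shows "(\<integral>p. f (fst p) (snd p) \<partial>(M \<Otimes>\<^sub>M \<gamma>)) = (\<integral>\<omega>. (\<integral>x. f \<omega> x \<partial>\<gamma>) \<partial>M)"
    and "(\<integral>p. f (fst p) (snd p) \<partial>(M \<Otimes>\<^sub>M \<gamma>)) = (\<integral>x. (\<integral>\<omega>. f \<omega> x \<partial>M) \<partial>\<gamma>)"
proof -
  interpret G: real_distribution \<gamma> by (rule real_dist_normal_dist)
  interpret P: pair_prob_space M \<gamma> ..
  have f': "integrable (M \<Otimes>\<^sub>M \<gamma>) (\<lambda>(x, y). f x y)" using f by (simp add: split_beta')
  show "(\<integral>p. f (fst p) (snd p) \<partial>(M \<Otimes>\<^sub>M \<gamma>)) = (\<integral>\<omega>. (\<integral>x. f \<omega> x \<partial>\<gamma>) \<partial>M)"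
    using P.integral_fst[OF f'] by (simp add: split_beta')
  show "(\<integral>p. f (fst p) (snd p) \<partial>(M \<Otimes>\<^sub>M \<gamma>)) = (\<integral>x. (\<integral>\<omega>. f \<omega> x \<partial>M) \<partial>\<gamma>)"
    using P.integral_snd[OF f'] by (simp add: split_beta')
qed

lemma abs_powr_2: "\<bar>x\<bar> powr 2 = x\<^sup>2" and abs_powr_4: "\<bar>x\<bar> powr 4 = x ^ 4" for x :: real
  using powr_2_norm[of x] powr_4_norm[of x] by simp_all

text \<open>Works with explicit versions \<open>DF\<close> and \<open>DS\<close> of the derivatives;
  \<open>stein_term_eq\<close> relates them to \<open>malliavin_D\<close>.\<close>

locale stein_setup = divergence_setup M X u F
  for M :: "'w measure" and X :: "'h::{real_inner, banach, second_countable_topology} \<Rightarrow> 'w \<Rightarrow> real"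
    and u :: "'w \<Rightarrow> 'h" and F :: "'w \<Rightarrow> real" +
  fixes S :: "'w \<Rightarrow> real" and DF DS :: "'w \<Rightarrow> 'h"
  assumes F_graph: "(F, DF) \<in> malliavin_graph M X 2" and S_graph: "(S, DS) \<in> malliavin_graph M X 4"
begin

lemma S_graph2: "(S, DS) \<in> malliavin_graph M X 2"
  by (rule malliavin_graph_mono[OF _ _ S_graph]) auto

lemma measurable_S [measurable]: "S \<in> borel_measurable M" "DS \<in> borel_measurable M" "DF \<in> borel_measurable M"
  using malliavin_graph_measurable[OF F_graph] malliavin_graph_measurable[OF S_graph] by blast+

definition V1 :: "'w \<Rightarrow> real" where "V1 \<omega> = DF \<omega> \<bullet> u \<omega>"
definition V2 :: "'w \<Rightarrow> real" where "V2 \<omega> = DS \<omega> \<bullet> u \<omega>"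

lemma measurable_V [measurable]: "V1 \<in> borel_measurable M" "V2 \<in> borel_measurable M"
  unfolding V1_def[abs_def] V2_def[abs_def] by measurable

lemma integrable_inner_graph:
  assumes "(G, Z) \<in> malliavin_graph M X 2" shows "integrable M (\<lambda>\<omega>. Z \<omega> \<bullet> u \<omega>)"
  using malliavin_graph_powr_integrable(2)[OF _ assms] malliavin_graph_measurable[OF assms] u_square
  by (intro integrable_inner_square) (simp_all add: powr_2_norm)

lemma integrable_V1: "integrable M V1" and integrable_V2: "integrable M V2"
  unfolding V1_def[abs_def] V2_def[abs_def]
  using integrable_inner_graph[OF F_graph] integrable_inner_graph[OF S_graph2] by blast+

lemma integrable_S2: "integrable M (\<lambda>\<omega>. (S \<omega>)\<^sup>2)"
  using malliavin_graph_powr_integrable(1)[OF _ S_graph2] by (simp add: abs_powr_2)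

lemma integrable_S: "integrable M S"
  by (rule integrable_if_square[OF measurable_S(1) integrable_S2])

text \<open>The product of \<open>S\<close>, \<open>DS\<close> and \<open>u\<close> is integrable
  because the first two have fourth moments and the last a second moment; this is the reason for
  exponent 4 on \<open>S\<close>. The inequality of arithmetic and geometric means is used
  twice.\<close>

lemma integrable_SV2: "integrable M (\<lambda>\<omega>. S \<omega> * V2 \<omega>)"
proof (rule Bochner_Integration.integrable_bound)
  have "integrable M (\<lambda>\<omega>. (S \<omega>) ^ 4)" "integrable M (\<lambda>\<omega>. norm (DS \<omega>) ^ 4)"
    using malliavin_graph_powr_integrable[OF _ S_graph] by (simp_all add: abs_powr_4 powr_4_norm)
  then show "integrable M (\<lambda>\<omega>. (S \<omega>) ^ 4 + norm (DS \<omega>) ^ 4 + (norm (u \<omega>))\<^sup>2)"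
    using u_square by simp
  have ineq: "\<bar>s * v\<bar> \<le> s ^ 4 + d ^ 4 + w\<^sup>2" if "\<bar>v\<bar> \<le> d * w" "d \<ge> 0" "w \<ge> 0" for s v d w :: real
  proof -
    have "\<bar>s * v\<bar> \<le> \<bar>s\<bar> * (d * w)" unfolding abs_mult using that by (intro mult_left_mono) auto
    also have "\<dots> = (\<bar>s\<bar> * d) * w" by simp
    finally have 1: "\<bar>s * v\<bar> \<le> (\<bar>s\<bar> * d) * w" .
    have 2: "2 * ((\<bar>s\<bar> * d) * w) \<le> s\<^sup>2 * d\<^sup>2 + w\<^sup>2"
      using sum_squares_bound[of "\<bar>s\<bar> * d" w] by (simp only: mult.assoc power_mult_distrib power2_abs)
    have 3: "2 * (s\<^sup>2 * d\<^sup>2) \<le> s ^ 4 + d ^ 4" using sum_squares_bound[of "s\<^sup>2" "d\<^sup>2"] by (simp flip: power_mult)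
    have 4: "0 \<le> w\<^sup>2" "0 \<le> s ^ 4" "0 \<le> d ^ 4" "0 \<le> (\<bar>s\<bar> * d) * w" "0 \<le> s\<^sup>2 * d\<^sup>2" using that by auto
    show ?thesis using 1 2 3 4 by linarith
  qed
  show "AE \<omega> in M. norm (S \<omega> * V2 \<omega>) \<le> norm ((S \<omega>) ^ 4 + norm (DS \<omega>) ^ 4 + (norm (u \<omega>))\<^sup>2)"
  proof (rule AE_I2)
    fix \<omega>
    have "\<bar>S \<omega> * V2 \<omega>\<bar> \<le> (S \<omega>) ^ 4 + norm (DS \<omega>) ^ 4 + (norm (u \<omega>))\<^sup>2"
      unfolding V2_def by (rule ineq[OF Cauchy_Schwarz_ineq2]) auto
    then show "norm (S \<omega> * V2 \<omega>) \<le> norm ((S \<omega>) ^ 4 + norm (DS \<omega>) ^ 4 + (norm (u \<omega>))\<^sup>2)"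
      unfolding real_norm_def by (rule order_trans[OF _ abs_ge_self])
  qed
qed simp

abbreviation N :: "('w \<times> real) measure" where "N \<equiv> M \<Otimes>\<^sub>M \<gamma>"

lemma integrable_fst: "integrable M A \<Longrightarrow> integrable N (\<lambda>p. A (fst p))" for A :: "'w \<Rightarrow> real"
  using integrable_product_std_normal[of A "\<lambda>_. 1"] integrable_const_std_normal by simp

lemma integrable_fst_snd: "integrable M A \<Longrightarrow> integrable N (\<lambda>p. A (fst p) * snd p)"
  by (rule integrable_product_std_normal, assumption, rule integrable_std_normal_poly_growth[of _ 1 1]) simp_all

text \<open>The path \<open>sin t F + cos t S x\<close> replaces the usual one with square roots of \<open>t\<close>, whose derivative is
  singular at the end points.\<close>

lemma interpolation:
  assumes f: "test_function K f f1 f2 f3" and b2: "\<And>x. \<bar>f2 x\<bar> \<le> K2" and b3: "\<And>x. \<bar>f3 x\<bar> \<le> K3"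
  shows "\<bar>(\<integral>\<omega>. f (F \<omega>) \<partial>M) - (\<integral>\<omega>. (\<integral>x. f (S \<omega> * x) \<partial>\<gamma>) \<partial>M)\<bar> \<le>
    K2 / 2 * (\<integral>\<omega>. \<bar>V1 \<omega> - (S \<omega>)\<^sup>2\<bar> \<partial>M) + 2 / 3 * K3 * (\<integral>\<omega>. \<bar>S \<omega> * V2 \<omega>\<bar> \<partial>M)"
proof -
  interpret G: real_distribution \<gamma> by (rule real_dist_normal_dist)
  interpret P: pair_prob_space M \<gamma> ..
  note D = test_functionD[OF f]
  note [measurable] = D(4-7)[THEN borel_measurable_continuous_onI]
  have K2: "K2 \<ge> 0" and K3: "K3 \<ge> 0" using b2[of 0] b3[of 0] by linarith+
  define L where "L t p = sin t * F (fst p) + cos t * S (fst p) * snd p" for t and p :: "'w \<times> real"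
  have [measurable]: "L t \<in> borel_measurable N" for t unfolding L_def[abs_def] by measurable
  define E1 where "E1 = (\<integral>\<omega>. \<bar>V1 \<omega> - (S \<omega>)\<^sup>2\<bar> \<partial>M)"
  define E2 where "E2 = (\<integral>\<omega>. \<bar>S \<omega> * V2 \<omega>\<bar> \<partial>M)"
  define w where "w p = \<bar>F (fst p)\<bar> + \<bar>S (fst p) * snd p\<bar>" for p :: "'w \<times> real"
  have iw: "integrable N w" unfolding w_def[abs_def]
    using integrable_fst[OF integrable_F] integrable_fst_snd[OF integrable_S] by (intro Bochner_Integration.integrable_add integrable_abs)
  have Lw: "\<bar>L t p\<bar> \<le> w p" for t p
  proof -
    have "\<bar>sin t * F (fst p)\<bar> \<le> 1 * \<bar>F (fst p)\<bar>" "\<bar>cos t * (S (fst p) * snd p)\<bar> \<le> 1 * \<bar>S (fst p) * snd p\<bar>"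
      by (subst abs_mult, intro mult_right_mono; simp)+
    then show ?thesis unfolding L_def w_def mult.assoc by linarith
  qed
  define g where "g t = (\<integral>p. f (L t p) \<partial>N)" for t
  define g' where "g' t = (\<integral>p. f1 (L t p) * (cos t * F (fst p) - sin t * S (fst p) * snd p) \<partial>N)" for t
  have if0: "integrable N (\<lambda>p. f (L t p))" for t
  proof (rule Bochner_Integration.integrable_bound)
    show "integrable N (\<lambda>p. \<bar>f 0\<bar> + w p)" by (intro Bochner_Integration.integrable_add P.integrable_const iw)
    show "AE p in N. norm (f (L t p)) \<le> norm (\<bar>f 0\<bar> + w p)"
    proof (rule AE_I2)
      fix p
      have "\<bar>f (L t p)\<bar> \<le> \<bar>f 0\<bar> + w p" using lip1_growth[OF D(11), of "L t p"] Lw[of t p] by linarith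
      then show "norm (f (L t p)) \<le> norm (\<bar>f 0\<bar> + w p)" unfolding real_norm_def by (rule order_trans[OF _ abs_ge_self])
    qed
  qed measurable
  have dg: "(g has_real_derivative g' t) (at t)" for t
    unfolding g_def[abs_def] g'_def
  proof (rule has_real_derivative_integral[OF if0 _ _ iw])
    show "((\<lambda>t. f (L t p)) has_real_derivative f1 (L t p) * (cos t * F (fst p) - sin t * S (fst p) * snd p)) (at t)" for t p
      unfolding L_def by (rule DERIV_chain2[OF D(1)]) (auto intro!: derivative_eq_intros)
    show "(\<lambda>p. f1 (L t p) * (cos t * F (fst p) - sin t * S (fst p) * snd p)) \<in> borel_measurable N" for t by measurable
    fix t p
    have "\<bar>cos t * F (fst p)\<bar> \<le> 1 * \<bar>F (fst p)\<bar>" "\<bar>sin t * (S (fst p) * snd p)\<bar> \<le> 1 * \<bar>S (fst p) * snd p\<bar>"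
      by (subst abs_mult, intro mult_right_mono; simp)+
    then have "\<bar>cos t * F (fst p) - sin t * S (fst p) * snd p\<bar> \<le> w p" unfolding w_def mult.assoc by linarith
    then have "\<bar>f1 (L t p)\<bar> * \<bar>cos t * F (fst p) - sin t * S (fst p) * snd p\<bar> \<le> 1 * w p"
      using D(8) by (intro mult_mono) auto
    then show "\<bar>f1 (L t p) * (cos t * F (fst p) - sin t * S (fst p) * snd p)\<bar> \<le> w p" by (simp add: abs_mult)
  qed
  have bm: "integrable N (\<lambda>p. h (L t p) * A p)" if "integrable N A" "\<And>x. \<bar>h x\<bar> \<le> B" "h \<in> borel_measurable borel"
    for h :: "real \<Rightarrow> real" and A :: "'w \<times> real \<Rightarrow> real" and B t
  proof (rule integrable_bounded_mult[OF that(1), where K = B])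
    note [measurable] = that(3)
    show "(\<lambda>p. h (L t p)) \<in> borel_measurable N" by measurable
  qed (rule that(2))
  \<comment> \<open>Integration by parts in the Gaussian variable: for fixed \<omega> the path is
    affine in it with slope \<open>cos t * S \<omega>\<close>, whose two factors account for the
    right-hand side. No division by the slope occurs, so \<open>S \<omega>\<close> may
    vanish.\<close>
  have stein: "(\<integral>p. h (L t p) * (Y (fst p) * snd p) \<partial>N) = cos t * (\<integral>p. h' (L t p) * (S (fst p) * Y (fst p)) \<partial>N)"
    if Y: "integrable M Y" "integrable M (\<lambda>\<omega>. S \<omega> * Y \<omega>)" and h: "\<And>x. (h has_real_derivative h' x) (at x)" "\<And>x. \<bar>h x\<bar> \<le> B" "\<And>x. \<bar>h' x\<bar> \<le> B'"
      and c: "continuous_on UNIV h" "continuous_on UNIV h'" for h h' Y B B' t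
  proof -
    have [measurable]: "h \<in> borel_measurable borel" "h' \<in> borel_measurable borel" using c by (auto intro: borel_measurable_continuous_onI)
    have i1: "integrable N (\<lambda>p. h (L t p) * (Y (fst p) * snd p))" by (rule bm[OF integrable_fst_snd[OF Y(1)] h(2)]) simp
    have i2: "integrable N (\<lambda>p. h' (L t p) * (S (fst p) * Y (fst p)))" by (rule bm[OF integrable_fst[OF Y(2)] h(3)]) simp
    have B0: "B \<ge> 0" "B' \<ge> 0" using h(2)[of 0] h(3)[of 0] by linarith+
    have st: "(\<integral>x. h (sin t * F \<omega> + cos t * S \<omega> * x) * (Y \<omega> * x) \<partial>\<gamma>) = cos t * (\<integral>x. h' (sin t * F \<omega> + cos t * S \<omega> * x) * (S \<omega> * Y \<omega>) \<partial>\<gamma>)" for \<omega>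
    proof -
      let ?a = "sin t * F \<omega>" and ?b = "cos t * S \<omega>"
      have "(\<integral>x. h' (?a + ?b * x) * ?b \<partial>\<gamma>) = (\<integral>x. x * h (?a + ?b * x) \<partial>\<gamma>)"
      proof (rule stein_identity[where K = "B + B' * \<bar>?b\<bar>"])
        fix x
        show "((\<lambda>x. h (?a + ?b * x)) has_real_derivative h' (?a + ?b * x) * ?b) (at x)"
          by (rule DERIV_chain2[OF h(1)]) (auto intro!: derivative_eq_intros)
        have nn: "0 \<le> B' * \<bar>?b\<bar>" using B0 by simp
        have le: "z \<le> (B + B' * \<bar>?b\<bar>) * (1 + \<bar>x\<bar>)" if "z \<le> B + B' * \<bar>?b\<bar>" for z
        proof -
          have "0 \<le> (B + B' * \<bar>?b\<bar>) * \<bar>x\<bar>" using B0 nn by (intro mult_nonneg_nonneg add_nonneg_nonneg) auto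
          then show ?thesis using that by (simp add: distrib_left)
        qed
        show "\<bar>h (?a + ?b * x)\<bar> \<le> (B + B' * \<bar>?b\<bar>) * (1 + \<bar>x\<bar>)"
          using h(2)[of "?a + ?b * x"] nn by (intro le) linarith
        have "\<bar>h' (?a + ?b * x) * ?b\<bar> \<le> B' * \<bar>?b\<bar>"
          unfolding abs_mult[of "h' (?a + ?b * x)"] by (intro mult_right_mono h(3)) simp
        then show "\<bar>h' (?a + ?b * x) * ?b\<bar> \<le> (B + B' * \<bar>?b\<bar>) * (1 + \<bar>x\<bar>)"
          using B0 by (intro le) linarith
        show "continuous_on UNIV (\<lambda>x. h' (?a + ?b * x) * ?b)"
          by (intro continuous_intros continuous_on_compose2[OF c(2)]) auto
      qed
      then have e: "(\<integral>x. h' (?a + ?b * x) \<partial>\<gamma>) * ?b = (\<integral>x. x * h (?a + ?b * x) \<partial>\<gamma>)" by simp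
      have "(\<integral>x. h (?a + ?b * x) * (Y \<omega> * x) \<partial>\<gamma>) = (\<integral>x. Y \<omega> * (x * h (?a + ?b * x)) \<partial>\<gamma>)"
        by (intro Bochner_Integration.integral_cong) auto
      also have "\<dots> = Y \<omega> * ((\<integral>x. h' (?a + ?b * x) \<partial>\<gamma>) * ?b)" by (simp add: e)
      also have "\<dots> = cos t * ((\<integral>x. h' (?a + ?b * x) \<partial>\<gamma>) * (S \<omega> * Y \<omega>))" by simp
      finally show ?thesis by simp
    qed
    have "(\<integral>p. h (L t p) * (Y (fst p) * snd p) \<partial>N) = (\<integral>\<omega>. (\<integral>x. h (sin t * F \<omega> + cos t * S \<omega> * x) * (Y \<omega> * x) \<partial>\<gamma>) \<partial>M)"
      using integral_product_std_normal(1)[of "\<lambda>\<omega> x. h (sin t * F \<omega> + cos t * S \<omega> * x) * (Y \<omega> * x)"] i1 by (simp add: L_def)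
    also have "\<dots> = (\<integral>\<omega>. cos t * (\<integral>x. h' (sin t * F \<omega> + cos t * S \<omega> * x) * (S \<omega> * Y \<omega>) \<partial>\<gamma>) \<partial>M)" by (simp only: st)
    also have "\<dots> = cos t * (\<integral>\<omega>. (\<integral>x. h' (sin t * F \<omega> + cos t * S \<omega> * x) * (S \<omega> * Y \<omega>) \<partial>\<gamma>) \<partial>M)" by (rule integral_mult_right_zero)
    also have "(\<integral>\<omega>. (\<integral>x. h' (sin t * F \<omega> + cos t * S \<omega> * x) * (S \<omega> * Y \<omega>) \<partial>\<gamma>) \<partial>M) = (\<integral>p. h' (L t p) * (S (fst p) * Y (fst p)) \<partial>N)"
      using integral_product_std_normal(1)[of "\<lambda>\<omega> x. h' (sin t * F \<omega> + cos t * S \<omega> * x) * (S \<omega> * Y \<omega>)"] i2 by (simp add: L_def)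
    finally show ?thesis .
  qed
  let ?I1 = "\<lambda>t. \<integral>p. f2 (L t p) * (V1 (fst p) - (S (fst p))\<^sup>2) \<partial>N"
  let ?I2 = "\<lambda>t. \<integral>p. f3 (L t p) * (S (fst p) * V2 (fst p)) \<partial>N"
  have iF: "integrable N (\<lambda>p. f1 (L t p) * F (fst p))" for t by (rule bm[OF integrable_fst[OF integrable_F] D(8)]) simp
  have iS: "integrable N (\<lambda>p. f1 (L t p) * (S (fst p) * snd p))" for t by (rule bm[OF integrable_fst_snd[OF integrable_S] D(8)]) simp
  have iV1: "integrable N (\<lambda>p. f2 (L t p) * V1 (fst p))" for t by (rule bm[OF integrable_fst[OF integrable_V1] D(9)]) simp
  have iV2: "integrable N (\<lambda>p. f2 (L t p) * (V2 (fst p) * snd p))" for t by (rule bm[OF integrable_fst_snd[OF integrable_V2] D(9)]) simp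
  have iS2: "integrable N (\<lambda>p. f2 (L t p) * (S (fst p))\<^sup>2)" for t by (rule bm[OF integrable_fst[OF integrable_S2] D(9)]) simp
  \<comment> \<open>For a fixed value x of the Gaussian variable the path is a combination of
    \<open>F\<close> and \<open>S\<close> with coefficients \<open>sin t\<close> and
    \<open>cos t * x\<close>. The order of integration is exchanged so that \<open>dual_C1\<close>
    applies on the inside.\<close>
  have FE: "(\<integral>p. f1 (L t p) * F (fst p) \<partial>N) = sin t * (\<integral>p. f2 (L t p) * V1 (fst p) \<partial>N) + cos t * (\<integral>p. f2 (L t p) * (V2 (fst p) * snd p) \<partial>N)" for t
  proof -
    have ii: "integrable N (\<lambda>p. f2 (L t p) * (sin t * V1 (fst p) + cos t * (V2 (fst p) * snd p)))"
      using iV1[of t] iV2[of t] by (simp add: distrib_left mult.left_commute)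
    have b: "\<bar>f1 x\<bar> \<le> max 1 K" "\<bar>f2 x\<bar> \<le> max 1 K" for x using D(8,9)[of x] by (auto simp: le_max_iff_disj)
    have "(\<integral>p. f1 (L t p) * F (fst p) \<partial>N) = (\<integral>x. (\<integral>\<omega>. f1 (sin t * F \<omega> + (cos t * x) * S \<omega>) * F \<omega> \<partial>M) \<partial>\<gamma>)"
      using integral_product_std_normal(2)[of "\<lambda>\<omega> x. f1 (sin t * F \<omega> + (cos t * x) * S \<omega>) * F \<omega>"] iF[of t] by (simp add: L_def mult_ac)
    also have "\<dots> = (\<integral>x. (\<integral>\<omega>. f2 (sin t * F \<omega> + (cos t * x) * S \<omega>) * (sin t * V1 \<omega> + (cos t * x) * V2 \<omega>) \<partial>M) \<partial>\<gamma>)"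
      unfolding V1_def V2_def dual_C1[OF F_graph S_graph2 D(2) D(6) b] ..
    also have "\<dots> = (\<integral>p. f2 (L t p) * (sin t * V1 (fst p) + cos t * (V2 (fst p) * snd p)) \<partial>N)"
      using integral_product_std_normal(2)[of "\<lambda>\<omega> x. f2 (sin t * F \<omega> + (cos t * x) * S \<omega>) * (sin t * V1 \<omega> + (cos t * x) * V2 \<omega>)"] ii by (simp add: L_def mult_ac)
    also have "\<dots> = sin t * (\<integral>p. f2 (L t p) * V1 (fst p) \<partial>N) + cos t * (\<integral>p. f2 (L t p) * (V2 (fst p) * snd p) \<partial>N)"
      using iV1[of t] iV2[of t] by (simp add: distrib_left mult.left_commute)
    finally show ?thesis .
  qed
  \<comment> \<open>Duality for the \<open>F\<close> part and Stein's identity for the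
    \<open>S\<close> part both produce second derivatives with the factor
    \<open>sin t * cos t\<close>, and these combine to \<open>V1 - S\<^sup>2\<close>. The leftover
    term with \<open>V2\<close> still contains the Gaussian variable; one more Stein step turns it
    into a third derivative.\<close>
  have g'_eq: "g' t = sin t * cos t * ?I1 t + (cos t) ^ 3 * ?I2 t" for t
  proof -
    have "g' t = (\<integral>p. cos t * (f1 (L t p) * F (fst p)) - sin t * (f1 (L t p) * (S (fst p) * snd p)) \<partial>N)"
      unfolding g'_def by (intro Bochner_Integration.integral_cong) (auto simp: algebra_simps)
    also have "\<dots> = cos t * (\<integral>p. f1 (L t p) * F (fst p) \<partial>N) - sin t * (\<integral>p. f1 (L t p) * (S (fst p) * snd p) \<partial>N)"
      using iF[of t] iS[of t] by simp
    also have "(\<integral>p. f1 (L t p) * (S (fst p) * snd p) \<partial>N) = cos t * (\<integral>p. f2 (L t p) * (S (fst p))\<^sup>2 \<partial>N)"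
      using stein[OF integrable_S _ D(2) D(8) D(9) D(5) D(6), of t] integrable_S2 by (simp add: power2_eq_square)
    also have "(\<integral>p. f1 (L t p) * F (fst p) \<partial>N) = sin t * (\<integral>p. f2 (L t p) * V1 (fst p) \<partial>N) + cos t * (cos t * ?I2 t)"
      using FE[of t] stein[OF integrable_V2 integrable_SV2 D(3) D(9) D(10) D(6) D(7), of t] by simp
    finally have "g' t = sin t * cos t * ((\<integral>p. f2 (L t p) * V1 (fst p) \<partial>N) - (\<integral>p. f2 (L t p) * (S (fst p))\<^sup>2 \<partial>N)) + (cos t) ^ 3 * ?I2 t"
      by (simp add: algebra_simps power3_eq_cube)
    also have "(\<integral>p. f2 (L t p) * V1 (fst p) \<partial>N) - (\<integral>p. f2 (L t p) * (S (fst p))\<^sup>2 \<partial>N) = ?I1 t"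
      using iV1[of t] iS2[of t] by (simp add: right_diff_distrib)
    finally show ?thesis .
  qed
  have abs_bound: "\<bar>\<integral>p. h (L t p) * A (fst p) \<partial>N\<bar> \<le> B * (\<integral>\<omega>. \<bar>A \<omega>\<bar> \<partial>M)"
    if A: "integrable M A" and h: "\<And>x. \<bar>h x\<bar> \<le> B" "h \<in> borel_measurable borel"
    for h :: "real \<Rightarrow> real" and A :: "'w \<Rightarrow> real" and B t
  proof -
    have i: "integrable N (\<lambda>p. h (L t p) * A (fst p))" by (rule bm[OF integrable_fst[OF A] h])
    have iA: "integrable N (\<lambda>p. \<bar>A (fst p)\<bar>)" using integrable_fst[OF A] by simp
    have "\<bar>\<integral>p. h (L t p) * A (fst p) \<partial>N\<bar> \<le> (\<integral>p. \<bar>h (L t p) * A (fst p)\<bar> \<partial>N)" by (rule integral_abs_bound)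
    also have "\<dots> \<le> (\<integral>p. B * \<bar>A (fst p)\<bar> \<partial>N)"
    proof (rule integral_mono)
      show "integrable N (\<lambda>p. \<bar>h (L t p) * A (fst p)\<bar>)" using i by (rule integrable_abs)
      show "integrable N (\<lambda>p. B * \<bar>A (fst p)\<bar>)" using iA by simp
      show "\<bar>h (L t p) * A (fst p)\<bar> \<le> B * \<bar>A (fst p)\<bar>" for p unfolding abs_mult using h(1) by (intro mult_right_mono) auto
    qed
    also have "\<dots> = B * (\<integral>\<omega>. \<bar>A \<omega>\<bar> \<partial>M)"
      using integral_product_std_normal(1)[of "\<lambda>\<omega> x. \<bar>A \<omega>\<bar>"] iA by simp
    finally show ?thesis .
  qed
  have I1: "\<bar>?I1 t\<bar> \<le> K2 * E1" for t unfolding E1_def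
    by (rule abs_bound[of "\<lambda>\<omega>. V1 \<omega> - (S \<omega>)\<^sup>2" f2 K2, OF _ b2]) (use integrable_V1 integrable_S2 in auto)
  have I2: "\<bar>?I2 t\<bar> \<le> K3 * E2" for t unfolding E2_def
    by (rule abs_bound[of "\<lambda>\<omega>. S \<omega> * V2 \<omega>" f3 K3, OF integrable_SV2 b3]) simp
  \<comment> \<open>An antiderivative of the bound on \<open>g'\<close>. Its increments over the
    quarter period are the constants 1/2 for sin t cos t and 2/3 for (cos t)^3.\<close>
  define H where "H t = K2 * E1 / 2 * (sin t)\<^sup>2 + K3 * E2 * (sin t - (sin t) ^ 3 / 3)" for t
  have dH: "(H has_real_derivative (sin t * cos t * (K2 * E1) + (cos t) ^ 3 * (K3 * E2))) (at t)" for t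
  proof -
    have "(H has_real_derivative (K2 * E1 / 2 * (2 * sin t * cos t) + K3 * E2 * (cos t - (sin t)\<^sup>2 * cos t))) (at t)"
      unfolding H_def[abs_def] by (auto intro!: derivative_eq_intros simp: power2_eq_square)
    moreover have "cos t - (sin t)\<^sup>2 * cos t = (cos t) ^ 3"
    proof -
      have "cos t - (sin t)\<^sup>2 * cos t = cos t * (1 - (sin t)\<^sup>2)" by (simp add: algebra_simps)
      also have "1 - (sin t)\<^sup>2 = (cos t)\<^sup>2" using cos_squared_eq[of t] by simp
      also have "cos t * (cos t)\<^sup>2 = (cos t) ^ 3" by (simp add: power3_eq_cube power2_eq_square)
      finally show ?thesis .
    qed
    ultimately show ?thesis by (simp add: mult_ac)
  qed
  have g'b: "\<bar>g' t\<bar> \<le> sin t * cos t * (K2 * E1) + (cos t) ^ 3 * (K3 * E2)" if t: "0 \<le> t" "t \<le> pi / 2" for t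
  proof -
    have sc: "0 \<le> sin t" "0 \<le> cos t" using t by (auto intro: sin_ge_zero cos_ge_zero)
    have "\<bar>sin t * cos t * ?I1 t\<bar> \<le> sin t * cos t * (K2 * E1)"
      using sc I1[of t] by (simp add: abs_mult mult_left_mono)
    moreover have "\<bar>(cos t) ^ 3 * ?I2 t\<bar> \<le> (cos t) ^ 3 * (K3 * E2)"
      using sc I2[of t] by (simp add: abs_mult mult_left_mono)
    ultimately show ?thesis unfolding g'_eq by linarith
  qed
  \<comment> \<open>Monotonicity of g - H and g + H replaces integrating the bound on the
    derivative.\<close>
  have up: "g (pi / 2) - H (pi / 2) \<le> g 0 - H 0"
  proof (rule DERIV_nonpos_imp_nonincreasing[of 0 "pi / 2" "\<lambda>t. g t - H t"])
    fix t assume "0 \<le> t" "t \<le> pi / 2"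
    then show "\<exists>y. ((\<lambda>t. g t - H t) has_real_derivative y) (at t) \<and> y \<le> 0"
      using DERIV_diff[OF dg dH, of t] g'b[of t]
      by (intro exI[of _ "g' t - (sin t * cos t * (K2 * E1) + (cos t) ^ 3 * (K3 * E2))"] conjI) auto
  qed simp
  have lo: "g 0 + H 0 \<le> g (pi / 2) + H (pi / 2)"
  proof (rule DERIV_nonneg_imp_nondecreasing[of 0 "pi / 2" "\<lambda>t. g t + H t"])
    fix t assume "0 \<le> t" "t \<le> pi / 2"
    then show "\<exists>y. ((\<lambda>t. g t + H t) has_real_derivative y) (at t) \<and> y \<ge> 0"
      using DERIV_add[OF dg dH, of t] g'b[of t]
      by (intro exI[of _ "g' t + (sin t * cos t * (K2 * E1) + (cos t) ^ 3 * (K3 * E2))"] conjI) auto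
  qed simp
  have H: "H 0 = 0" "H (pi / 2) = K2 / 2 * E1 + 2 / 3 * K3 * E2" by (simp_all add: H_def)
  have g0: "g 0 = (\<integral>\<omega>. (\<integral>x. f (S \<omega> * x) \<partial>\<gamma>) \<partial>M)"
    using integral_product_std_normal(1)[of "\<lambda>\<omega> x. f (S \<omega> * x)"] if0[of 0] by (simp add: g_def L_def)
  have g1: "g (pi / 2) = (\<integral>\<omega>. f (F \<omega>) \<partial>M)"
    using integral_product_std_normal(1)[of "\<lambda>\<omega> x. f (F \<omega>)"] if0[of "pi / 2"] by (simp add: g_def L_def)
  show ?thesis using up lo unfolding H g0 g1 E1_def[symmetric] E2_def[symmetric] by linarith
qed

end

section \<open>The Wasserstein distance\<close>

lemma lip1_smoothed:
  assumes f: "lip1 f" shows "lip1 (smoothed \<epsilon> f)"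
  unfolding lip1_def
proof (intro allI)
  fix x y
  have i: "integrable \<gamma> (\<lambda>z. f (a + \<epsilon> * z))" for a by (rule integrable_std_normal_lip1[OF f])
  have "\<bar>smoothed \<epsilon> f x - smoothed \<epsilon> f y\<bar> = \<bar>\<integral>z. f (x + \<epsilon> * z) - f (y + \<epsilon> * z) \<partial>\<gamma>\<bar>"
    using i by (simp add: smoothed_def)
  also have "\<dots> \<le> (\<integral>z. \<bar>f (x + \<epsilon> * z) - f (y + \<epsilon> * z)\<bar> \<partial>\<gamma>)" by (rule integral_abs_bound)
  also have "\<dots> \<le> (\<integral>z. \<bar>x - y\<bar> \<partial>\<gamma>)"
  proof (rule integral_mono)
    show "integrable \<gamma> (\<lambda>z. \<bar>f (x + \<epsilon> * z) - f (y + \<epsilon> * z)\<bar>)" using i by simp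
    show "integrable \<gamma> (\<lambda>z. \<bar>x - y\<bar>)" by (rule integrable_const_std_normal)
    show "\<bar>f (x + \<epsilon> * z) - f (y + \<epsilon> * z)\<bar> \<le> \<bar>x - y\<bar>" for z
      using lip1D[OF f, of "x + \<epsilon> * z" "y + \<epsilon> * z"] by simp
  qed
  finally show "\<bar>smoothed \<epsilon> f x - smoothed \<epsilon> f y\<bar> \<le> \<bar>x - y\<bar>" by simp
qed

lemma lip1_cong_bound:
  assumes f: "lip1 f" and g: "lip1 g" and fg: "\<And>x. \<bar>g x - f x\<bar> \<le> \<delta>"
  shows "\<bar>(\<integral>y. g (a + b * y) \<partial>\<gamma>) - (\<integral>y. f (a + b * y) \<partial>\<gamma>)\<bar> \<le> \<delta>"
proof -
  have i: "integrable \<gamma> (\<lambda>y. g (a + b * y))" "integrable \<gamma> (\<lambda>y. f (a + b * y))"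
    using integrable_std_normal_lip1 f g by auto
  have "\<bar>(\<integral>y. g (a + b * y) \<partial>\<gamma>) - (\<integral>y. f (a + b * y) \<partial>\<gamma>)\<bar> = \<bar>\<integral>y. g (a + b * y) - f (a + b * y) \<partial>\<gamma>\<bar>" using i by simp
  also have "\<dots> \<le> (\<integral>y. \<bar>g (a + b * y) - f (a + b * y)\<bar> \<partial>\<gamma>)" by (rule integral_abs_bound)
  also have "\<dots> \<le> (\<integral>y. \<delta> \<partial>\<gamma>)"
    using i fg by (intro integral_mono integrable_abs Bochner_Integration.integrable_diff integrable_const_std_normal) auto
  finally show ?thesis by simp
qed

text \<open>The conditional expectation of f(S \<eta>) given S = r, so that statements about S
  \<eta> can be made on \<open>M\<close> without the extension.\<close>

definition gauss_scale :: "(real \<Rightarrow> real) \<Rightarrow> real \<Rightarrow> real" where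
  "gauss_scale f r = (\<integral>x. f (r * x) \<partial>\<gamma>)"

lemma gauss_scale_lipschitz:
  assumes f: "lip1 f" shows "\<bar>gauss_scale f r - gauss_scale f s\<bar> \<le> sqrt (2 / pi) * \<bar>r - s\<bar>"
proof -
  have i: "integrable \<gamma> (\<lambda>x. f (r * x))" for r using integrable_std_normal_lip1[OF f, of 0] by simp
  have "\<bar>gauss_scale f r - gauss_scale f s\<bar> = \<bar>\<integral>x. f (r * x) - f (s * x) \<partial>\<gamma>\<bar>" using i by (simp add: gauss_scale_def)
  also have "\<dots> \<le> (\<integral>x. \<bar>f (r * x) - f (s * x)\<bar> \<partial>\<gamma>)" by (rule integral_abs_bound)
  also have "\<dots> \<le> (\<integral>x. \<bar>r - s\<bar> * \<bar>x\<bar> \<partial>\<gamma>)"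
  proof (rule integral_mono)
    show "integrable \<gamma> (\<lambda>x. \<bar>f (r * x) - f (s * x)\<bar>)" using i by simp
    show "integrable \<gamma> (\<lambda>x. \<bar>r - s\<bar> * \<bar>x\<bar>)" using integrable_abs_std_normal by simp
    show "\<bar>f (r * x) - f (s * x)\<bar> \<le> \<bar>r - s\<bar> * \<bar>x\<bar>" for x
      using lip1D[OF f, of "r * x" "s * x"] by (simp add: abs_mult[symmetric] left_diff_distrib)
  qed
  finally show ?thesis by (simp add: integral_abs_std_normal mult.commute)
qed

lemma measurable_gauss_scale:
  assumes f: "lip1 f" shows "gauss_scale f \<in> borel_measurable borel"
proof (rule borel_measurable_continuous_onI)
  have "(sqrt (2 / pi))-lipschitz_on UNIV (gauss_scale f)"
    using gauss_scale_lipschitz[OF f] by (auto simp: lipschitz_on_def dist_real_def)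
  then show "continuous_on UNIV (gauss_scale f)" by (rule lipschitz_on_continuous_on)
qed

text \<open>The symmetry of the normal law, read off from \<open>gaussian_convolution\<close> with
  mollification scale 0, where the square root of a^2 is |a|.\<close>

lemma gauss_scale_abs_arg:
  assumes f: "lip1 f" shows "gauss_scale f \<bar>a\<bar> = gauss_scale f a"
proof -
  have "smoothed 0 f = f" by (rule ext) (simp add: smoothed_def)
  then show ?thesis using gaussian_convolution[OF f, of 0 a] by (simp add: gauss_scale_def)
qed

lemma gauss_scale_abs: "gauss_scale abs r = sqrt (2 / pi) * \<bar>r\<bar>"
  by (simp add: gauss_scale_def abs_mult integral_abs_std_normal)

lemma sqrt_2_div_pi_half: "sqrt (2 / pi) / 2 = 1 / sqrt (2 * pi)"
  by (simp add: real_sqrt_divide real_sqrt_mult field_simps)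

lemma sqrt_sum_squares_minus_abs: "0 \<le> sqrt (s\<^sup>2 + e\<^sup>2) - \<bar>s\<bar>" "e \<ge> 0 \<Longrightarrow> sqrt (s\<^sup>2 + e\<^sup>2) - \<bar>s\<bar> \<le> e"
  using real_sqrt_ge_abs1[of s e] sqrt_sum_squares_le_sum_abs[of s e] by auto

lemma le_if_le_add_all_pos:
  assumes "\<And>d. d > 0 \<Longrightarrow> x \<le> y + 2 * d" shows "x \<le> (y :: real)"
proof (rule field_le_epsilon)
  fix e :: real assume "0 < e" then show "x \<le> y + e" using assms[of "e / 2"] by simp
qed

text \<open>\<open>d'\<close> stands for \<open>sqrt (2 / pi) E|S| - E|F|\<close>, a lower bound for the distance given by the
  test function \<open>abs\<close>. It compensates a possibly negative \<open>E[S]\<close> in \<open>A\<close>.\<close>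

lemma optimize_smoothing_parameter:
  fixes a A d d' c m :: real
  assumes a: "a \<ge> 0" and m: "m = max a A" and A: "2 * c - A \<le> d'"
    and 1: "\<And>e. 0 < e \<Longrightarrow> e \<le> 1 \<Longrightarrow> d \<le> 2 * c * e + a / e\<^sup>2"
    and 2: "\<And>e. 0 < e \<Longrightarrow> e \<le> 1 \<Longrightarrow> d \<le> 2 * c * e + 2 * (a / e\<^sup>2) - d'"
  shows "d \<le> 3 * a powr (1 / 3) * m powr (2 / 3)"
proof (cases "a = 0")
  case True
  have "d \<le> 0"
  proof (rule ccontr)
    assume d: "\<not> d \<le> 0"
    \<comment> \<open>For a = 0 the first bound is linear in \<open>e\<close>. Since
      \<open>C\<close> exceeds 2 c, this \<open>e\<close> is small enough to give d \<le> d /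
      2.\<close>
    define C where "C = 2 * \<bar>c\<bar> + 1"
    have C: "C > 0" by (simp add: C_def add_nonneg_pos)
    define e where "e = min 1 (d / (2 * C))"
    have e: "0 < e" "e \<le> 1" using d C by (auto simp: e_def)
    have "d \<le> 2 * c * e" using 1[OF e] True by simp
    also have "\<dots> \<le> C * e" using e by (intro mult_right_mono) (auto simp: C_def)
    also have "\<dots> \<le> C * (d / (2 * C))" using C by (intro mult_left_mono) (auto simp: e_def)
    also have "\<dots> = d / 2" using C by simp
    finally show False using d by simp
  qed
  then show ?thesis using True by simp
next
  case False
  then have a0: "a > 0" and m0: "m > 0" "a \<le> m" using a m by auto
  \<comment> \<open>This choice equates \<open>e * m\<close> with \<open>a / e\<^sup>2\<close>, the
    common value being \<open>Q\<close>; it is at most 1 because a \<le> m.\<close>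
  define e where "e = (a / m) powr (1 / 3)"
  define Q where "Q = a powr (1 / 3) * m powr (2 / 3)"
  have e: "0 < e" "e \<le> 1" using a0 m0 by (auto simp: e_def intro!: powr_le1)
  have em: "e * m = Q"
  proof -
    have "m = m powr (1 / 3) * m powr (2 / 3)" using m0 by (simp flip: powr_add)
    then have "e * m = a powr (1 / 3) / m powr (1 / 3) * (m powr (1 / 3) * m powr (2 / 3))"
      using a0 m0 by (simp add: e_def powr_divide)
    then show ?thesis using m0 by (simp add: Q_def)
  qed
  have "a / e\<^sup>2 = Q"
  proof -
    have "e ^ 3 = a / m" using a0 m0 by (simp add: e_def powr_power)
    then have "a = e ^ 3 * m" using m0 by simp
    then have "a / e\<^sup>2 = e * m" using e by (simp add: power3_eq_cube power2_eq_square)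
    then show ?thesis using em by simp
  qed
  then have 1: "d \<le> 2 * c * e + Q" and 2: "d \<le> 2 * c * e + 2 * Q - d'" using 1[OF e] 2[OF e] by auto
  have Q0: "Q \<ge> 0" by (simp add: Q_def)
  have "d \<le> 3 * Q"
  \<comment> \<open>If 2 c \<le> m, the first bound gives even 2 Q. Otherwise the excess (2 c - m) e
    is at most 2 c - m because e \<le> 1, hence at most \<open>d'\<close>, which the second bound
    subtracts; the total is then 3 Q.\<close>
  proof (cases "2 * c \<le> m")
    case True
    then have "2 * c * e \<le> m * e" using e by (intro mult_right_mono) auto
    then show ?thesis using 1 em Q0 by (simp add: mult.commute)
  next
    case False
    then have "(2 * c - m) * e \<le> (2 * c - m) * 1" using e by (intro mult_left_mono) auto
    moreover have "2 * c - m \<le> d'" using A m by linarith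
    ultimately have "2 * c * e - d' \<le> e * m" by (simp add: algebra_simps)
    then show ?thesis using 2 em by linarith
  qed
  then show ?thesis by (simp add: Q_def mult.assoc)
qed

section \<open>Estimates at a fixed smoothing scale\<close>

context stein_setup
begin

definition E1 where "E1 = (\<integral>\<omega>. \<bar>V1 \<omega> - (S \<omega>)\<^sup>2\<bar> \<partial>M)"
definition E2 where "E2 = (\<integral>\<omega>. \<bar>S \<omega> * V2 \<omega>\<bar> \<partial>M)"

lemma integrable_lip1_comp:
  assumes f: "lip1 f" and Y: "integrable M Y" shows "integrable M (\<lambda>\<omega>. f (Y \<omega>))"
proof (rule Bochner_Integration.integrable_bound)
  note [measurable] = lip1_measurable[OF f] borel_measurable_integrable[OF Y]
  show "integrable M (\<lambda>\<omega>. \<bar>f 0\<bar> + \<bar>Y \<omega>\<bar>)" using Y by simp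
  show "(\<lambda>\<omega>. f (Y \<omega>)) \<in> borel_measurable M" by measurable
  show "AE \<omega> in M. norm (f (Y \<omega>)) \<le> norm (\<bar>f 0\<bar> + \<bar>Y \<omega>\<bar>)"
    using lip1_growth[OF f] by (intro AE_I2) simp
qed

lemma integrable_gauss_scale:
  assumes f: "lip1 f" and Y: "integrable M Y" shows "integrable M (\<lambda>\<omega>. gauss_scale f (Y \<omega>))"
proof (rule Bochner_Integration.integrable_bound)
  note [measurable] = measurable_gauss_scale[OF f] borel_measurable_integrable[OF Y]
  show "integrable M (\<lambda>\<omega>. \<bar>gauss_scale f 0\<bar> + sqrt (2 / pi) * \<bar>Y \<omega>\<bar>)" using Y by simp
  show "(\<lambda>\<omega>. gauss_scale f (Y \<omega>)) \<in> borel_measurable M" by measurable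
  show "AE \<omega> in M. norm (gauss_scale f (Y \<omega>)) \<le> norm (\<bar>gauss_scale f 0\<bar> + sqrt (2 / pi) * \<bar>Y \<omega>\<bar>)"
  proof (rule AE_I2)
    fix \<omega>
    have "\<bar>gauss_scale f (Y \<omega>)\<bar> \<le> \<bar>gauss_scale f 0\<bar> + sqrt (2 / pi) * \<bar>Y \<omega>\<bar>"
      using gauss_scale_lipschitz[OF f, of "Y \<omega>" 0] by simp
    then show "norm (gauss_scale f (Y \<omega>)) \<le> norm (\<bar>gauss_scale f 0\<bar> + sqrt (2 / pi) * \<bar>Y \<omega>\<bar>)"
      unfolding real_norm_def by (rule order_trans[OF _ abs_ge_self])
  qed
qed

lemma integral_diff_bound:
  fixes A B C :: "'w \<Rightarrow> real"
  assumes "integrable M A" "integrable M B" "integrable M C" "\<And>\<omega>. \<bar>A \<omega> - B \<omega>\<bar> \<le> C \<omega>"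
  shows "\<bar>(\<integral>\<omega>. A \<omega> \<partial>M) - (\<integral>\<omega>. B \<omega> \<partial>M)\<bar> \<le> (\<integral>\<omega>. C \<omega> \<partial>M)"
proof -
  have "\<bar>(\<integral>\<omega>. A \<omega> \<partial>M) - (\<integral>\<omega>. B \<omega> \<partial>M)\<bar> = \<bar>\<integral>\<omega>. A \<omega> - B \<omega> \<partial>M\<bar>" using assms by simp
  also have "\<dots> \<le> (\<integral>\<omega>. \<bar>A \<omega> - B \<omega>\<bar> \<partial>M)" by (rule integral_abs_bound)
  also have "\<dots> \<le> (\<integral>\<omega>. C \<omega> \<partial>M)" using assms by (intro integral_mono integrable_abs Bochner_Integration.integrable_diff)
  finally show ?thesis .
qed

lemma integrable_radius: "integrable M (\<lambda>\<omega>. sqrt ((S \<omega>)\<^sup>2 + \<epsilon>\<^sup>2))"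
proof (rule Bochner_Integration.integrable_bound)
  show "integrable M (\<lambda>\<omega>. \<bar>S \<omega>\<bar> + \<bar>\<epsilon>\<bar>)" using integrable_S by simp
  show "AE \<omega> in M. norm (sqrt ((S \<omega>)\<^sup>2 + \<epsilon>\<^sup>2)) \<le> norm (\<bar>S \<omega>\<bar> + \<bar>\<epsilon>\<bar>)"
    using sqrt_sum_squares_le_sum_abs[of "S _" \<epsilon>] by (intro AE_I2) simp
qed measurable

text \<open>The interpolation needs smooth functions, so \<open>f\<close> is replaced by a test
  function within \<delta>, at the cost of \<delta> in each of the two integrals. The bounds after
  smoothing do not depend on the approximation, so \<delta> can tend to 0.\<close>

lemma smoothed_distance:
  assumes f: "lip1 f" and \<epsilon>: "\<epsilon> > 0"
  shows "\<bar>(\<integral>\<omega>. smoothed \<epsilon> f (F \<omega>) \<partial>M) - (\<integral>\<omega>. gauss_scale f (sqrt ((S \<omega>)\<^sup>2 + \<epsilon>\<^sup>2)) \<partial>M)\<bar> \<le>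
    1 / sqrt (2 * pi) * E1 / \<epsilon> + 2 * sqrt 2 / 3 * E2 / \<epsilon>\<^sup>2"
proof (rule le_if_le_add_all_pos)
  fix \<delta> :: real assume \<delta>: "\<delta> > 0"
  obtain K g g1 g2 g3 where g: "test_function K g g1 g2 g3" and gf: "\<And>x. \<bar>g x - f x\<bar> \<le> \<delta>"
    using test_function_approximation[OF f \<delta>] by blast
  have lg: "lip1 g" using test_functionD(11)[OF g] .
  note N = smoothed_test_function[OF g \<epsilon>]
  let ?r = "\<lambda>\<omega>. sqrt ((S \<omega>)\<^sup>2 + \<epsilon>\<^sup>2)"
  have "\<bar>(\<integral>\<omega>. smoothed \<epsilon> g (F \<omega>) \<partial>M) - (\<integral>\<omega>. (\<integral>x. smoothed \<epsilon> g (S \<omega> * x) \<partial>\<gamma>) \<partial>M)\<bar> \<le>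
    (sqrt (2 / pi) / \<epsilon>) / 2 * E1 + 2 / 3 * (sqrt 2 / \<epsilon>\<^sup>2) * E2"
    unfolding E1_def E2_def by (rule interpolation[OF N])
  also have "\<dots> = (sqrt (2 / pi) / 2) * E1 / \<epsilon> + 2 * sqrt 2 / 3 * E2 / \<epsilon>\<^sup>2" by simp
  finally have 1: "\<bar>(\<integral>\<omega>. smoothed \<epsilon> g (F \<omega>) \<partial>M) - (\<integral>\<omega>. gauss_scale g (?r \<omega>) \<partial>M)\<bar> \<le> 1 / sqrt (2 * pi) * E1 / \<epsilon> + 2 * sqrt 2 / 3 * E2 / \<epsilon>\<^sup>2"
    by (simp only: gaussian_convolution[OF lg] gauss_scale_def sqrt_2_div_pi_half)
  have "\<bar>(\<integral>\<omega>. smoothed \<epsilon> g (F \<omega>) \<partial>M) - (\<integral>\<omega>. smoothed \<epsilon> f (F \<omega>) \<partial>M)\<bar> \<le> (\<integral>\<omega>. \<delta> \<partial>M)"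
    using integrable_lip1_comp[OF lip1_smoothed[OF f] integrable_F] integrable_lip1_comp[OF lip1_smoothed[OF lg] integrable_F]
    by (intro integral_diff_bound) (auto simp: smoothed_def intro!: lip1_cong_bound[OF f lg gf])
  then have 2: "\<bar>(\<integral>\<omega>. smoothed \<epsilon> g (F \<omega>) \<partial>M) - (\<integral>\<omega>. smoothed \<epsilon> f (F \<omega>) \<partial>M)\<bar> \<le> \<delta>" by (simp add: prob_space)
  have gs: "\<bar>gauss_scale g r - gauss_scale f r\<bar> \<le> \<delta>" for r
    using lip1_cong_bound[OF f lg gf, of 0 r] by (simp add: gauss_scale_def)
  have "\<bar>(\<integral>\<omega>. gauss_scale g (?r \<omega>) \<partial>M) - (\<integral>\<omega>. gauss_scale f (?r \<omega>) \<partial>M)\<bar> \<le> (\<integral>\<omega>. \<delta> \<partial>M)"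
    using integrable_gauss_scale[OF f integrable_radius] integrable_gauss_scale[OF lg integrable_radius]
    by (intro integral_diff_bound gs) auto
  then have 3: "\<bar>(\<integral>\<omega>. gauss_scale g (?r \<omega>) \<partial>M) - (\<integral>\<omega>. gauss_scale f (?r \<omega>) \<partial>M)\<bar> \<le> \<delta>" by (simp add: prob_space)
  show "\<bar>(\<integral>\<omega>. smoothed \<epsilon> f (F \<omega>) \<partial>M) - (\<integral>\<omega>. gauss_scale f (?r \<omega>) \<partial>M)\<bar> \<le> 1 / sqrt (2 * pi) * E1 / \<epsilon> + 2 * sqrt 2 / 3 * E2 / \<epsilon>\<^sup>2 + 2 * \<delta>"
    using 1 2 3 by linarith
qed

text \<open>The value of \<open>stein_term\<close> in terms of \<open>E1\<close> and
  \<open>E2\<close>: its second coefficient is doubled because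
  \<open>D(S\<^sup>2) = 2 S DS\<close>.\<close>

definition stein where "stein = 1 / sqrt (2 * pi) * E1 + 2 * sqrt 2 / 3 * E2"

lemma E_nonneg: "E1 \<ge> 0" "E2 \<ge> 0"
  by (simp_all add: E1_def E2_def)

lemma stein_nonneg: "stein \<ge> 0"
  using E_nonneg by (simp add: stein_def)

text \<open>For \<epsilon> \<le> 1 the factor 1 / \<epsilon> of the first term is at most 1 /
  \<epsilon>^2, which merges the two terms into one.\<close>

lemma smoothed_distance_stein:
  assumes f: "lip1 f" and \<epsilon>: "\<epsilon> > 0" "\<epsilon> \<le> 1"
  shows "\<bar>(\<integral>\<omega>. smoothed \<epsilon> f (F \<omega>) \<partial>M) - (\<integral>\<omega>. gauss_scale f (sqrt ((S \<omega>)\<^sup>2 + \<epsilon>\<^sup>2)) \<partial>M)\<bar> \<le> stein / \<epsilon>\<^sup>2"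
proof -
  have "1 / sqrt (2 * pi) * E1 / \<epsilon> \<le> 1 / sqrt (2 * pi) * E1 / \<epsilon>\<^sup>2"
    using E_nonneg \<epsilon> by (intro divide_left_mono) (auto simp: power2_eq_square mult_le_cancel_left1)
  then show ?thesis using smoothed_distance[OF f \<epsilon>(1)] by (simp add: stein_def add_divide_distrib)
qed

text \<open>Both bounds start from the same estimate, containing the mollification error
  \<open>q\<close> of S \<eta>. The first uses that \<open>q\<close> is at most
  \<open>sqrt (2 / pi) * \<epsilon>\<close>. The second bounds \<open>q\<close> through the distance
  estimate for the test function \<open>abs\<close>, which costs a second copy of
  \<open>stein / \<epsilon>\<^sup>2\<close> but gains the difference of the first absolute
  moments.\<close>

lemma distance_bounds:
  assumes f: "lip1 f" and \<epsilon>: "\<epsilon> > 0" "\<epsilon> \<le> 1"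
  defines "d \<equiv> \<bar>(\<integral>\<omega>. f (F \<omega>) \<partial>M) - (\<integral>\<omega>. gauss_scale f (S \<omega>) \<partial>M)\<bar>"
  shows "d \<le> 2 * sqrt (2 / pi) * \<epsilon> + stein / \<epsilon>\<^sup>2"
    and "d \<le> 2 * sqrt (2 / pi) * \<epsilon> + 2 * (stein / \<epsilon>\<^sup>2) - (sqrt (2 / pi) * (\<integral>\<omega>. \<bar>S \<omega>\<bar> \<partial>M) - (\<integral>\<omega>. \<bar>F \<omega>\<bar> \<partial>M))"
proof -
  let ?c = "sqrt (2 / pi)"
  let ?r = "\<lambda>\<omega>. sqrt ((S \<omega>)\<^sup>2 + \<epsilon>\<^sup>2)"
  define q where "q = ?c * ((\<integral>\<omega>. ?r \<omega> \<partial>M) - (\<integral>\<omega>. \<bar>S \<omega>\<bar> \<partial>M))"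
  have iS: "integrable M (\<lambda>\<omega>. \<bar>S \<omega>\<bar>)" using integrable_S by simp
  have sm: "\<bar>(\<integral>\<omega>. smoothed \<epsilon> h (F \<omega>) \<partial>M) - (\<integral>\<omega>. h (F \<omega>) \<partial>M)\<bar> \<le> ?c * \<epsilon>" if h: "lip1 h" for h
  proof -
    have "\<bar>(\<integral>\<omega>. smoothed \<epsilon> h (F \<omega>) \<partial>M) - (\<integral>\<omega>. h (F \<omega>) \<partial>M)\<bar> \<le> (\<integral>\<omega>. ?c * \<epsilon> \<partial>M)"
      using integrable_lip1_comp[OF lip1_smoothed[OF h] integrable_F] integrable_lip1_comp[OF h integrable_F] smoothed_error[OF h] \<epsilon>
      by (intro integral_diff_bound) auto
    then show ?thesis by (simp add: prob_space)
  qed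
  have "\<bar>(\<integral>\<omega>. gauss_scale f (?r \<omega>) \<partial>M) - (\<integral>\<omega>. gauss_scale f (S \<omega>) \<partial>M)\<bar> \<le> (\<integral>\<omega>. ?c * (?r \<omega> - \<bar>S \<omega>\<bar>) \<partial>M)"
  proof (rule integral_diff_bound)
    show "\<bar>gauss_scale f (?r \<omega>) - gauss_scale f (S \<omega>)\<bar> \<le> ?c * (?r \<omega> - \<bar>S \<omega>\<bar>)" for \<omega>
      using gauss_scale_lipschitz[OF f, of "?r \<omega>" "\<bar>S \<omega>\<bar>"] sqrt_sum_squares_minus_abs(1)[of "S \<omega>" \<epsilon>]
      by (simp add: gauss_scale_abs_arg[OF f])
  qed (use integrable_gauss_scale[OF f integrable_radius] integrable_gauss_scale[OF f integrable_S] integrable_radius iS in auto)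
  also have "\<dots> = q" using integrable_radius iS by (simp add: q_def)
  finally have 2: "\<bar>(\<integral>\<omega>. gauss_scale f (?r \<omega>) \<partial>M) - (\<integral>\<omega>. gauss_scale f (S \<omega>) \<partial>M)\<bar> \<le> q" .
  have d: "d \<le> ?c * \<epsilon> + q + stein / \<epsilon>\<^sup>2"
    using sm[OF f] 2 smoothed_distance_stein[OF f \<epsilon>] unfolding d_def by linarith
  have "(\<integral>\<omega>. ?r \<omega> \<partial>M) - (\<integral>\<omega>. \<bar>S \<omega>\<bar> \<partial>M) = (\<integral>\<omega>. ?r \<omega> - \<bar>S \<omega>\<bar> \<partial>M)" using integrable_radius iS by simp
  also have "\<dots> \<le> (\<integral>\<omega>. \<epsilon> \<partial>M)"
    using integrable_radius iS sqrt_sum_squares_minus_abs(2)[of \<epsilon>] \<epsilon> by (intro integral_mono) auto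
  finally have "q \<le> ?c * \<epsilon>" unfolding q_def by (intro mult_left_mono) (simp_all add: prob_space)
  then show "d \<le> 2 * ?c * \<epsilon> + stein / \<epsilon>\<^sup>2" using d by linarith
  \<comment> \<open>For \<open>abs\<close> the Gaussian side is explicit, so the distance estimate
    becomes an upper bound for the mean of sqrt (S^2 + \<epsilon>^2), and thereby for
    \<open>q\<close>.\<close>
  have "?c * (\<integral>\<omega>. ?r \<omega> \<partial>M) = (\<integral>\<omega>. gauss_scale abs (?r \<omega>) \<partial>M)" by (simp add: gauss_scale_abs)
  then have "?c * (\<integral>\<omega>. ?r \<omega> \<partial>M) \<le> (\<integral>\<omega>. \<bar>F \<omega>\<bar> \<partial>M) + ?c * \<epsilon> + stein / \<epsilon>\<^sup>2"
    using sm[OF lip1_abs] smoothed_distance_stein[OF lip1_abs \<epsilon>] by linarith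
  then have "?c * (\<integral>\<omega>. \<bar>S \<omega>\<bar> \<partial>M) - (\<integral>\<omega>. \<bar>F \<omega>\<bar> \<partial>M) + q \<le> ?c * \<epsilon> + stein / \<epsilon>\<^sup>2"
    unfolding q_def right_diff_distrib by linarith
  then show "d \<le> 2 * ?c * \<epsilon> + 2 * (stein / \<epsilon>\<^sup>2) - (?c * (\<integral>\<omega>. \<bar>S \<omega>\<bar> \<partial>M) - (\<integral>\<omega>. \<bar>F \<omega>\<bar> \<partial>M))"
    using d by linarith
qed

lemma malliavin_D_F: "AE \<omega> in M. malliavin_D M X F \<omega> = DF \<omega>" "malliavin_D M X F \<in> borel_measurable M"
  using malliavin_D_graph[OF malliavin_graph_mono[OF _ _ F_graph]] malliavin_graph_measurable by (auto, blast)

lemma malliavin_D_S2: "AE \<omega> in M. malliavin_D M X (\<lambda>\<omega>. (S \<omega>)\<^sup>2) \<omega> = (2 * S \<omega>) *\<^sub>R DS \<omega>"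
    "malliavin_D M X (\<lambda>\<omega>. (S \<omega>)\<^sup>2) \<in> borel_measurable M"
  using malliavin_D_graph[OF malliavin_graph_square[OF S_graph2]] malliavin_graph_measurable by (auto, blast)

lemma stein_term_eq: "stein_term M X u F S = stein"
proof -
  have "(\<integral>\<omega>. \<bar>u \<omega> \<bullet> malliavin_D M X F \<omega> - (S \<omega>)\<^sup>2\<bar> \<partial>M) = E1"
    unfolding E1_def
  proof (rule integral_cong_AE)
    show "AE \<omega> in M. \<bar>u \<omega> \<bullet> malliavin_D M X F \<omega> - (S \<omega>)\<^sup>2\<bar> = \<bar>V1 \<omega> - (S \<omega>)\<^sup>2\<bar>"
      using malliavin_D_F(1) by eventually_elim (simp add: V1_def inner_commute)
  qed (use malliavin_D_F(2) in measurable)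
  moreover have "(\<integral>\<omega>. \<bar>u \<omega> \<bullet> malliavin_D M X (\<lambda>\<omega>'. (S \<omega>')\<^sup>2) \<omega>\<bar> \<partial>M) = (\<integral>\<omega>. 2 * \<bar>S \<omega> * V2 \<omega>\<bar> \<partial>M)"
  proof (rule integral_cong_AE)
    show "AE \<omega> in M. \<bar>u \<omega> \<bullet> malliavin_D M X (\<lambda>\<omega>'. (S \<omega>')\<^sup>2) \<omega>\<bar> = 2 * \<bar>S \<omega> * V2 \<omega>\<bar>"
      using malliavin_D_S2(1) by eventually_elim (simp add: V2_def inner_commute abs_mult)
  qed (use malliavin_D_S2(2) in measurable)
  ultimately show ?thesis by (simp add: stein_term_def stein_def E2_def)
qed

theorem lipschitz_distance:
  assumes f: "lip1 f"
  shows "\<bar>(\<integral>\<omega>. f (F \<omega>) \<partial>M) - (\<integral>\<omega>. gauss_scale f (S \<omega>) \<partial>M)\<bar> \<le> Delta M X u F S"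
proof -
  let ?c = "sqrt (2 / pi)"
  \<comment> \<open>Since -E[S] is at most E|S|, a deficit of the second entry of the maximum below
    \<open>2 * ?c\<close> is covered by the lower bound \<open>d'\<close> from the test function
    \<open>abs\<close>.\<close>
  have "- (\<integral>\<omega>. S \<omega> \<partial>M) \<le> (\<integral>\<omega>. \<bar>S \<omega>\<bar> \<partial>M)"
    using integral_abs_bound[of M S] by linarith
  then have "?c * (- (\<integral>\<omega>. S \<omega> \<partial>M)) \<le> ?c * (\<integral>\<omega>. \<bar>S \<omega>\<bar> \<partial>M)" by (intro mult_left_mono) auto
  then have A: "2 * ?c - (?c * (2 + (\<integral>\<omega>. S \<omega> \<partial>M)) + (\<integral>\<omega>. \<bar>F \<omega>\<bar> \<partial>M)) \<le> ?c * (\<integral>\<omega>. \<bar>S \<omega>\<bar> \<partial>M) - (\<integral>\<omega>. \<bar>F \<omega>\<bar> \<partial>M)"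
    by (simp add: algebra_simps)
  show ?thesis
    unfolding Delta_def stein_term_eq
    by (rule optimize_smoothing_parameter[OF stein_nonneg refl A distance_bounds[OF f]])
qed

end

section \<open>The Kolmogorov distance\<close>

text \<open>For h > 0, h times the usual piecewise linear approximation of an indicator, which makes
  the Lipschitz constant 1: the value is \<open>h\<close> up to \<open>x\<close> and 0 from
  \<open>x + h\<close> on.\<close>

definition ramp :: "real \<Rightarrow> real \<Rightarrow> real \<Rightarrow> real" where
  "ramp h x y = max 0 (min h (x + h - y))"

lemma lip1_ramp: "lip1 (ramp h x)"
  unfolding lip1_def
proof (intro allI)
  fix y z
  have "\<bar>max 0 p - max 0 q\<bar> \<le> \<bar>p - q\<bar>" "\<bar>min h p - min h q\<bar> \<le> \<bar>p - q\<bar>" for p q :: real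
    by linarith+
  from order_trans[OF this(1) this(2)[of "x + h - y" "x + h - z"]]
  show "\<bar>ramp h x y - ramp h x z\<bar> \<le> \<bar>y - z\<bar>" unfolding ramp_def by linarith
qed

lemma ramp_bounds:
  assumes "h > 0"
  shows "h * indicator {..x} y \<le> ramp h x y" "ramp h x y \<le> h * indicator {..x + h} y"
  using assms by (auto simp: ramp_def indicator_def)

text \<open>The ramp starting at x bounds the distribution function of \<open>F\<close> from above,
  the one starting at x - h from below. Each comparison shifts the argument for \<open>G\<close> by
  \<open>h\<close>, which costs at most \<open>e\<close> by the concentration bound; dividing by the
  height of the ramp gives d / h.\<close>

lemma (in prob_space) prob_diff_le_lip1:
  fixes F G :: "'a \<Rightarrow> real"
  assumes [measurable]: "F \<in> borel_measurable M" "G \<in> borel_measurable M" and h: "h > 0"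
    and d: "\<And>f. lip1 f \<Longrightarrow> \<bar>(\<integral>\<omega>. f (F \<omega>) \<partial>M) - (\<integral>\<omega>. f (G \<omega>) \<partial>M)\<bar> \<le> d"
    and c: "\<And>y. prob {\<omega> \<in> space M. y < G \<omega> \<and> G \<omega> \<le> y + h} \<le> e"
  shows "\<bar>prob {\<omega> \<in> space M. F \<omega> \<le> x} - prob {\<omega> \<in> space M. G \<omega> \<le> x}\<bar> \<le> d / h + e"
proof -
  have ib: "integrable M (\<lambda>\<omega>. ramp h x (Y \<omega>))" if [measurable]: "Y \<in> borel_measurable M" for Y x
  proof -
    note [measurable] = lip1_measurable[OF lip1_ramp[of h x]]
    show ?thesis by (rule integrable_const_bound[of _ h]) (use h in \<open>auto simp: ramp_def\<close>)
  qed
  have ind: "(\<integral>\<omega>. h * indicator {..x} (Y \<omega>) \<partial>M) = h * prob {\<omega> \<in> space M. Y \<omega> \<le> x}"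
    "integrable M (\<lambda>\<omega>. h * indicator {..x} (Y \<omega>))"
    if [measurable]: "Y \<in> borel_measurable M" for Y :: "'a \<Rightarrow> real" and x
  proof -
    have "(\<integral>\<omega>. indicator {..x} (Y \<omega>) \<partial>M) = (\<integral>\<omega>. indicator {\<omega> \<in> space M. Y \<omega> \<le> x} \<omega> \<partial>M :: real)"
      by (intro Bochner_Integration.integral_cong) (auto simp: indicator_def)
    then show "(\<integral>\<omega>. h * indicator {..x} (Y \<omega>) \<partial>M) = h * prob {\<omega> \<in> space M. Y \<omega> \<le> x}" by simp
    show "integrable M (\<lambda>\<omega>. h * indicator {..x} (Y \<omega>))"
      by (intro integrable_mult_right integrable_const_bound[of _ 1]) (auto simp: indicator_def)
  qed
  have lo: "h * prob {\<omega> \<in> space M. Y \<omega> \<le> x} \<le> (\<integral>\<omega>. ramp h x (Y \<omega>) \<partial>M)"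
    if Y: "Y \<in> borel_measurable M" for Y x
    unfolding ind(1)[OF Y, symmetric] by (intro integral_mono ind(2)[OF Y] ib[OF Y] ramp_bounds(1) h)
  have up: "(\<integral>\<omega>. ramp h x (Y \<omega>) \<partial>M) \<le> h * prob {\<omega> \<in> space M. Y \<omega> \<le> x + h}"
    if Y: "Y \<in> borel_measurable M" for Y x
    unfolding ind(1)[OF Y, symmetric] by (intro integral_mono ind(2)[OF Y] ib[OF Y] ramp_bounds(2) h)
  have split: "prob {\<omega> \<in> space M. G \<omega> \<le> y + h} \<le> prob {\<omega> \<in> space M. G \<omega> \<le> y} + e" for y
  proof -
    have "{\<omega> \<in> space M. G \<omega> \<le> y + h} = {\<omega> \<in> space M. G \<omega> \<le> y} \<union> {\<omega> \<in> space M. y < G \<omega> \<and> G \<omega> \<le> y + h}"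
      using h by auto
    then have "prob {\<omega> \<in> space M. G \<omega> \<le> y + h} = prob {\<omega> \<in> space M. G \<omega> \<le> y} + prob {\<omega> \<in> space M. y < G \<omega> \<and> G \<omega> \<le> y + h}"
      by (simp only:, subst finite_measure_Union) auto
    then show ?thesis using c[of y] by simp
  qed
  have "h * prob {\<omega> \<in> space M. F \<omega> \<le> x} \<le> h * prob {\<omega> \<in> space M. G \<omega> \<le> x + h} + d"
    using lo[of F x] up[of G x] d[OF lip1_ramp[of h x]] by simp
  also have "\<dots> \<le> h * (prob {\<omega> \<in> space M. G \<omega> \<le> x} + e) + d"
    using split[of x] h by simp
  finally have 1: "prob {\<omega> \<in> space M. F \<omega> \<le> x} \<le> prob {\<omega> \<in> space M. G \<omega> \<le> x} + e + d / h"
    using h by (simp add: field_simps)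
  have "h * prob {\<omega> \<in> space M. G \<omega> \<le> x - h} \<le> h * prob {\<omega> \<in> space M. F \<omega> \<le> x} + d"
    using lo[of G "x - h"] up[of F "x - h"] d[OF lip1_ramp[of h "x - h"]] by simp
  then have "prob {\<omega> \<in> space M. G \<omega> \<le> x - h} \<le> prob {\<omega> \<in> space M. F \<omega> \<le> x} + d / h"
    using h by (simp add: field_simps)
  then have 2: "prob {\<omega> \<in> space M. G \<omega> \<le> x} \<le> prob {\<omega> \<in> space M. F \<omega> \<le> x} + d / h + e"
    using split[of "x - h"] by simp
  show ?thesis using 1 2 by linarith
qed

text \<open>The probability is at most z = h / |s| and at most 1, and the minimum of z and 1 is at
  most z to the power \<alpha> because 0 < \<alpha> \<le> 1.\<close>

lemma std_normal_small_ball: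
  assumes s: "s \<noteq> 0" and h: "h > 0" and \<alpha>: "0 < \<alpha>" "\<alpha> \<le> 1"
  shows "emeasure \<gamma> {x. y < s * x \<and> s * x \<le> y + h} \<le> ennreal (h powr \<alpha> * \<bar>s\<bar> powr (- \<alpha>))"
proof -
  let ?A = "{x. y < s * x \<and> s * x \<le> y + h}"
  let ?z = "h / \<bar>s\<bar>"
  have z: "?z > 0" using s h by simp
  \<comment> \<open>An interval symmetric about y / s covers both signs of \<open>s\<close>. Its
    doubled length is compensated by the bound 1/2 on the density.\<close>
  have sub: "?A \<subseteq> {y / s - ?z..y / s + ?z}"
  proof
    fix x assume "x \<in> ?A"
    then have "\<bar>s * x - y\<bar> \<le> h" using h by auto
    then have "\<bar>s\<bar> * \<bar>x - y / s\<bar> \<le> h" using s by (simp add: abs_mult[symmetric] right_diff_distrib)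
    then have "\<bar>x - y / s\<bar> \<le> ?z" using s by (simp add: field_simps)
    then show "x \<in> {y / s - ?z..y / s + ?z}" unfolding atLeastAtMost_iff by linarith
  qed
  have dens: "std_normal_density x \<le> 1 / 2" for x
  proof -
    have "2 \<le> sqrt (2 * pi)" using pi_gt3 by (intro real_le_rsqrt) simp
    then have "1 / sqrt (2 * pi) \<le> 1 / 2" by (intro divide_left_mono) auto
    moreover have "exp (- x\<^sup>2 / 2) \<le> 1" by simp
    ultimately have "1 / sqrt (2 * pi) * exp (- x\<^sup>2 / 2) \<le> 1 / 2 * 1" by (intro mult_mono) auto
    then show ?thesis by (simp add: std_normal_density_def)
  qed
  have "emeasure \<gamma> ?A \<le> emeasure \<gamma> {y / s - ?z..y / s + ?z}" by (rule emeasure_mono[OF sub]) simp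
  also have "\<dots> = (\<integral>\<^sup>+x. ennreal (std_normal_density x) * indicator {y / s - ?z..y / s + ?z} x \<partial>lborel)"
    by (simp add: emeasure_density)
  also have "\<dots> \<le> (\<integral>\<^sup>+x. ennreal (1 / 2) * indicator {y / s - ?z..y / s + ?z} x \<partial>lborel)"
    using dens by (intro nn_integral_mono mult_right_mono ennreal_leI) auto
  also have "\<dots> = ennreal (1 / 2) * emeasure lborel {y / s - ?z..y / s + ?z}"
    by (rule nn_integral_cmult_indicator) simp
  also have "\<dots> = ennreal (1 / 2) * ennreal (2 * ?z)"
    using z h by (subst emeasure_lborel_Icc) auto
  also have "\<dots> = ennreal (1 / 2 * (2 * ?z))" using z h by (intro ennreal_mult[symmetric]) auto
  also have "\<dots> = ennreal ?z" by simp
  finally have 1: "emeasure \<gamma> ?A \<le> ennreal ?z" .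
  have 2: "emeasure \<gamma> ?A \<le> 1"
    using prob_space.emeasure_le_1[OF real_distribution.axioms(1)[OF real_dist_normal_dist]] by blast
  have eq: "?z powr \<alpha> = h powr \<alpha> * \<bar>s\<bar> powr (- \<alpha>)"
    using s h by (simp add: powr_divide powr_minus field_simps)
  have "emeasure \<gamma> ?A \<le> ennreal (?z powr \<alpha>)"
  proof (cases "?z \<le> 1")
    case True
    have "?z powr 1 \<le> ?z powr \<alpha>" using z h True \<alpha> by (intro powr_mono') auto
    then show ?thesis using z h by (intro order_trans[OF 1] ennreal_leI) simp
  next
    case False
    then have "1 \<le> ?z powr \<alpha>" using \<alpha> by (intro ge_one_powr_ge_zero) auto
    then show ?thesis using 2 by (intro order_trans[OF 2]) (simp add: ennreal_1[symmetric] del: ennreal_1)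
  qed
  then show ?thesis by (simp add: eq)
qed

section \<open>Transfer to the extension\<close>

locale extended_setup = stein_setup M X u F S DF DS
  for M :: "'w measure" and X :: "'h::{real_inner, banach, second_countable_topology} \<Rightarrow> 'w \<Rightarrow> real"
    and u :: "'w \<Rightarrow> 'h" and F S :: "'w \<Rightarrow> real" and DF DS :: "'w \<Rightarrow> 'h" +
  fixes M' :: "'e measure" and \<pi> :: "'e \<Rightarrow> 'w" and \<eta> :: "'e \<Rightarrow> real"
  assumes ext: "extension_of M' \<pi> M" and \<eta>_normal: "distributed M' lborel \<eta> std_normal_density"
    and \<eta>_indep: "prob_space.indep_set M' {\<eta> -` A \<inter> space M' | A. A \<in> sets borel}
      (sets (process_algebra M' (\<lambda>h \<omega>. X h (\<pi> \<omega>))))"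
begin

sublocale E: prob_space M'
  using ext unfolding extension_of_def by blast

lemma measurable_\<pi> [measurable]: "\<pi> \<in> measurable M' M"
  using ext unfolding extension_of_def by blast

lemma distr_\<pi>: "distr M' M \<pi> = M"
  using ext unfolding extension_of_def by blast

lemma measurable_\<eta> [measurable]: "\<eta> \<in> borel_measurable M'"
  using distributed_measurable[OF \<eta>_normal] by simp

lemma distr_\<eta>: "distr M' borel \<eta> = \<gamma>"
proof -
  have "distr M' borel \<eta> = distr M' lborel \<eta>" by (rule distr_cong) auto
  then show ?thesis using distributed_distr_eq_density[OF \<eta>_normal] by (simp only:)
qed

lemma vimage_process_algebra:
  assumes "B \<in> sets (process_algebra M X)"
  shows "\<pi> -` B \<inter> space M' \<in> sets (process_algebra M' (\<lambda>h \<omega>. X h (\<pi> \<omega>)))"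
  using assms unfolding sets_process_algebra[of M X]
proof induction
  case (Basic a)
  then obtain h A where a: "a = X h -` A \<inter> space M" "A \<in> sets borel" by auto
  have "\<pi> -` a \<inter> space M' = (\<lambda>\<omega>. X h (\<pi> \<omega>)) -` A \<inter> space M'"
    using measurable_space[OF measurable_\<pi>] by (auto simp: a)
  moreover have "\<dots> \<in> sets (process_algebra M' (\<lambda>h \<omega>. X h (\<pi> \<omega>)))"
    using a(2) unfolding sets_process_algebra by (intro sigma_sets.Basic) blast
  ultimately show ?case by simp
next
  case Empty then show ?case by simp
next
  case (Compl a)
  have "\<pi> -` (space M - a) \<inter> space M' = space M' - (\<pi> -` a \<inter> space M')"
    using measurable_space[OF measurable_\<pi>] by auto
  then show ?case
    using sets.compl_sets[OF Compl.IH] by simp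
next
  case (Union a)
  have "\<pi> -` (\<Union>i. a i) \<inter> space M' = (\<Union>i. \<pi> -` a i \<inter> space M')" by auto
  moreover have "(\<Union>i. \<pi> -` a i \<inter> space M') \<in> sets (process_algebra M' (\<lambda>h \<omega>. X h (\<pi> \<omega>)))"
    by (rule sets.countable_UN) (use Union.IH in blast)
  ultimately show ?case by (simp only:)
qed

text \<open>The hypothesis speaks of events generated by the composed process only. An arbitrary
  event of \<open>M\<close> agrees with one of these up to a null set, and null sets stay null under
  \<open>\<pi>\<close> because it preserves the measure.\<close>

lemma \<pi>_\<eta>_indep:
  assumes B: "B \<in> sets M" and A: "A \<in> sets borel"
  shows "E.prob ((\<pi> -` B \<inter> space M') \<inter> (\<eta> -` A \<inter> space M')) = E.prob (\<pi> -` B \<inter> space M') * E.prob (\<eta> -` A \<inter> space M')"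
proof -
  obtain C where C: "C \<in> sets (process_algebra M X)" and ae: "AE \<omega> in M. \<omega> \<in> B \<longleftrightarrow> \<omega> \<in> C"
    using AE_process_algebra_representative[OF B] by blast
  have CM [measurable]: "C \<in> sets M" using C subalgebra_X by (auto simp: subalgebra_def)
  note [measurable] = B A
  have "AE \<omega> in distr M' M \<pi>. \<omega> \<in> B \<longleftrightarrow> \<omega> \<in> C" by (subst distr_\<pi>) (rule ae)
  then have ae': "AE \<omega> in M'. \<pi> \<omega> \<in> B \<longleftrightarrow> \<pi> \<omega> \<in> C" by (subst (asm) AE_distr_iff) auto
  have 1: "E.prob (\<pi> -` B \<inter> space M') = E.prob (\<pi> -` C \<inter> space M')"
    using ae' by (intro E.finite_measure_eq_AE) (auto intro: measurable_sets)
  have 2: "E.prob ((\<pi> -` B \<inter> space M') \<inter> (\<eta> -` A \<inter> space M')) = E.prob ((\<pi> -` C \<inter> space M') \<inter> (\<eta> -` A \<inter> space M'))"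
  proof (intro E.finite_measure_eq_AE)
    show "AE x in M'. (x \<in> \<pi> -` B \<inter> space M' \<inter> (\<eta> -` A \<inter> space M')) = (x \<in> \<pi> -` C \<inter> space M' \<inter> (\<eta> -` A \<inter> space M'))"
      using ae' by eventually_elim auto
  qed (auto intro!: sets.Int measurable_sets[OF measurable_\<pi>] measurable_sets[OF measurable_\<eta>])
  have "E.prob ((\<eta> -` A \<inter> space M') \<inter> (\<pi> -` C \<inter> space M')) = E.prob (\<eta> -` A \<inter> space M') * E.prob (\<pi> -` C \<inter> space M')"
    by (rule E.indep_setD[OF \<eta>_indep]) (use A vimage_process_algebra[OF C] in auto)
  then show ?thesis unfolding 1 2 by (simp add: Int_commute mult.commute)
qed

lemma distr_\<pi>_\<eta>: "distr M' (M \<Otimes>\<^sub>M borel) (\<lambda>\<omega>. (\<pi> \<omega>, \<eta> \<omega>)) = M \<Otimes>\<^sub>M \<gamma>"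
  using E.distr_Pair_indep[OF measurable_\<pi> measurable_\<eta> \<pi>_\<eta>_indep] by (simp only: distr_\<pi> distr_\<eta>)

lemma integral_F:
  assumes f: "lip1 f" shows "(\<integral>\<omega>. f (F (\<pi> \<omega>)) \<partial>M') = (\<integral>\<omega>. f (F \<omega>) \<partial>M)"
proof -
  note [measurable] = lip1_measurable[OF f]
  have "(\<integral>\<omega>. f (F \<omega>) \<partial>distr M' M \<pi>) = (\<integral>\<omega>. f (F (\<pi> \<omega>)) \<partial>M')" by (rule integral_distr) auto
  then show ?thesis by (simp only: distr_\<pi>)
qed

lemma integral_S\<eta>:
  assumes f: "lip1 f" shows "(\<integral>\<omega>. f (S (\<pi> \<omega>) * \<eta> \<omega>) \<partial>M') = (\<integral>\<omega>. gauss_scale f (S \<omega>) \<partial>M)"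
proof -
  note [measurable] = lip1_measurable[OF f]
  have P: "prob_space (M \<Otimes>\<^sub>M \<gamma>)"
    unfolding distr_\<pi>_\<eta>[symmetric] by (rule E.prob_space_distr) simp
  have m: "(\<lambda>p. f (S (fst p) * snd p)) \<in> borel_measurable (M \<Otimes>\<^sub>M borel)" by measurable
  have i: "integrable (M \<Otimes>\<^sub>M \<gamma>) (\<lambda>p. f (S (fst p) * snd p))"
  proof (rule Bochner_Integration.integrable_bound)
    show "integrable (M \<Otimes>\<^sub>M \<gamma>) (\<lambda>p. \<bar>f 0\<bar> + \<bar>S (fst p) * snd p\<bar>)"
      using integrable_fst_snd[OF integrable_S] finite_measure.integrable_const[OF prob_space.finite_measure[OF P]]
      by (intro Bochner_Integration.integrable_add integrable_abs) auto
    show "(\<lambda>p. f (S (fst p) * snd p)) \<in> borel_measurable (M \<Otimes>\<^sub>M \<gamma>)" by measurable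
    show "AE p in M \<Otimes>\<^sub>M \<gamma>. norm (f (S (fst p) * snd p)) \<le> norm (\<bar>f 0\<bar> + \<bar>S (fst p) * snd p\<bar>)"
      using lip1_growth[OF f] by (intro AE_I2) simp
  qed
  have "(\<integral>\<omega>. f (S (\<pi> \<omega>) * \<eta> \<omega>) \<partial>M') = (\<integral>p. f (S (fst p) * snd p) \<partial>distr M' (M \<Otimes>\<^sub>M borel) (\<lambda>\<omega>. (\<pi> \<omega>, \<eta> \<omega>)))"
    by (subst integral_distr[OF _ m]) auto
  also have "\<dots> = (\<integral>\<omega>. (\<integral>x. f (S \<omega> * x) \<partial>\<gamma>) \<partial>M)"
    unfolding distr_\<pi>_\<eta> by (rule integral_product_std_normal(1)[OF i])
  finally show ?thesis by (simp add: gauss_scale_def)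
qed

lemma extended_lipschitz_distance:
  assumes "lip1 f"
  shows "\<bar>(\<integral>\<omega>. f (F (\<pi> \<omega>)) \<partial>M') - (\<integral>\<omega>. f (S (\<pi> \<omega>) * \<eta> \<omega>) \<partial>M')\<bar> \<le> Delta M X u F S"
  unfolding integral_F[OF assms] integral_S\<eta>[OF assms] by (rule lipschitz_distance[OF assms])

lemma small_ball:
  assumes h: "h > 0" and \<alpha>: "0 < \<alpha>" "\<alpha> \<le> 1" and fin: "neg_moment M S \<alpha> < \<infinity>"
  shows "E.prob {\<omega> \<in> space M'. y < S (\<pi> \<omega>) * \<eta> \<omega> \<and> S (\<pi> \<omega>) * \<eta> \<omega> \<le> y + h} \<le> h powr \<alpha> * enn2real (neg_moment M S \<alpha>)"
proof -
  let ?A = "{p \<in> space (M \<Otimes>\<^sub>M borel). y < S (fst p) * snd p \<and> S (fst p) * snd p \<le> y + h}"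
  have A: "?A \<in> sets (M \<Otimes>\<^sub>M borel)" by measurable
  have A': "?A \<in> sets (M \<Otimes>\<^sub>M \<gamma>)" using A by (simp cong: sets_pair_measure_cong)
  have "emeasure M' {\<omega> \<in> space M'. y < S (\<pi> \<omega>) * \<eta> \<omega> \<and> S (\<pi> \<omega>) * \<eta> \<omega> \<le> y + h}
    = emeasure (distr M' (M \<Otimes>\<^sub>M borel) (\<lambda>\<omega>. (\<pi> \<omega>, \<eta> \<omega>))) ?A"
  proof -
    have "(\<lambda>\<omega>. (\<pi> \<omega>, \<eta> \<omega>)) -` ?A \<inter> space M' = {\<omega> \<in> space M'. y < S (\<pi> \<omega>) * \<eta> \<omega> \<and> S (\<pi> \<omega>) * \<eta> \<omega> \<le> y + h}"
      using measurable_space[OF measurable_\<pi>] by (auto simp: space_pair_measure)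
    then show ?thesis using A by (subst emeasure_distr) auto
  qed
  also have "\<dots> = (\<integral>\<^sup>+\<omega>. emeasure \<gamma> (Pair \<omega> -` ?A) \<partial>M)"
    unfolding distr_\<pi>_\<eta> by (rule std_normal.emeasure_pair_measure_alt[OF A'])
  also have "\<dots> \<le> (\<integral>\<^sup>+\<omega>. ennreal (h powr \<alpha>) * (if S \<omega> = 0 then \<infinity> else ennreal (\<bar>S \<omega>\<bar> powr (- \<alpha>))) \<partial>M)"
  proof (rule nn_integral_mono)
    fix \<omega> assume \<omega>: "\<omega> \<in> space M"
    have eq: "Pair \<omega> -` ?A = {x. y < S \<omega> * x \<and> S \<omega> * x \<le> y + h}" using \<omega> by (auto simp: space_pair_measure)
    show "emeasure \<gamma> (Pair \<omega> -` ?A) \<le> ennreal (h powr \<alpha>) * (if S \<omega> = 0 then \<infinity> else ennreal (\<bar>S \<omega>\<bar> powr (- \<alpha>)))"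
    \<comment> \<open>Where \<open>S\<close> vanishes the right-hand side is infinite, since
      \<open>h powr \<alpha>\<close> is positive; the small-ball estimate handles the other
      points.\<close>
    proof (cases "S \<omega> = 0")
      case True then show ?thesis using h by (simp add: ennreal_mult_top)
    next
      case False
      then show ?thesis
        unfolding eq using std_normal_small_ball[OF False h \<alpha>, of y] by (simp add: ennreal_mult)
    qed
  qed
  also have "\<dots> = ennreal (h powr \<alpha>) * neg_moment M S \<alpha>"
    unfolding neg_moment_def by (rule nn_integral_cmult) measurable
  also have "\<dots> = ennreal (h powr \<alpha> * enn2real (neg_moment M S \<alpha>))"
    using fin by (simp add: ennreal_mult)
  finally show ?thesis by (simp add: E.emeasure_eq_measure)
qed

lemma kolmogorov_pointwise:
  assumes \<alpha>: "0 < \<alpha>" "\<alpha> \<le> 1" and fin: "neg_moment M S \<alpha> < \<infinity>"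
  shows "\<bar>E.prob {\<omega> \<in> space M'. F (\<pi> \<omega>) \<le> x} - E.prob {\<omega> \<in> space M'. S (\<pi> \<omega>) * \<eta> \<omega> \<le> x}\<bar> \<le>
    Delta M X u F S powr (\<alpha> / (\<alpha> + 1)) * (1 + enn2real (neg_moment M S \<alpha>))" (is "?D \<le> _")
proof -
  define \<Delta> where "\<Delta> = Delta M X u F S"
  define E where "E = enn2real (neg_moment M S \<alpha>)"
  have E0: "E \<ge> 0" by (simp add: E_def)
  have \<Delta>0: "\<Delta> \<ge> 0"
    using extended_lipschitz_distance[OF lip1_abs] unfolding \<Delta>_def by linarith
  have bound: "?D \<le> \<Delta> / h + h powr \<alpha> * E" if h: "h > 0" for h
    unfolding \<Delta>_def E_def
    by (rule E.prob_diff_le_lip1[OF _ _ h extended_lipschitz_distance small_ball[OF h \<alpha> fin]]) auto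
  show ?thesis
  proof (cases "\<Delta> = 0")
    case True
    have "?D \<le> 0"
    proof (rule ccontr)
      assume D: "\<not> ?D \<le> 0"
      \<comment> \<open>For \<Delta> = 0 the balancing width would be 0. With width
        \<open>k powr (1 / \<alpha>)\<close> the bound is \<open>k * E\<close>, and \<open>k\<close>
        is chosen to make \<open>k * (E + 1)\<close> half of the alleged positive value.\<close>
      define k where "k = ?D / 2 / (E + 1)"
      have k: "k > 0" using D E0 by (simp add: k_def)
      have "?D \<le> k * E" using bound[of "k powr (1 / \<alpha>)"] k \<alpha> True by (simp add: powr_powr)
      also have "\<dots> \<le> k * (E + 1)" using k by simp
      also have "\<dots> = ?D / 2"
      proof -
        have "E + 1 \<noteq> 0" using E0 by linarith
        from nonzero_divide_eq_eq[OF this, THEN iffD1, OF k_def[symmetric]] show ?thesis by (rule sym)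
      qed
      finally show False using D by simp
    qed
    then show ?thesis using True by (simp add: \<Delta>_def)
  next
    case False
    then have \<Delta>: "\<Delta> > 0" using \<Delta>0 by simp
    \<comment> \<open>This width equates \<Delta> / h with \<open>h powr \<alpha>\<close>; both
      become the power of \<Delta> in the claim.\<close>
    define h where "h = \<Delta> powr (1 / (\<alpha> + 1))"
    have "\<Delta> / h = \<Delta> powr (1 - 1 / (\<alpha> + 1))" using \<Delta> by (simp add: h_def powr_diff)
    also have "1 - 1 / (\<alpha> + 1) = \<alpha> / (\<alpha> + 1)" using \<alpha> by (simp add: field_simps)
    finally have 1: "\<Delta> / h = \<Delta> powr (\<alpha> / (\<alpha> + 1))" .
    have 2: "h powr \<alpha> = \<Delta> powr (\<alpha> / (\<alpha> + 1))" by (simp add: h_def powr_powr)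
    have "?D \<le> \<Delta> powr (\<alpha> / (\<alpha> + 1)) + \<Delta> powr (\<alpha> / (\<alpha> + 1)) * E"
      using bound[of h] \<Delta> unfolding 1 2 by (simp add: h_def)
    then show ?thesis by (simp add: \<Delta>_def E_def distrib_left)
  qed
qed

end

theorem theorem3p4:
  fixes M :: "'w measure"
    and X :: "'h::{real_inner, banach, second_countable_topology} \<Rightarrow> 'w \<Rightarrow> real"
    and F S :: "'w \<Rightarrow> real"
    and u :: "'w \<Rightarrow> 'h"
    and M' :: "'e measure"
    and \<pi> :: "'e \<Rightarrow> 'w"
    and \<eta> :: "'e \<Rightarrow> real"
  assumes infinite_dim: "\<not> (\<exists>B :: 'h set. finite B \<and> span B = UNIV)"
    and iso: "isonormal M X"
    and F: "F \<in> sobolev M X 2"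
    and F_centered: "(\<integral>\<omega>. F \<omega> \<partial>M) = 0"
    and u: "u \<in> sobolev_vec M X 2"
    and F_div: "(u, F) \<in> divergence_graph M X"
    and S: "S \<in> sobolev M X 4"
    and ext: "extension_of M' \<pi> M"
    and \<eta>_normal: "distributed M' lborel \<eta> std_normal_density"
    and \<eta>_indep: "prob_space.indep_set M' {\<eta> -` A \<inter> space M' | A. A \<in> sets borel}
      (sets (process_algebra M' (\<lambda>h \<omega>. X h (\<pi> \<omega>))))"
  shows "wasserstein_dist M' (\<lambda>\<omega>. F (\<pi> \<omega>)) (\<lambda>\<omega>. S (\<pi> \<omega>) * \<eta> \<omega>)
           \<le> ereal (Delta M X u F S) \<and>
    (\<forall>\<alpha>::real. 0 < \<alpha> \<longrightarrow> \<alpha> \<le> 1 \<longrightarrow> neg_moment M S \<alpha> < \<infinity> \<longrightarrow>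
       kolmogorov_dist M' (\<lambda>\<omega>. F (\<pi> \<omega>)) (\<lambda>\<omega>. S (\<pi> \<omega>) * \<eta> \<omega>)
         \<le> Delta M X u F S powr (\<alpha> / (\<alpha> + 1)) * (1 + enn2real (neg_moment M S \<alpha>)))"
proof -
  obtain DF where DF: "(F, DF) \<in> malliavin_graph M X 2" using F by (auto simp: sobolev_def)
  obtain DS where DS: "(S, DS) \<in> malliavin_graph M X 4" using S by (auto simp: sobolev_def)
  interpret extended_setup M X u F S DF DS M' \<pi> \<eta>
    by unfold_locales (rule iso F_div F_centered DF DS ext \<eta>_normal \<eta>_indep)+
  have "lip1 \<phi>" if "1-lipschitz_on UNIV \<phi>" for \<phi> :: "real \<Rightarrow> real"
    using that by (simp add: lip1_def lipschitz_on_def dist_real_def)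
  then have "wasserstein_dist M' (\<lambda>\<omega>. F (\<pi> \<omega>)) (\<lambda>\<omega>. S (\<pi> \<omega>) * \<eta> \<omega>) \<le> ereal (Delta M X u F S)"
    unfolding wasserstein_dist_def by (intro SUP_least) (simp add: extended_lipschitz_distance)
  moreover have "kolmogorov_dist M' (\<lambda>\<omega>. F (\<pi> \<omega>)) (\<lambda>\<omega>. S (\<pi> \<omega>) * \<eta> \<omega>)
      \<le> Delta M X u F S powr (\<alpha> / (\<alpha> + 1)) * (1 + enn2real (neg_moment M S \<alpha>))"
    if "0 < \<alpha>" "\<alpha> \<le> 1" "neg_moment M S \<alpha> < \<infinity>" for \<alpha>
    unfolding kolmogorov_dist_def by (rule cSUP_least) (use kolmogorov_pointwise[OF that] in auto)
  ultimately show ?thesis by blast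
qed

end
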